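(* Let $w$ be a group word in $n$ letters such that the associated cell complex $X(w)$ is a surface (that is, a topological $2$-manifold), and let $\rho : G \to \mathrm{GL}(V)$ be an irreducible representation of a compact group $G$, with character $\chi^\rho$. Let $\kappa$ denote the Euler characteristic of $X(w)$. If $X(w)$ is orientable, then $$\int_{G^n} \rho(w(t))\, dt = (\dim V)^{\kappa - 2}\, I;$$ if $X(w)$ is not orientable, then $$\int_{G^n} \rho(w(t))\, dt = v(\chi^\rho)^{2-\kappa} (\dim V)^{\kappa - 2}\, I,$$ where $v(\chi^\rho) := \int_G \chi^\rho(g^2)\, dg$ is the Frobenius–Schur indicator and $I$ is the identity of $V$.
   Context: Representations are continuous, finite-dimensional and over $\mathbb{C}$. Integrals over $G$ and $G^n$ are with respect to normalized Haar measure; integrals of matrices are taken entrywise. A group word $w$ in $n$ letters is an element of the free group $F_n$ on $x_1,\dots,x_n$. For $t=(t_1,\dots,t_n)\in G^n$, $w(t)\in G$ denotes the image of $w$ under the homomorphism $F_n\to G$ sending $x_i\mapsto t_i$. The cell complex $X(w)$: write $w=x_{i_1}^{\varepsilon_1}\cdots x_{i_\ell}^{\varepsilon_\ell}$ with $\varepsilon_j=\pm1$. Take a closed polygonal disk with $\ell$ sides, and going around its boundary label the $j$-th side by the letter $x_{i_j}$, directed along the direction of travel if $\varepsilon_j=1$ and against it if $\varepsilon_j=-1$. $X(w)$ is the quotient obtained by identifying all sides carrying the same letter, respecting their directions. It is a CW complex with one $2$-cell, one $1$-cell for each letter occurring in $w$, and $0$-cells the classes of polygon vertices (vertices are identified only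 as forced by the identification of sides). *)

theory Defs
  imports
    "HOL-Algebra.Group"
    "HOL-Probability.Probability"
    "HOL-Complex_Analysis.Complex_Analysis"
begin

section \<open>Compact groups and Haar measure\<close>

locale compact_group = group G for G (structure) +
  fixes T :: "'a topology"
  assumes topspace_eq: "topspace T = carrier G"
    and continuous_mult: "continuous_map (prod_topology T T) T (\<lambda>(x, y). x \<otimes> y)"
    and continuous_inv: "continuous_map T T (\<lambda>x. inv x)"
    and compact_topology: "compact_space T"
    and Hausdorff_topology: "Hausdorff_space T"

text \<open>A left-invariant regular Borel probability measure; on a compact group
  it is unique.\<close>

definition normalized_haar_measure ::
    "('a, 'b) monoid_scheme \<Rightarrow> 'a topology \<Rightarrow> 'a measure \<Rightarrow> bool" where
  "normalized_haar_measure G T \<mu> \<longleftrightarrow>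
     space \<mu> = topspace T \<and>
     sets \<mu> = sigma_sets (topspace T) {U. openin T U} \<and>
     prob_space \<mu> \<and>
     (\<forall>g\<in>carrier G. \<forall>A\<in>sets \<mu>. emeasure \<mu> ((\<lambda>x. g \<otimes>\<^bsub>G\<^esub> x) ` A) = emeasure \<mu> A) \<and>
     (\<forall>A\<in>sets \<mu>. emeasure \<mu> A = (SUP K\<in>{K. compactin T K \<and> K \<subseteq> A}. emeasure \<mu> K))"


section \<open>Representations\<close>

definition general_linear :: "(complex^'m^'m) monoid" where
  "general_linear = \<lparr>carrier = {A. invertible A}, monoid.mult = (**), one = mat 1\<rparr>"

definition representation ::
    "('a, 'b) monoid_scheme \<Rightarrow> 'a topology \<Rightarrow> ('a \<Rightarrow> complex^'m^'m) \<Rightarrow> bool" where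
  "representation G T \<rho> \<longleftrightarrow> \<rho> \<in> hom G general_linear \<and> continuous_map T euclidean \<rho>"

text \<open>The space \<open>complex^'m\<close> is never zero, as \<open>'m\<close> is inhabited.\<close>

definition irreducible_representation ::
    "('a, 'b) monoid_scheme \<Rightarrow> 'a topology \<Rightarrow> ('a \<Rightarrow> complex^'m^'m) \<Rightarrow> bool" where
  "irreducible_representation G T \<rho> \<longleftrightarrow>
     representation G T \<rho> \<and>
     (\<forall>W :: (complex^'m) set.
        vec.subspace W \<and> (\<forall>g\<in>carrier G. \<forall>x\<in>W. \<rho> g *v x \<in> W) \<longrightarrow> W = {0} \<or> W = UNIV)"

definition character :: "('a \<Rightarrow> complex^'m^'m) \<Rightarrow> 'a \<Rightarrow> complex" where
  "character \<rho> g = trace (\<rho> g)"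

definition frobenius_schur ::
    "('a, 'b) monoid_scheme \<Rightarrow> 'a measure \<Rightarrow> ('a \<Rightarrow> complex) \<Rightarrow> complex" where
  "frobenius_schur G \<mu> f = (LINT g|\<mu>. f (g [^]\<^bsub>G\<^esub> (2::nat)))"

definition matrix_integral :: "'x measure \<Rightarrow> ('x \<Rightarrow> complex^'m^'m) \<Rightarrow> complex^'m^'m" where
  "matrix_integral M F = (\<chi> i j. LINT x|M. F x $ i $ j)"


section \<open>Group words\<close>

text \<open>The pair \<open>(i, True)\<close> stands for the letter with index \<open>i\<close> and \<open>(i, False)\<close> for its
  inverse. A list is an expression of an element of the free group and need not be reduced.
  Letters are numbered from 0.\<close>

type_synonym group_word = "(nat \<times> bool) list"

definition word_letters :: "group_word \<Rightarrow> nat set" where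
  "word_letters w = fst ` set w"

definition word_eval :: "('a, 'b) monoid_scheme \<Rightarrow> group_word \<Rightarrow> (nat \<Rightarrow> 'a) \<Rightarrow> 'a" where
  "word_eval G w t =
     foldr (\<lambda>(i, positive) g. (if positive then t i else inv\<^bsub>G\<^esub> (t i)) \<otimes>\<^bsub>G\<^esub> g) w \<one>\<^bsub>G\<^esub>"


section \<open>Topological surfaces\<close>

definition quotient_topology :: "'a topology \<Rightarrow> ('a \<times> 'a) set \<Rightarrow> 'a set topology" where
  "quotient_topology X r =
     topology (\<lambda>S. S \<subseteq> topspace X // r \<and> openin X {x \<in> topspace X. r `` {x} \<in> S})"

lemma openin_quotient_topology:
  "openin (quotient_topology X r) S \<longleftrightarrow>
     S \<subseteq> topspace X // r \<and> openin X {x \<in> topspace X. r `` {x} \<in> S}"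
proof -
  have "istopology (\<lambda>S. S \<subseteq> topspace X // r \<and> openin X {x \<in> topspace X. r `` {x} \<in> S})"
    unfolding istopology_def
  proof (intro conjI allI impI)
    fix S S'
    assume "S \<subseteq> topspace X // r \<and> openin X {x \<in> topspace X. r `` {x} \<in> S}"
      and "S' \<subseteq> topspace X // r \<and> openin X {x \<in> topspace X. r `` {x} \<in> S'}"
    moreover have "{x \<in> topspace X. r `` {x} \<in> S \<inter> S'} =
        {x \<in> topspace X. r `` {x} \<in> S} \<inter> {x \<in> topspace X. r `` {x} \<in> S'}"
      by blast
    ultimately show "S \<inter> S' \<subseteq> topspace X // r"
      and "openin X {x \<in> topspace X. r `` {x} \<in> S \<inter> S'}"
      by auto
  next
    fix \<K>
    assume *: "\<forall>K\<in>\<K>. K \<subseteq> topspace X // r \<and> openin X {x \<in> topspace X. r `` {x} \<in> K}"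
    show "\<Union>\<K> \<subseteq> topspace X // r"
      using * by blast
    have "{x \<in> topspace X. r `` {x} \<in> \<Union>\<K>} = (\<Union>K\<in>\<K>. {x \<in> topspace X. r `` {x} \<in> K})"
      by blast
    then show "openin X {x \<in> topspace X. r `` {x} \<in> \<Union>\<K>}"
      using * by auto
  qed
  then show ?thesis
    by (simp add: quotient_topology_def topology_inverse')
qed

definition second_countable_space :: "'a topology \<Rightarrow> bool" where
  "second_countable_space X \<longleftrightarrow>
     (\<exists>\<B>. countable \<B> \<and> (\<forall>B\<in>\<B>. openin X B) \<and>
        (\<forall>U x. openin X U \<and> x \<in> U \<longrightarrow> (\<exists>B\<in>\<B>. x \<in> B \<and> B \<subseteq> U)))"

text \<open>The Euclidean plane is taken to be \<open>\<complex>\<close>.\<close>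

definition planar_chart :: "'a topology \<Rightarrow> 'a set \<times> ('a \<Rightarrow> complex) \<Rightarrow> bool" where
  "planar_chart X = (\<lambda>(U, \<phi>).
     openin X U \<and> open (\<phi> ` U) \<and> homeomorphic_map (subtopology X U) (top_of_set (\<phi> ` U)) \<phi>)"

text \<open>A topological 2-manifold, without boundary.\<close>

definition surface :: "'a topology \<Rightarrow> bool" where
  "surface X \<longleftrightarrow>
     Hausdorff_space X \<and> second_countable_space X \<and>
     (\<forall>x\<in>topspace X. \<exists>U \<phi>. planar_chart X (U, \<phi>) \<and> x \<in> U)"

text \<open>Local degree 1 everywhere, for a homeomorphism \<open>f\<close> between open subsets of the plane: small
  counterclockwise circles about \<open>z\<close> are mapped to loops winding once counterclockwise
  about \<open>f z\<close>.\<close>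

definition orientation_preserving_on :: "complex set \<Rightarrow> (complex \<Rightarrow> complex) \<Rightarrow> bool" where
  "orientation_preserving_on S f \<longleftrightarrow>
     (\<forall>z r. 0 < r \<and> cball z r \<subseteq> S \<longrightarrow> winding_number (f \<circ> circlepath z r) (f z) = 1)"

text \<open>Orientability of a surface: there is an atlas all of whose transition maps preserve
  orientation.\<close>

definition orientable :: "'a topology \<Rightarrow> bool" where
  "orientable X \<longleftrightarrow>
     (\<exists>\<A>. (\<forall>c\<in>\<A>. planar_chart X c) \<and> topspace X = (\<Union>(U, \<phi>)\<in>\<A>. U) \<and>
        (\<forall>(U, \<phi>)\<in>\<A>. \<forall>(V, \<psi>)\<in>\<A>.
           orientation_preserving_on (\<phi> ` (U \<inter> V)) (\<psi> \<circ> inv_into U \<phi>)))"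


section \<open>The cell complex of a word\<close>

text \<open>The polygon with \<open>\<ell>\<close> sides is the closed unit disk with its boundary circle divided into
  \<open>\<ell>\<close> equal arcs (this also covers \<open>\<ell> = 1\<close> and \<open>\<ell> = 2\<close>). The \<open>j\<close>-th side runs
  counterclockwise from \<open>cis (2 * pi * j / \<ell>)\<close> to \<open>cis (2 * pi * (j + 1) / \<ell>)\<close>. Below it is
  parametrised over \<open>{0..1}\<close> along the direction of its label, hence backwards if the
  exponent is negative.\<close>

definition side_point :: "group_word \<Rightarrow> nat \<Rightarrow> real \<Rightarrow> complex" where
  "side_point w j u =
     cis (2 * pi * (real j + (if snd (w ! j) then u else 1 - u)) / real (length w))"

definition side_pairs :: "group_word \<Rightarrow> (complex \<times> complex) set" where
  "side_pairs w =
     {(side_point w j u, side_point w k u) |j k u.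
        j < length w \<and> k < length w \<and> fst (w ! j) = fst (w ! k) \<and> 0 \<le> u \<and> u \<le> 1}"

definition gluing :: "group_word \<Rightarrow> (complex \<times> complex) set" where
  "gluing w = Id_on (cball 0 1) \<union> (side_pairs w)\<^sup>+"

lemma equiv_gluing: "equiv (cball 0 1) (gluing w)"
proof -
  have "side_pairs w \<subseteq> cball 0 1 \<times> cball 0 1"
    by (auto simp: side_pairs_def side_point_def)
  then have sub: "(side_pairs w)\<^sup>+ \<subseteq> cball 0 1 \<times> cball 0 1"
    by (rule trancl_subset_Sigma)
  have "sym (side_pairs w)"
    unfolding sym_def side_pairs_def by fastforce
  then have "sym ((side_pairs w)\<^sup>+)"
    by (rule sym_trancl)
  then have "sym (gluing w)"
    by (auto simp: gluing_def intro: sym_Un)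
  moreover have "trans (gluing w)"
    unfolding gluing_def trans_def by (auto dest: trancl_trans)
  moreover have "refl_on (cball 0 1) (gluing w)"
    unfolding gluing_def refl_on_def by auto
  ultimately show ?thesis
    using sub by (auto simp: equiv_def gluing_def)
qed

definition word_complex :: "group_word \<Rightarrow> complex set topology" where
  "word_complex w = quotient_topology (top_of_set (cball 0 1)) (gluing w)"

definition zero_cells :: "group_word \<Rightarrow> complex set set" where
  "zero_cells w =
     (\<lambda>j. gluing w `` {cis (2 * pi * real j / real (length w))}) ` {..<length w}"

text \<open>The alternating sum of the numbers of cells: one 1-cell for each letter that occurs, and
  a single 2-cell.\<close>

definition euler_characteristic :: "group_word \<Rightarrow> int" where
  "euler_characteristic w = int (card (zero_cells w)) - int (card (word_letters w)) + 1"

end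

theory Submission
  imports Defs "HOL-Computational_Algebra.Fundamental_Theorem_Algebra"
begin

text \<open>The integral factorises over the letters once every letter occurs exactly twice in \<open>w\<close>, because then
only second moments of the matrix entries of \<open>\<rho>\<close> enter. Both halves of the argument, the topology that
produces this shape of \<open>w\<close> and the representation theory that evaluates it, meet in the three numbers
\<open>E\<close>, \<open>N\<close>, \<open>v\<close> of the relation \<open>word_reduction\<close>.

\<^emph>\<open>Representation theory.\<close> Schur's lemma gives, with \<open>d = dim V\<close> and \<open>\<nu>\<close> the Frobenius-Schur indicator,
\<open>\<integral> \<rho>(g) A \<rho>(g\<inverse>) dg = tr(A)/d\<close> and \<open>\<integral> \<rho>(g) A \<rho>(g) dg = (\<nu>/d) A\<^sup>*\<close>, where \<open>\<nu> \<in> {0, 1, -1}\<close> and, unless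
\<open>\<nu> = 0\<close>, \<open>A \<mapsto> A\<^sup>*\<close> is an anti-automorphism with \<open>\<rho>(g)\<^sup>* = \<rho>(g\<inverse>)\<close>. Integrating out one or two letters
at a time therefore replaces \<open>a x u x b\<close> by \<open>a u\<inverse> b\<close> with a factor \<open>\<nu>/d\<close>, cancels \<open>x x\<inverse>\<close> with a factor \<open>1\<close>,
and removes a pair of linked letters \<open>x\<close>, \<open>y\<close> from \<open>x y u x\<inverse> \<dots> y\<inverse>\<close> with a factor \<open>1/d\<^sup>2\<close>. Every word in which
each letter occurs twice is exhausted by these steps (\<open>word_reduction_exists\<close>), and the integral is
\<open>\<nu>\<^sup>N (1/d)\<^sup>E d\<^sup>v\<close> times the identity (\<open>matrix_integral_word_matrix\<close>).

\<^emph>\<open>Euler characteristic.\<close> \<open>E\<close> is the number of letters, and \<open>v + 1\<close> is the number of vertices of the complex.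
To see the latter without following vertices through the reduction steps, the evaluation is carried out for
matrices that satisfy the same second moment identities and need not come from a group: two-by-two matrices of
independent random signs, with the transpose in the role of the inverse. There the expected trace of \<open>w\<close> is
\<open>2\<^bsup>v + 1\<^esup>\<close> by the reduction, while expanding the trace as a sum over index paths around the polygon
counts the labelings of the glued vertices by two symbols (\<open>card_zero_cells\<close>).
Since \<open>N\<close> has the parity of \<open>E - v\<close>, and both are positive when a letter occurs twice with the same sign,
\<open>\<nu>\<^sup>N\<close> is the power of \<open>\<nu>\<close> in the statement.

\<^emph>\<open>Topology.\<close> Near an interior point of a side the complex is a book of half disks, one page for each
occurrence of the letter, and invariance of domain allows exactly two pages in a surface
(\<open>surface_letter_twice\<close>, \<open>surface_letter_at_most_twice\<close>). Charts are compared with the open disk through the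
local degree, a winding number that is \<open>\<plusminus>1\<close>, locally constant and multiplicative. Crossing a side changes the
degree of a chart precisely when the two occurrences of its letter have the same sign. So an oriented atlas
forces opposite signs (\<open>orientable_opposite_signs\<close>); conversely, for opposite signs, the degree is constant on a
small punctured disk around any point, also around a vertex, and the charts of degree \<open>1\<close> form an
oriented atlas (\<open>opposite_signs_orientable\<close>).\<close>

no_notation fps_nth (infixl "$" 75)

section \<open>Local degree of planar embeddings\<close>

definition planar_embedding :: "complex set \<Rightarrow> (complex \<Rightarrow> complex) \<Rightarrow> bool" where
  "planar_embedding S f \<longleftrightarrow> open S \<and> continuous_on S f \<and> inj_on f S"

text \<open>Only small circles are used, so that the degree depends on the germ of \<open>f\<close> at \<open>z\<close> alone.
For an embedding every circle whose disk lies in the domain gives the same value.\<close>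

definition has_local_degree :: "(complex \<Rightarrow> complex) \<Rightarrow> complex \<Rightarrow> complex \<Rightarrow> bool" where
  "has_local_degree f z k \<longleftrightarrow>
     (\<forall>\<^sub>F r in at_right 0. winding_number (f \<circ> circlepath z r) (f z) = k)"

lemma planar_embedding_subset:
  "planar_embedding S f \<Longrightarrow> open S' \<Longrightarrow> S' \<subseteq> S \<Longrightarrow> planar_embedding S' f"
  unfolding planar_embedding_def by (meson continuous_on_subset inj_on_subset)

lemma planar_embedding_small_disk:
  assumes f: "planar_embedding S f" "z \<in> S" and R: "0 < R"
  obtains d where "0 < d" "cball z d \<subseteq> S" "f ` cball z d \<subseteq> cball (f z) R"
proof -
  have opS: "open S" using f(1) by (simp add: planar_embedding_def)
  obtain r where r: "r > 0" "cball z r \<subseteq> S" using opS f(2) open_contains_cball by blast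
  have "continuous (at z) f" using f opS by (simp add: planar_embedding_def continuous_on_eq_continuous_at)
  then obtain e where e: "0 < e" "\<And>w. dist w z < e \<Longrightarrow> dist (f w) (f z) < R"
    using R by (auto simp: continuous_at_eps_delta dist_commute)
  show ?thesis
    using r e by (intro that[of "min (e/2) r"]) (auto simp: dist_commute less_imp_le subset_iff)
qed

lemma planar_embedding_compose:
  assumes "planar_embedding S f" "planar_embedding S' g" "f ` S \<subseteq> S'"
  shows "planar_embedding S (g \<circ> f)"
  using assms unfolding planar_embedding_def
  by (meson comp_inj_on continuous_on_compose continuous_on_subset inj_on_subset)

lemma planar_embedding_open_image:
  assumes "planar_embedding S f" shows "open (f ` S)"
  using assms invariance_of_domain unfolding planar_embedding_def by blast

text \<open>Loops with equal winding number are homotopic in the punctured plane. The radial retraction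
onto the punctured disk moves the homotopy into the domain of \<open>g\<close>, and injectivity of \<open>g\<close> makes its image
avoid \<open>g z\<close>.\<close>

lemma winding_number_image_loop_eq:
  assumes g: "continuous_on (cball z R) g" "inj_on g (cball z R)" and R: "0 < R"
    and p: "path p" "pathfinish p = pathstart p" "path_image p \<subseteq> cball z R - {z}"
    and q: "path q" "pathfinish q = pathstart q" "path_image q \<subseteq> cball z R - {z}"
    and eq: "winding_number p z = winding_number q z"
  shows "winding_number (g \<circ> p) (g z) = winding_number (g \<circ> q) (g z)"
proof -
  \<comment> \<open>the radial retraction of the punctured plane onto the punctured disk\<close>
  define h where "h = (\<lambda>w. z + complex_of_real (min 1 (R / norm (w - z))) * (w - z))"
  have hom: "homotopic_loops (- {z}) p q"
    using winding_number_homotopic_loops_eq[of p z q] p q eq by blast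
  have h_id: "h w = w" if "w \<in> cball z R - {z}" for w
  proof -
    have "1 \<le> R / norm (w - z)" using that by (auto simp: dist_norm norm_minus_commute)
    then show ?thesis by (simp add: h_def min_def)
  qed
  have h_ran: "h w \<in> cball z R - {z}" if "w \<noteq> z" for w
  proof -
    have n: "norm (w - z) > 0" using that by simp
    have m: "0 < min 1 (R / norm (w - z))" using n R by simp
    have "norm (h w - z) = min 1 (R / norm (w - z)) * norm (w - z)"
      using m by (simp add: h_def norm_mult)
    also have "\<dots> \<le> R / norm (w - z) * norm (w - z)"
      by (intro mult_right_mono) auto
    also have "\<dots> = R" using n by simp
    finally have "norm (h w - z) \<le> R" .
    moreover have "h w \<noteq> z" using m n by (simp add: h_def)
    ultimately show ?thesis by (simp add: dist_norm norm_minus_commute)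
  qed
  have h_cont: "continuous_on (- {z}) h"
    unfolding h_def by (intro continuous_intros) auto
  have "homotopic_loops (cball z R - {z}) (h \<circ> p) (h \<circ> q)"
    by (rule homotopic_loops_continuous_image[OF hom h_cont]) (use h_ran in auto)
  moreover have "continuous_on (cball z R - {z}) g"
    using g(1) continuous_on_subset by blast
  moreover have "g \<in> (cball z R - {z}) \<rightarrow> - {g z}"
    using g(2) R by (auto simp: inj_on_def Pi_iff)
  ultimately have "homotopic_loops (- {g z}) (g \<circ> (h \<circ> p)) (g \<circ> (h \<circ> q))"
    by (rule homotopic_loops_continuous_image)
  then have "winding_number (g \<circ> (h \<circ> p)) (g z) = winding_number (g \<circ> (h \<circ> q)) (g z)"
    by (rule winding_number_homotopic_loops)
  moreover have "winding_number (g \<circ> (h \<circ> p)) (g z) = winding_number (g \<circ> p) (g z)"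
    by (rule winding_number_cong) (metis atLeastAtMost_iff comp_apply h_id image_subset_iff p(3) path_image_def)
  moreover have "winding_number (g \<circ> (h \<circ> q)) (g z) = winding_number (g \<circ> q) (g z)"
    by (rule winding_number_cong) (metis atLeastAtMost_iff comp_apply h_id image_subset_iff q(3) path_image_def)
  ultimately show ?thesis by simp
qed

lemma winding_number_image_circle_radius:
  assumes "planar_embedding S f" "cball z r \<subseteq> S" "cball z s \<subseteq> S" "0 < r" "0 < s"
  shows "winding_number (f \<circ> circlepath z r) (f z) = winding_number (f \<circ> circlepath z s) (f z)"
proof (rule winding_number_image_loop_eq[where R = "max r s"])
  have "cball z (max r s) \<subseteq> S" using assms by (auto simp: max_def)
  then show "continuous_on (cball z (max r s)) f" "inj_on f (cball z (max r s))"
    using assms(1) unfolding planar_embedding_def by (meson continuous_on_subset inj_on_subset)+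
  show "winding_number (circlepath z r) z = winding_number (circlepath z s) z"
    using assms by (simp add: winding_number_circlepath_centre)
qed (use assms in \<open>auto simp: path_image_circlepath dist_norm norm_minus_commute\<close>)

lemma has_local_degree_iff:
  assumes "planar_embedding S f" "cball z r \<subseteq> S" "0 < r"
  shows "has_local_degree f z k \<longleftrightarrow> winding_number (f \<circ> circlepath z r) (f z) = k"
proof -
  have "\<forall>\<^sub>F s in at_right 0. winding_number (f \<circ> circlepath z s) (f z)
          = winding_number (f \<circ> circlepath z r) (f z)"
    unfolding eventually_at_right_field
  proof (intro exI[of _ r] conjI allI impI)
    fix s :: real assume "0 < s" "s < r"
    moreover from this have "cball z s \<subseteq> S" using assms(2) by (force simp: subset_iff)
    ultimately show "winding_number (f \<circ> circlepath z s) (f z)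
          = winding_number (f \<circ> circlepath z r) (f z)"
      using winding_number_image_circle_radius[OF assms(1) _ assms(2)] assms(3) by blast
  qed (use assms in auto)
  then have "has_local_degree f z k \<longleftrightarrow>
      (\<forall>\<^sub>F s::real in at_right 0. winding_number (f \<circ> circlepath z r) (f z) = k)"
    unfolding has_local_degree_def by (intro eventually_cong) (auto elim: eventually_mono)
  then show ?thesis by simp
qed

lemma has_local_degree_unique:
  assumes "has_local_degree f z k" "has_local_degree f z l" shows "k = l"
proof -
  have "\<forall>\<^sub>F r::real in at_right 0. k = l"
    using assms unfolding has_local_degree_def by eventually_elim simp
  then show ?thesis by simp
qed

lemma has_local_degree_cong:
  assumes "open S" "z \<in> S" "\<And>w. w \<in> S \<Longrightarrow> f w = g w"
  shows "has_local_degree f z k \<longleftrightarrow> has_local_degree g z k"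
proof -
  obtain r where r: "r > 0" "cball z r \<subseteq> S" using assms open_contains_cball by blast
  have "\<forall>\<^sub>F s in at_right 0. winding_number (f \<circ> circlepath z s) (f z)
          = winding_number (g \<circ> circlepath z s) (g z)"
    unfolding eventually_at_right_field
  proof (intro exI[of _ r] conjI allI impI)
    fix s :: real assume s: "0 < s" "s < r"
    have "circlepath z s t \<in> S" if "0 \<le> t" "t \<le> 1" for t
    proof -
      have "circlepath z s t \<in> path_image (circlepath z s)"
        using that by (auto simp: path_image_def)
      then show ?thesis using r s by (auto simp: path_image_circlepath subset_iff dist_norm norm_minus_commute)
    qed
    then have "winding_number (f \<circ> circlepath z s) (f z) = winding_number (g \<circ> circlepath z s) (f z)"
      using assms(3) by (intro winding_number_cong) auto
    then show "winding_number (f \<circ> circlepath z s) (f z) = winding_number (g \<circ> circlepath z s) (g z)"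
      using assms by simp
  qed (use r in auto)
  then show ?thesis
    unfolding has_local_degree_def by (intro eventually_cong) (auto elim: eventually_mono)
qed

lemma path_image_circle_embedding:
  assumes "planar_embedding S f" "cball z r \<subseteq> S" "0 < r"
  shows "path (f \<circ> circlepath z r)" "pathfinish (f \<circ> circlepath z r) = pathstart (f \<circ> circlepath z r)"
    "f z \<notin> path_image (f \<circ> circlepath z r)"
    "path_image (f \<circ> circlepath z r) \<subseteq> f ` S"
    "simple_path (f \<circ> circlepath z r)"
proof -
  have sp: "sphere z r \<subseteq> S" "z \<in> S" using assms by auto
  then have c: "continuous_on (sphere z r) f" and i: "inj_on f (sphere z r)" "inj_on f S"
    using assms(1) unfolding planar_embedding_def by (meson continuous_on_subset inj_on_subset)+
  show "path (f \<circ> circlepath z r)"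
    by (rule path_continuous_image) (use c assms in \<open>auto simp: path_image_circlepath\<close>)
  show "pathfinish (f \<circ> circlepath z r) = pathstart (f \<circ> circlepath z r)"
    by (simp add: pathfinish_compose pathstart_compose)
  have pi: "path_image (f \<circ> circlepath z r) = f ` sphere z r"
    using assms(3) by (simp add: path_image_compose)
  have "z \<notin> sphere z r" using assms(3) by simp
  then show "f z \<notin> path_image (f \<circ> circlepath z r)"
    unfolding pi using inj_on_image_mem_iff[OF i(2) sp(2,1)] by blast
  show "path_image (f \<circ> circlepath z r) \<subseteq> f ` S"
    unfolding pi using sp by blast
  show "simple_path (f \<circ> circlepath z r)"
    by (rule simple_path_continuous_image) (use c i assms in \<open>auto simp: path_image_circlepath simple_path_circlepath\<close>)
qed

text \<open>The image of the circle is a simple closed curve, so that only the value \<open>0\<close> has to be excluded.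
If it occurred, the inverse of \<open>f\<close> could not tell the image of the circle from a constant loop, and the circle
itself would have winding number \<open>0\<close> about its centre.\<close>

lemma winding_number_image_circle_cases:
  assumes f: "planar_embedding S f" "cball z r \<subseteq> S" "0 < r"
  shows "winding_number (f \<circ> circlepath z r) (f z) \<in> {-1, 1}"
proof -
  let ?\<gamma> = "f \<circ> circlepath z r"
  note props = path_image_circle_embedding[OF f]
  have "winding_number ?\<gamma> (f z) \<noteq> 0"
  proof
    assume zero: "winding_number ?\<gamma> (f z) = 0"
    have opB: "open (f ` S)" by (rule planar_embedding_open_image[OF f(1)])
    obtain g where g: "homeomorphism S (f ` S) f g"
      using invariance_of_domain_homeomorphism[of S f] f(1) unfolding planar_embedding_def by auto
    obtain R where R: "0 < R" "cball (f z) R \<subseteq> f ` S"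
      using opB f by (metis open_contains_cball centre_in_cball imageI less_eq_real_def subsetD)
    have zS: "z \<in> S" using f(2,3) by auto
    obtain d where d: "0 < d" "cball z d \<subseteq> S" "f ` cball z d \<subseteq> cball (f z) R"
      using planar_embedding_small_disk[OF f(1) zS R(1)] .
    let ?\<delta> = "f \<circ> circlepath z d"
    note propsd = path_image_circle_embedding[OF f(1) d(2,1)]
    have z0: "winding_number ?\<delta> (f z) = 0"
      using zero winding_number_image_circle_radius[OF f(1,2) d(2) f(3) d(1)] by simp
    obtain a where a: "a \<in> cball (f z) R" "a \<noteq> f z"
      using R(1) by (intro that[of "f z + of_real R"]) (auto simp: dist_norm)
    have gc: "continuous_on (cball (f z) R) g" "inj_on g (cball (f z) R)"
      using g R(2) unfolding homeomorphism_def by (meson continuous_on_subset, metis inj_on_inverseI subsetD)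
    have "winding_number (g \<circ> ?\<delta>) (g (f z)) = winding_number (g \<circ> (\<lambda>t. a)) (g (f z))"
    proof (rule winding_number_image_loop_eq[OF gc R(1)])
      show "path_image ?\<delta> \<subseteq> cball (f z) R - {f z}"
        proof -
      have "path_image ?\<delta> = f ` sphere z d" using d(1) by (simp add: path_image_compose path_image_circlepath)
      then show ?thesis using propsd(3) d(3) sphere_cball[of z d] by blast
    qed
      show "winding_number ?\<delta> (f z) = winding_number (\<lambda>t. a) (f z)"
        using z0 a by (simp add: winding_number_zero_const)
    qed (use propsd a in \<open>auto simp: path_image_def pathstart_def pathfinish_def path_def\<close>)
    also have "\<dots> = 0"
    proof -
      have "g a \<noteq> g (f z)" using gc(2) a R(1) by (auto simp: inj_on_def)
      then show ?thesis by (simp add: o_def winding_number_zero_const)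
    qed
    finally have "winding_number (g \<circ> ?\<delta>) (g (f z)) = 0" .
    moreover have "winding_number (g \<circ> ?\<delta>) (g (f z)) = winding_number (circlepath z d) z"
    proof -
      have gf: "g (f w) = w" if "w \<in> S" for w using g that by (simp add: homeomorphism_def)
      have "winding_number (g \<circ> ?\<delta>) z = winding_number (circlepath z d) z"
      proof (rule winding_number_cong)
        fix t :: real assume "0 \<le> t" "t \<le> 1"
        then have "circlepath z d t \<in> path_image (circlepath z d)" by (auto simp: path_image_def)
        then have "circlepath z d t \<in> S" using d by (auto simp: path_image_circlepath)
        then show "(g \<circ> ?\<delta>) t = circlepath z d t" using gf by simp
      qed
      moreover have "z \<in> S" using f(2,3) by auto
      then have "g (f z) = z" by (rule gf)
      ultimately show ?thesis by simp
    qed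
    ultimately show False using d(1) by (simp add: winding_number_circlepath_centre)
  qed
  then show ?thesis
    using simple_closed_path_winding_number_cases[OF props(5,2,3)] unfolding insert_iff empty_iff by blast
qed

lemma has_local_degree_exists:
  assumes "planar_embedding S f" "z \<in> S"
  obtains k where "has_local_degree f z k" "k \<in> {-1, 1}"
proof -
  obtain r where "r > 0" "cball z r \<subseteq> S"
    using assms unfolding planar_embedding_def by (meson open_contains_cball)
  then show ?thesis
    using that has_local_degree_iff[OF assms(1)] winding_number_image_circle_cases[OF assms(1)] by blast
qed

text \<open>As the degree of \<open>f\<close> is \<open>\<plusminus>1\<close>, the image under \<open>f\<close> of a small circle has the same winding number
about \<open>f z\<close> as a circle or a reversed circle, and \<open>g\<close> preserves such equalities.\<close>

lemma has_local_degree_compose: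
  assumes f: "planar_embedding S f" "z \<in> S" "has_local_degree f z k"
    and g: "planar_embedding S' g" "f z \<in> S'" "has_local_degree g (f z) l"
  shows "has_local_degree (g \<circ> f) z (l * k)"
proof -
  obtain R where R: "0 < R" "cball (f z) R \<subseteq> S'"
    using g unfolding planar_embedding_def by (meson open_contains_cball)
  have opS: "open S" using f(1) by (simp add: planar_embedding_def)
  obtain d where d: "0 < d" "cball z d \<subseteq> S" "f ` cball z d \<subseteq> cball (f z) R"
    using planar_embedding_small_disk[OF f(1,2) R(1)] .
  let ?\<delta> = "f \<circ> circlepath z d" and ?c = "circlepath (f z) R"
  note propsd = path_image_circle_embedding[OF f(1) d(2,1)]
  have k: "winding_number ?\<delta> (f z) = k"
    using has_local_degree_iff[OF f(1) d(2,1)] f(3) by simp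
  have l: "winding_number (g \<circ> ?c) (g (f z)) = l"
    using has_local_degree_iff[OF g(1) R(2,1)] g(3) by simp
  have gc: "continuous_on (cball (f z) R) g" "inj_on g (cball (f z) R)"
    using g(1) R(2) unfolding planar_embedding_def by (meson continuous_on_subset inj_on_subset)+
  have sub: "path_image ?\<delta> \<subseteq> cball (f z) R - {f z}"
    proof -
      have "path_image ?\<delta> = f ` sphere z d" using d(1) by (simp add: path_image_compose path_image_circlepath)
      then show ?thesis using propsd(3) d(3) sphere_cball[of z d] by blast
    qed
  have kc: "k \<in> {-1, 1}" using winding_number_image_circle_cases[OF f(1) d(2,1)] k by simp
  note propsc = path_image_circle_embedding[OF g(1) R(2,1)]
  have "winding_number (g \<circ> ?\<delta>) (g (f z)) = l * k"
  proof (cases "k = 1")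
    case True
    have "winding_number (g \<circ> ?\<delta>) (g (f z)) = winding_number (g \<circ> ?c) (g (f z))"
      by (rule winding_number_image_loop_eq[OF gc R(1)])
        (use propsd sub R k True in \<open>auto simp: path_image_circlepath winding_number_circlepath_centre dist_norm norm_minus_commute\<close>)
    then show ?thesis using l True by simp
  next
    case False
    then have km: "k = -1" using kc by simp
    have "winding_number (g \<circ> ?\<delta>) (g (f z)) = winding_number (g \<circ> reversepath ?c) (g (f z))"
      by (rule winding_number_image_loop_eq[OF gc R(1)])
        (use propsd sub R k km in \<open>auto simp: path_image_circlepath winding_number_circlepath_centre
            dist_norm norm_minus_commute winding_number_reversepath\<close>)
    also have "g \<circ> reversepath ?c = reversepath (g \<circ> ?c)" by (auto simp: reversepath_def)
    finally have "winding_number (g \<circ> ?\<delta>) (g (f z)) = winding_number (reversepath (g \<circ> ?c)) (g (f z))" .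
    then show ?thesis using l km winding_number_reversepath[OF propsc(1,3)] by simp
  qed
  moreover 
  have "planar_embedding (ball z d) (g \<circ> f)"
  proof (rule planar_embedding_compose)
    show "planar_embedding (ball z d) f" by (rule planar_embedding_subset[OF f(1)]) (use d(2) in auto)
    show "f ` ball z d \<subseteq> S'" using d(3) R(2) ball_subset_cball[of z d] by blast
  qed fact
  moreover have "cball z (d/2) \<subseteq> ball z d" "0 < d/2" using d(1) by auto
  ultimately have *: "has_local_degree (g \<circ> f) z m \<longleftrightarrow> winding_number ((g \<circ> f) \<circ> circlepath z (d/2)) ((g \<circ> f) z) = m" for m
    by (intro has_local_degree_iff)
  have "winding_number (g \<circ> (f \<circ> circlepath z (d/2))) (g (f z)) = winding_number (g \<circ> ?\<delta>) (g (f z))"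
  proof (rule winding_number_image_loop_eq[OF gc R(1)])
    have d2: "cball z (d/2) \<subseteq> S" "0 < d/2" using d by (auto simp: subset_iff)
    note p2 = path_image_circle_embedding[OF f(1) d2]
    show "path (f \<circ> circlepath z (d/2))" "pathfinish (f \<circ> circlepath z (d/2)) = pathstart (f \<circ> circlepath z (d/2))"
      using p2 by auto
    show "path_image (f \<circ> circlepath z (d/2)) \<subseteq> cball (f z) R - {f z}"
      proof -
      have "path_image (f \<circ> circlepath z (d/2)) = f ` sphere z (d/2)" using d(1) by (simp add: path_image_compose path_image_circlepath)
      moreover have "sphere z (d/2) \<subseteq> cball z d" using d(1) by auto
      ultimately show ?thesis using p2(3) d(3) by blast
    qed
    show "winding_number (f \<circ> circlepath z (d/2)) (f z) = winding_number ?\<delta> (f z)"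
      using winding_number_image_circle_radius[OF f(1) d2(1) d(2) d2(2) d(1)] .
  qed (use propsd sub in auto)
  then show ?thesis
    unfolding * comp_assoc o_apply[of g f] using \<open>winding_number (g \<circ> ?\<delta>) (g (f z)) = l * k\<close> by (rule trans)
qed

text \<open>When the centre of a circle of fixed radius moves a little, the loop \<open>f \<circ> circlepath w r\<close> seen from
\<open>f w\<close> changes uniformly by less than its distance from \<open>0\<close>.\<close>

lemma has_local_degree_locally_constant:
  assumes f: "planar_embedding S f" "z \<in> S" "has_local_degree f z k"
  shows "\<exists>d>0. ball z d \<subseteq> S \<and> (\<forall>w\<in>ball z d. has_local_degree f w k)"
proof -
  have opS: "open S" using f(1) by (simp add: planar_embedding_def)
  obtain R where R: "0 < R" "cball z R \<subseteq> S" using opS f(2) open_contains_cball by blast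
  define r where "r = R / 2"
  have r: "0 < r" "cball z r \<subseteq> S" using R by (auto simp: r_def subset_iff)
  have cont: "continuous_on (cball z R) f"
    using f(1) R(2) unfolding planar_embedding_def by (meson continuous_on_subset)
  have uc: "uniformly_continuous_on (cball z R) f"
    by (rule compact_uniformly_continuous[OF cont]) simp
  note props = path_image_circle_embedding[OF f(1) r(2,1)]
  obtain m where m: "0 < m" "\<And>y. y \<in> path_image (f \<circ> circlepath z r) \<Longrightarrow> m \<le> dist (f z) y"
    using separate_point_closed[OF closed_path_image[OF props(1)] props(3)] by auto
  obtain d where d: "0 < d" "\<And>x y. x \<in> cball z R \<Longrightarrow> y \<in> cball z R \<Longrightarrow> dist y x < d \<Longrightarrow> dist (f y) (f x) < m / 2"
    using uc m(1) unfolding uniformly_continuous_on_def by (meson half_gt_zero)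
  define e where "e = min d r"
  have e: "0 < e" "ball z e \<subseteq> S" using d r by (auto simp: e_def subset_iff)
  have "has_local_degree f w k" if w: "w \<in> ball z e" for w
  proof -
    have wr: "cball w r \<subseteq> cball z R"
    proof
      fix x assume "x \<in> cball w r"
      then have "dist z x \<le> dist z w + dist w x" "dist w x \<le> r" by (auto intro: dist_triangle)
      then show "x \<in> cball z R" using w by (auto simp: e_def r_def)
    qed
    then have wS: "cball w r \<subseteq> S" using R by blast
    note propsw = path_image_circle_embedding[OF f(1) wS r(1)]
    have "winding_number (\<lambda>t. (f \<circ> circlepath w r) t - f w) 0 = winding_number (\<lambda>t. (f \<circ> circlepath z r) t - f z) 0"
    proof (rule winding_number_nearby_loops_eq)
      show "path (\<lambda>t. (f \<circ> circlepath w r) t - f w)" "path (\<lambda>t. (f \<circ> circlepath z r) t - f z)"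
        using propsw(1) props(1) unfolding path_def by (auto intro: continuous_on_diff[OF _ continuous_on_const])
      show "pathfinish (\<lambda>t. (f \<circ> circlepath w r) t - f w) = pathstart (\<lambda>t. (f \<circ> circlepath w r) t - f w)"
        "pathfinish (\<lambda>t. (f \<circ> circlepath z r) t - f z) = pathstart (\<lambda>t. (f \<circ> circlepath z r) t - f z)"
        using propsw(2) props(2) by (auto simp: pathfinish_def pathstart_def)
      fix t :: real assume t: "t \<in> {0..1}"
      let ?a = "circlepath w r t" and ?b = "circlepath z r t"
      have ab: "dist ?a ?b = dist w z" by (simp add: circlepath dist_norm)
      have b: "?b \<in> sphere z r" and a: "?a \<in> sphere w r"
        using r(1) t by (auto simp: circlepath dist_norm norm_mult)
      have abR: "?a \<in> cball z R" "?b \<in> cball z R"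
        using wr a b R(1) by (force simp: r_def subset_iff)+
      then have "dist (f ?a) (f ?b) < m / 2"
        using ab w by (intro d(2)) (auto simp: e_def dist_commute)
      moreover have "dist (f w) (f z) < m / 2"
        using w R(1) by (intro d(2)) (auto simp: e_def r_def dist_commute)
      moreover have "f ?b \<in> path_image (f \<circ> circlepath z r)"
        using t unfolding path_image_def by (metis comp_apply imageI)
      then have "m \<le> norm (f ?b - f z)"
        using m(2) unfolding dist_norm by (metis norm_minus_commute)
      moreover have "norm ((f ?a - f w) - (f ?b - f z)) \<le> dist (f ?a) (f ?b) + dist (f w) (f z)"
        unfolding dist_norm using norm_triangle_ineq4[of "f ?a - f ?b" "f w - f z"]
        by (simp add: algebra_simps)
      ultimately show "norm ((f \<circ> circlepath w r) t - f w - ((f \<circ> circlepath z r) t - f z))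
           < norm ((f \<circ> circlepath z r) t - f z - 0)" by simp
    qed
    then have "winding_number (f \<circ> circlepath w r) (f w) = winding_number (f \<circ> circlepath z r) (f z)"
      using winding_number_offset by metis
    then show ?thesis
      using has_local_degree_iff[OF f(1) wS r(1)] has_local_degree_iff[OF f(1) r(2,1)] f(3) by simp
  qed
  then show ?thesis using e by blast
qed

lemma has_local_degree_cnj:
  assumes "planar_embedding S f" "z \<in> S" "has_local_degree f z k" "k \<in> {-1, 1}"
  shows "has_local_degree (cnj \<circ> f) z (- k)"
proof -
  obtain r where r: "r > 0" "cball z r \<subseteq> S"
    using assms unfolding planar_embedding_def by (meson open_contains_cball)
  note props = path_image_circle_embedding[OF assms(1) r(2,1)]
  have pe: "planar_embedding S (cnj \<circ> f)"
    using assms(1) unfolding planar_embedding_def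
    by (auto simp: o_def inj_on_def intro!: continuous_intros)
  have "winding_number (f \<circ> circlepath z r) (f z) = k"
    using has_local_degree_iff[OF assms(1) r(2,1)] assms(3) by simp
  then have "winding_number (cnj \<circ> (f \<circ> circlepath z r)) (cnj (f z)) = - k"
    using winding_number_cnj[OF props(1,3)] assms(4) by auto
  then show ?thesis
    unfolding has_local_degree_iff[OF pe r(2,1)] comp_assoc o_apply[of cnj f] .
qed

text \<open>On a small circle \<open>f\<close> is dominated by its linear part, which maps the circle to a circle run
through once counterclockwise.\<close>

lemma has_local_degree_derivative:
  assumes "planar_embedding S f" "z \<in> S" "(f has_field_derivative D) (at z)" "D \<noteq> 0"
  shows "has_local_degree f z 1"
proof -
  have opS: "open S" using assms(1) by (simp add: planar_embedding_def)
  have "\<exists>d>0. \<forall>w. norm (w - z) < d \<longrightarrow> norm (f w - f z - D * (w - z)) \<le> norm D / 2 * norm (w - z)"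
  proof -
    have "norm D / 2 > 0" using assms(4) by simp
    then show ?thesis
      using assms(3) unfolding has_field_derivative_def has_derivative_at_alt by blast
  qed
  then obtain d where d: "d > 0" "\<And>w. norm (w - z) < d \<Longrightarrow> norm (f w - f z - D * (w - z)) \<le> norm D / 2 * norm (w - z)"
    by blast
  obtain R where R: "0 < R" "cball z R \<subseteq> S" using opS assms(2) open_contains_cball by blast
  define r where "r = min (d / 2) R"
  have r: "0 < r" "cball z r \<subseteq> S" "r < d" using d(1) R by (auto simp: r_def subset_iff)
  note props = path_image_circle_embedding[OF assms(1) r(2,1)]
  \<comment> \<open>the image of the circle under the linear part: again a circle, starting at angle \<open>Arg D\<close>\<close>
  define g where "g = (\<lambda>t. f z + D * (circlepath z r t - z))"
  have g_eq: "g = part_circlepath (f z) (norm D * r) (Arg D) (Arg D + 2 * pi)"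
  proof
    fix t
    have "D = norm D * exp (\<i> * Arg D)" using assms(4) by (simp add: Arg_eq)
    then have "D * (of_real r * exp (2 * of_real pi * \<i> * of_real t))
       = of_real (norm D) * of_real r * (exp (\<i> * Arg D) * exp (2 * of_real pi * \<i> * of_real t))"
      by (metis (no_types, opaque_lifting) mult.assoc mult.commute)
    then show "g t = part_circlepath (f z) (norm D * r) (Arg D) (Arg D + 2 * pi) t"
      by (simp add: g_def circlepath part_circlepath_def linepath_def exp_add[symmetric] algebra_simps)
  qed
  have "winding_number g (f z) = 1"
  proof -
    let ?p = "part_circlepath (f z) (norm D * r) (Arg D) (Arg D + 2 * pi)"
    have pos: "0 < norm D * r" using assms(4) r by simp
    have "f z \<notin> sphere (f z) (norm D * r)" using pos by auto
    then have "f z \<notin> path_image ?p"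
      using path_image_part_circlepath_subset'[of "norm D * r" "f z" "Arg D" "Arg D + 2*pi"] pos by auto
    then have "winding_number ?p (f z) = 1 / (2*pi*\<i>) * contour_integral ?p (\<lambda>w. 1 / (w - f z))"
      by (intro winding_number_valid_path) auto
    also have "contour_integral ?p (\<lambda>w. 1 / (w - f z)) = 2 * pi * \<i>"
    proof (rule contour_integral_unique)
      show "((\<lambda>w. 1 / (w - f z)) has_contour_integral 2 * pi * \<i>) ?p"
      proof -
        have "((\<lambda>t::real. 2 * pi * \<i>) has_integral (2*pi*\<i>)) {0..1}"
          using has_integral_const_real[of "2 * pi * \<i>" 0 1] by simp
        moreover have "1 / (?p t - f z) * vector_derivative ?p (at t within {0..1}) = 2 * pi * \<i>"
          if "t \<in> {0..1}" for t
        proof -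
          have "?p t - f z = norm D * r * exp (\<i> * linepath (Arg D) (Arg D + 2 * pi) t)"
            by (simp add: part_circlepath_def)
          moreover from this have "?p t - f z \<noteq> 0" using assms(4) r(1) by simp
          ultimately show ?thesis
            using that by (simp add: vector_derivative_part_circlepath01)
        qed
        ultimately show ?thesis
          unfolding has_contour_integral_def
          by (subst has_integral_cong[where g = "\<lambda>t. 2 * pi * \<i>"]) auto
      qed
    qed
    finally show ?thesis by (simp add: g_eq)
  qed
  moreover have "winding_number (f \<circ> circlepath z r) (f z) = winding_number g (f z)"
  proof (rule winding_number_nearby_loops_eq)
    show "path g" unfolding g_eq by simp
    show "pathfinish g = pathstart g" by (simp add: g_def pathfinish_def pathstart_def circlepath)
    fix t :: real assume "t \<in> {0..1}"
    have n: "norm (circlepath z r t - z) = r" using r(1) by (simp add: circlepath norm_mult norm_exp_eq_Re)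
    have "norm (f (circlepath z r t) - g t) \<le> norm D / 2 * r"
      using d(2)[of "circlepath z r t"] n r(3) by (simp add: g_def algebra_simps)
    also have "\<dots> < norm D * r" using r(1) assms(4) by simp
    also have "\<dots> = norm (g t - f z)" using n by (simp add: g_def norm_mult)
    finally show "norm ((f \<circ> circlepath z r) t - g t) < norm (g t - f z)" by simp
  qed (use props in auto)
  ultimately show ?thesis using has_local_degree_iff[OF assms(1) r(2,1)] by simp
qed

lemma orientation_preserving_on_iff:
  assumes "planar_embedding S f"
  shows "orientation_preserving_on S f \<longleftrightarrow> (\<forall>z\<in>S. has_local_degree f z 1)"
proof
  assume L: "orientation_preserving_on S f"
  show "\<forall>z\<in>S. has_local_degree f z 1"
  proof
    fix z assume "z \<in> S"
    then obtain r where "r > 0" "cball z r \<subseteq> S"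
      using assms unfolding planar_embedding_def by (meson open_contains_cball)
    then show "has_local_degree f z 1"
      using L has_local_degree_iff[OF assms] unfolding orientation_preserving_on_def by blast
  qed
next
  assume R: "\<forall>z\<in>S. has_local_degree f z 1"
  show "orientation_preserving_on S f"
    unfolding orientation_preserving_on_def
  proof (intro allI impI)
    fix z and r :: real assume r: "0 < r \<and> cball z r \<subseteq> S"
    then have "z \<in> S" by auto
    then show "winding_number (f \<circ> circlepath z r) (f z) = 1"
      using R r has_local_degree_iff[OF assms] by blast
  qed
qed

section \<open>The glued polygon\<close>

abbreviation cell_point :: "group_word \<Rightarrow> complex \<Rightarrow> complex set" where
  "cell_point w z \<equiv> gluing w `` {z}"

text \<open>The strip carries logarithmic polar coordinates near a side: the imaginary part is the parameter of the
side, and the real part is negative inside the disk, \<open>0\<close> on the side and positive outside.\<close>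

definition strip :: "complex set" where
  "strip = {\<zeta>. 0 < Im \<zeta> \<and> Im \<zeta> < 1}"

text \<open>The sector over side \<open>j\<close>, parametrised so that the imaginary part runs along the direction of the label. The map
is holomorphic for a positive letter and antiholomorphic for a negative one, which is how the signs of the
letters enter the question of orientability.\<close>

definition side_collar :: "group_word \<Rightarrow> nat \<Rightarrow> complex \<Rightarrow> complex" where
  "side_collar w j \<zeta> = exp (of_real (2 * pi / length w) *
     ((if snd (w ! j) then \<zeta> else cnj \<zeta> + \<i>) + \<i> * of_nat j))"

lemma norm_side_collar: "norm (side_collar w j \<zeta>) = exp (2 * pi / length w * Re \<zeta>)"
  by (simp add: side_collar_def norm_exp_eq_Re)

lemma norm_side_collar_cases:
  assumes "j < length w"
  shows "norm (side_collar w j \<zeta>) < 1 \<longleftrightarrow> Re \<zeta> < 0" "norm (side_collar w j \<zeta>) \<le> 1 \<longleftrightarrow> Re \<zeta> \<le> 0"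
proof -
  have "length w > 0" using assms by linarith
  then have "2 * pi / length w > 0" by simp
  then show "norm (side_collar w j \<zeta>) < 1 \<longleftrightarrow> Re \<zeta> < 0" "norm (side_collar w j \<zeta>) \<le> 1 \<longleftrightarrow> Re \<zeta> \<le> 0"
    unfolding norm_side_collar exp_less_one_iff exp_le_one_iff mult_less_0_iff mult_le_0_iff by linarith+
qed

lemma side_point_eq_collar:
  "side_point w j u = side_collar w j (\<i> * of_real u)"
proof -
  show ?thesis
    by (simp add: side_point_def side_collar_def cis_conv_exp algebra_simps add_divide_distrib diff_divide_distrib)
qed

lemma open_strip: "open strip"
  unfolding strip_def by (intro open_Collect_conj open_Collect_less continuous_intros)

lemma side_collar_inj:
  assumes eq: "side_collar w j \<zeta> = side_collar w k \<zeta>'" and "j < length w" "k < length w"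
    and "\<zeta> \<in> strip" "0 \<le> Im \<zeta>'" "Im \<zeta>' \<le> 1"
  shows "j = k \<and> \<zeta> = \<zeta>'"
proof -
  define s where "s = (if snd (w ! j) then Im \<zeta> else 1 - Im \<zeta>)"
  define s' where "s' = (if snd (w ! k) then Im \<zeta>' else 1 - Im \<zeta>')"
  define c where "c = 2 * pi / length w"
  have l: "length w > 0" using assms(2) by linarith
  then have c: "c > 0" by (simp add: c_def)
  have s: "0 < s" "s < 1" "0 \<le> s'" "s' \<le> 1" using assms by (auto simp: s_def s'_def strip_def)
  have L: "side_collar w j \<zeta> = exp (Complex (c * Re \<zeta>) (c * (s + j)))"
    unfolding side_collar_def c_def s_def by (rule arg_cong[of _ _ exp]) (auto simp: complex_eq_iff)
  have R: "side_collar w k \<zeta>' = exp (Complex (c * Re \<zeta>') (c * (s' + k)))"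
    unfolding side_collar_def c_def s'_def by (rule arg_cong[of _ _ exp]) (auto simp: complex_eq_iff)
  obtain n :: int where n: "Complex (c * Re \<zeta>) (c * (s + j)) = Complex (c * Re \<zeta>') (c * (s' + k)) + of_int (2 * n) * pi * \<i>"
    using eq unfolding L R exp_eq by (auto simp: mult.assoc)
  have re: "Re \<zeta> = Re \<zeta>'" using n c by (auto simp: complex_eq_iff)
  have "c * (s + j) = c * (s' + k) + 2 * n * pi" using n by (auto simp: complex_eq_iff)
  moreover have "2 * n * pi = c * (n * real (length w))" using l by (simp add: c_def)
  ultimately have "c * (s + j) = c * (s' + k + n * real (length w))" by (simp add: algebra_simps)
  then have e: "s + j = s' + k + n * real (length w)" using c by simp
  have jk: "real j + 1 \<le> length w" "real k + 1 \<le> length w" using assms by linarith+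
  have "n = 0"
  proof (rule ccontr)
    assume "n \<noteq> 0"
    then consider "n \<ge> 1" | "n \<le> -1" by linarith
    then show False
    proof cases
      case 1
      then have "real (length w) \<le> n * real (length w)"
        using mult_right_mono[of 1 "real_of_int n" "real (length w)"] by simp
      then show False using e s jk by linarith
    next
      case 2
      then have "n * real (length w) \<le> - real (length w)"
        using mult_right_mono[of "real_of_int n" "-1" "real (length w)"] by simp
      then show False using e s jk by linarith
    qed
  qed
  then have e2: "s + j = s' + k" using e by simp
  have jk: "j = k"
  proof (rule ccontr)
    assume "j \<noteq> k"
    then have "real j + 1 \<le> k \<or> real k + 1 \<le> j" by linarith
    then show False using e2 s by linarith
  qed
  moreover have "Im \<zeta> = Im \<zeta>'" using e2 jk by (auto simp: s_def s'_def split: if_splits)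
  ultimately show ?thesis using re by (simp add: complex_eq_iff)
qed

lemma continuous_on_side_collar: "continuous_on S (side_collar w j)"
  unfolding side_collar_def
  by (cases "snd (w ! j)") (auto simp: divide_inverse intro!: continuous_intros)

lemma planar_embedding_side_collar:
  assumes "j < length w" shows "planar_embedding strip (side_collar w j)"
  unfolding planar_embedding_def
proof (intro conjI inj_onI)
  fix x y assume "x \<in> strip" "y \<in> strip" "side_collar w j x = side_collar w j y"
  then show "x = y" using side_collar_inj[of w j x j y] assms by (auto simp: strip_def)
qed (auto intro: open_strip continuous_on_side_collar)

lemma gluing_closed: "(z, z') \<in> gluing w \<Longrightarrow> z \<in> cball 0 1 \<and> z' \<in> cball 0 1"
  using equiv_gluing[of w] unfolding equiv_def by blast

lemma cell_point_eq_iff: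
  assumes "z \<in> cball 0 1"
  shows "cell_point w z = cell_point w z' \<longleftrightarrow> (z, z') \<in> gluing w"
  using equiv_class_eq_iff[OF equiv_gluing] assms
  by (metis equiv_class_eq_iff equiv_class_self equiv_gluing Image_singleton_iff)

lemma side_pairs_eq_collar:
  "(x, y) \<in> side_pairs w \<longleftrightarrow> (\<exists>j k u. j < length w \<and> k < length w \<and> fst (w ! j) = fst (w ! k) \<and> 0 \<le> u \<and> u \<le> 1
     \<and> x = side_collar w j (\<i> * of_real u) \<and> y = side_collar w k (\<i> * of_real u))"
  unfolding side_pairs_def side_point_eq_collar by auto

lemma gluing_interior:
  assumes "(z, z') \<in> gluing w" "norm z < 1" shows "z' = z"
proof -
  have "norm z = 1" if "(z, y) \<in> side_pairs w" for y
    using that by (auto simp: side_pairs_def side_point_def)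
  then show ?thesis using assms unfolding gluing_def by (auto dest: tranclD)
qed

text \<open>A point in the interior of a side has a unique side parameter, so a chain of identifications
starting there keeps the parameter and can only change the side.\<close>

lemma gluing_side:
  assumes "(side_collar w j \<zeta>, y) \<in> gluing w" "\<zeta> \<in> strip" "Re \<zeta> = 0" "j < length w"
  obtains k where "k < length w" "fst (w ! k) = fst (w ! j)" "y = side_collar w k \<zeta>"
proof -
  have step: "\<exists>k<length w. fst (w ! k) = fst (w ! j) \<and> y' = side_collar w k \<zeta>"
    if x: "x = side_collar w j' \<zeta>" "j' < length w" "fst (w ! j') = fst (w ! j)" and p: "(x, y') \<in> side_pairs w" for x y' j'
  proof -
    obtain a k u where a: "a < length w" "k < length w" "fst (w ! a) = fst (w ! k)" "0 \<le> u" "u \<le> 1"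
      "x = side_collar w a (\<i> * of_real u)" "y' = side_collar w k (\<i> * of_real u)"
      using p unfolding side_pairs_eq_collar by blast
    have "j' = a \<and> \<zeta> = \<i> * of_real u"
      using x a assms by (intro side_collar_inj[of w]) auto
    then show ?thesis using a x by auto
  qed
  consider "y = side_collar w j \<zeta>" | "(side_collar w j \<zeta>, y) \<in> (side_pairs w)\<^sup>+"
    using assms(1) unfolding gluing_def by auto
  then have "\<exists>k<length w. fst (w ! k) = fst (w ! j) \<and> y = side_collar w k \<zeta>"
  proof cases
    case 2
    then show ?thesis
      by (induction rule: trancl_induct) (use step assms(4) in blast)+
  qed (use assms in auto)
  then show ?thesis using that by blast
qed

lemma gluing_collar:
  assumes "j < length w" "k < length w" "fst (w ! j) = fst (w ! k)" "\<zeta> \<in> strip" "Re \<zeta> = 0"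
  shows "(side_collar w j \<zeta>, side_collar w k \<zeta>) \<in> gluing w"
proof -
  have "\<zeta> = \<i> * of_real (Im \<zeta>)" using assms by (simp add: complex_eq_iff)
  then have "(side_collar w j \<zeta>, side_collar w k \<zeta>) \<in> side_pairs w"
    unfolding side_pairs_eq_collar using assms by (intro exI[of _ j] exI[of _ k] exI[of _ "Im \<zeta>"]) (auto simp: strip_def)
  then show ?thesis unfolding gluing_def by auto
qed

text \<open>A point of the circle at angle \<open>2 * pi * x / \<ell>\<close> is a vertex if \<open>x\<close> is an integer, and lies on the
side with number \<open>\<lfloor>x\<rfloor>\<close> otherwise.\<close>

lemma disk_cases:
  assumes "z \<in> cball 0 1" "w \<noteq> []"
  obtains "norm z < 1"
  | j \<zeta> where "j < length w" "\<zeta> \<in> strip" "Re \<zeta> = 0" "z = side_collar w j \<zeta>"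
  | "cell_point w z \<in> zero_cells w"
proof (cases "norm z < 1")
  case False
  then have n: "norm z = 1" using assms by auto
  let ?l = "real (length w)"
  have l: "?l > 0" using assms by simp
  define x where "x = Arg2pi z * ?l / (2 * pi)"
  have z: "z = cis (2 * pi * x / ?l)"
    using Arg2pi_eq[of z] n l by (simp add: x_def cis_conv_exp mult.commute)
  have x0: "0 \<le> x" using Arg2pi_ge_0[of z] l by (simp add: x_def)
  have x1: "x < ?l" using Arg2pi_lt_2pi[of z] l by (simp add: x_def field_simps)
  define j where "j = nat \<lfloor>x\<rfloor>"
  have jx: "real j \<le> x" "x < real j + 1" using x0 unfolding j_def by linarith+
  have jl: "j < length w" using jx x1 by linarith
  show ?thesis
  proof (cases "x = real j")
    case True
    then have "cell_point w z \<in> zero_cells w"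
      unfolding zero_cells_def z using jl by auto
    then show ?thesis using that by blast
  next
    case False
    define u where "u = (if snd (w ! j) then x - j else 1 - (x - j))"
    have "z = side_point w j u" unfolding z side_point_def u_def by simp
    then have "z = side_collar w j (\<i> * of_real u)" by (simp add: side_point_eq_collar)
    moreover have "\<i> * of_real u \<in> strip" using jx False by (auto simp: strip_def u_def)
    ultimately show ?thesis using that(2)[of j "\<i> * of_real u"] jl by auto
  qed
qed (use that in blast)

lemma topspace_word_complex: "topspace (word_complex w) = cball 0 1 // gluing w"
proof -
  have "openin (word_complex w) (cball 0 1 // gluing w)"
    unfolding word_complex_def openin_quotient_topology
    by (auto simp: quotientI intro!: openin_subtopology_self[THEN back_subst[of "openin _"]])
  moreover have "S \<subseteq> cball 0 1 // gluing w" if "openin (word_complex w) S" for S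
    using that unfolding word_complex_def openin_quotient_topology by simp
  ultimately show ?thesis by (metis openin_subset openin_topspace subset_antisym)
qed

lemma cell_point_in_topspace: "z \<in> cball 0 1 \<Longrightarrow> cell_point w z \<in> topspace (word_complex w)"
  unfolding topspace_word_complex by (rule quotientI)

lemma topspace_word_complex_cases:
  assumes "x \<in> topspace (word_complex w)" obtains z where "z \<in> cball 0 1" "x = cell_point w z"
  using assms unfolding topspace_word_complex by (auto elim: quotientE)

lemma openin_word_complex:
  "openin (word_complex w) S \<longleftrightarrow>
     S \<subseteq> topspace (word_complex w) \<and> openin (top_of_set (cball 0 1)) {z \<in> cball 0 1. cell_point w z \<in> S}"
  unfolding topspace_word_complex unfolding word_complex_def openin_quotient_topology by simp

lemma continuous_map_cell_point: "continuous_map (top_of_set (cball 0 1)) (word_complex w) (cell_point w)"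
  unfolding continuous_map_def using cell_point_in_topspace by (auto simp: openin_word_complex)

lemma openin_cell_point_image:
  assumes "open V" "\<And>z z'. z \<in> V \<inter> cball 0 1 \<Longrightarrow> (z, z') \<in> gluing w \<Longrightarrow> z' \<in> V"
  shows "openin (word_complex w) (cell_point w ` (V \<inter> cball 0 1))"
proof -
  have "{z \<in> cball 0 1. cell_point w z \<in> cell_point w ` (V \<inter> cball 0 1)} = cball 0 1 \<inter> V"
    using assms(2) cell_point_eq_iff[of _ w] by (auto simp: image_iff) (metis IntI dist_0_norm mem_cball)
  then show ?thesis
    unfolding openin_word_complex using assms(1) cell_point_in_topspace by (auto simp: openin_open)
qed

lemma planar_chart_open_image:
  assumes "planar_chart X (U, \<phi>)" "openin X N" "N \<subseteq> U"
  shows "open (\<phi> ` N)"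
proof -
  have h: "homeomorphic_map (subtopology X U) (top_of_set (\<phi> ` U)) \<phi>" and o: "open (\<phi> ` U)"
    using assms(1) unfolding planar_chart_def by auto
  have "openin (subtopology X U) N"
    using assms(2,3) unfolding openin_subtopology by blast
  then have "openin (top_of_set (\<phi> ` U)) (\<phi> ` N)"
    using homeomorphic_imp_open_map[OF h] unfolding open_map_def by blast
  then show ?thesis using o openin_open_trans by blast
qed

lemma planar_chart_props:
  assumes "planar_chart X (U, \<phi>)"
  shows "openin X U" "U \<subseteq> topspace X" "open (\<phi> ` U)" "inj_on \<phi> U" "continuous_map (subtopology X U) euclidean \<phi>"
proof -
  have h: "homeomorphic_map (subtopology X U) (top_of_set (\<phi> ` U)) \<phi>" and o: "openin X U" "open (\<phi> ` U)"
    using assms unfolding planar_chart_def by auto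
  show "openin X U" "open (\<phi> ` U)" "U \<subseteq> topspace X" using o openin_subset by auto
  then have "topspace (subtopology X U) = U" by auto
  then show "inj_on \<phi> U" using homeomorphic_imp_injective_map[OF h] by simp
  show "continuous_map (subtopology X U) euclidean \<phi>"
    using homeomorphic_imp_continuous_map[OF h] continuous_map_in_subtopology by blast
qed

text \<open>Read in a chart, an injective parametrisation by an open set of the plane is a planar embedding;
this is what makes its local degree available.\<close>

lemma planar_chart_parametrisation:
  fixes e :: "complex \<Rightarrow> 'a"
  assumes c: "planar_chart X (U, \<phi>)" and S: "open S" and e: "continuous_map (top_of_set S) X e" "inj_on e S"
  shows "planar_embedding {z \<in> S. e z \<in> U} (\<phi> \<circ> e)"
  unfolding planar_embedding_def
proof (intro conjI)
  note p = planar_chart_props[OF c]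
  have "openin (top_of_set S) {z \<in> topspace (top_of_set S). e z \<in> U}"
    using e(1) p(1) unfolding continuous_map_def by blast
  then show "open {z \<in> S. e z \<in> U}" using S by (auto simp: openin_open_eq)
  have "continuous_map (subtopology (top_of_set S) {z \<in> S. e z \<in> U}) (subtopology X U) e"
    by (intro continuous_map_into_subtopology continuous_map_from_subtopology[OF e(1)]) auto
  from continuous_map_compose[OF this p(5)]
  have "continuous_map (top_of_set (S \<inter> {z \<in> S. e z \<in> U})) euclidean (\<phi> \<circ> e)"
    by (simp add: subtopology_subtopology)
  moreover have "S \<inter> {z \<in> S. e z \<in> U} = {z \<in> S. e z \<in> U}" by blast
  ultimately show "continuous_on {z \<in> S. e z \<in> U} (\<phi> \<circ> e)" by simp
  show "inj_on (\<phi> \<circ> e) {z \<in> S. e z \<in> U}"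
    using p(4) e(2) unfolding inj_on_def by auto
qed

lemma planar_chart_inverse_open:
  assumes c: "planar_chart X (U, \<phi>)" and V: "open V"
  shows "openin X {x \<in> U. \<phi> x \<in> V}"
proof -
  note p = planar_chart_props[OF c]
  have "openin (subtopology X U) {x \<in> topspace (subtopology X U). \<phi> x \<in> V}"
    using p(5) V unfolding continuous_map_def by (metis (no_types) open_openin)
  moreover have "topspace (subtopology X U) = U" using p(2) by auto
  ultimately show ?thesis using p(1) openin_trans_full by fastforce
qed

text \<open>Invariance of domain, transferred from the plane to a surface through its charts.\<close>

lemma surface_open_map:
  fixes e :: "complex \<Rightarrow> 'a"
  assumes X: "surface X" and S: "open S" and e: "continuous_map (top_of_set S) X e" "inj_on e S"
    and V: "open V" "V \<subseteq> S"
  shows "openin X (e ` V)"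
proof (subst openin_subopen, intro ballI)
  fix x assume "x \<in> e ` V"
  then obtain z where z: "z \<in> V" "x = e z" by auto
  then have "x \<in> topspace X" using e(1) V by (auto simp: continuous_map_def)
  then obtain U \<phi> where c: "planar_chart X (U, \<phi>)" "x \<in> U" using X unfolding surface_def by blast
  note p = planar_chart_props[OF c(1)]
  have emb: "planar_embedding {z \<in> S. e z \<in> U} (\<phi> \<circ> e)"
    by (rule planar_chart_parametrisation[OF c(1) S e])
  have "planar_embedding (V \<inter> {z \<in> S. e z \<in> U}) (\<phi> \<circ> e)"
    by (rule planar_embedding_subset[OF emb]) (use V emb in \<open>auto simp: planar_embedding_def\<close>)
  then have "open ((\<phi> \<circ> e) ` (V \<inter> {z \<in> S. e z \<in> U}))" by (rule planar_embedding_open_image)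
  then have "openin X {y \<in> U. \<phi> y \<in> (\<phi> \<circ> e) ` (V \<inter> {z \<in> S. e z \<in> U})}" (is "openin X ?O")
    by (rule planar_chart_inverse_open[OF c(1)])
  moreover have "?O \<subseteq> e ` V" using p(4) by (auto simp: inj_on_def)
  moreover have "x \<in> ?O" using z c V by auto
  ultimately show "\<exists>T. openin X T \<and> x \<in> T \<and> T \<subseteq> e ` V" by blast
qed

text \<open>Near \<open>p\<close> the projection of the disk is injective and open. In a chart its inverse would be an
embedding of an open set of the plane whose image is a neighbourhood of \<open>p\<close> in the closed disk; by invariance
of domain this image would be open, although \<open>p\<close> lies on the boundary circle.\<close>

lemma not_surface_free_boundary:
  assumes p: "p \<in> sphere 0 1" "p \<in> V" and V: "open V"
    and free: "\<And>z z'. z \<in> V \<inter> cball 0 1 \<Longrightarrow> (z, z') \<in> gluing w \<Longrightarrow> z' = z"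
  shows "\<not> surface (word_complex w)"
proof
  let ?X = "word_complex w"
  assume "surface ?X"
  moreover have pc: "p \<in> cball 0 1" using p by auto
  ultimately obtain U \<phi> where c: "planar_chart ?X (U, \<phi>)" "cell_point w p \<in> U"
    using cell_point_in_topspace[of p w] unfolding surface_def by blast
  note pr = planar_chart_props[OF c(1)]
  define W where "W = {z \<in> V \<inter> cball 0 1. cell_point w z \<in> U}"
  let ?f = "\<phi> \<circ> cell_point w"
  have opW: "openin ?X (cell_point w ` (O' \<inter> W))" if O': "open O'" for O'
  proof -
    have "openin ?X (cell_point w ` ((O' \<inter> V) \<inter> cball 0 1))"
      by (rule openin_cell_point_image) (use O' V free in auto)
    moreover have "cell_point w ` (O' \<inter> W) = cell_point w ` ((O' \<inter> V) \<inter> cball 0 1) \<inter> U"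
      by (auto simp: W_def)
    ultimately show ?thesis using pr(1) by (metis openin_Int)
  qed
  have W: "W \<subseteq> cball 0 1" by (auto simp: W_def)
  have inj: "inj_on (cell_point w) W"
  proof (rule inj_onI)
    fix x y assume "x \<in> W" "y \<in> W" "cell_point w x = cell_point w y"
    then show "x = y" using free[of x y] cell_point_eq_iff[of x w y] by (auto simp: W_def)
  qed
  have injf: "inj_on ?f W"
    using inj pr(4) by (intro comp_inj_on) (auto simp: W_def inj_on_def)
  have contf: "continuous_on W ?f"
  proof -
    have "continuous_map (subtopology (top_of_set (cball 0 1)) W) (subtopology ?X U) (cell_point w)"
      by (intro continuous_map_into_subtopology continuous_map_from_subtopology[OF continuous_map_cell_point]) (auto simp: W_def)
    from continuous_map_compose[OF this pr(5)]
    have "continuous_map (top_of_set (cball 0 1 \<inter> W)) euclidean ?f"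
      by (simp add: subtopology_subtopology)
    then show ?thesis using W by (simp add: inf_absorb2)
  qed
  have opf: "open (?f ` (O' \<inter> W))" if "open O'" for O'
    unfolding image_comp[symmetric]
    by (rule planar_chart_open_image[OF c(1) opW[OF that]]) (auto simp: W_def)
  define g where "g = inv_into W ?f"
  have gf: "g (?f x) = x" if "x \<in> W" for x
    unfolding g_def by (rule inv_into_f_f[OF injf that])
  have "continuous_on (?f ` W) g"
  proof (rule continuous_on_inverse_open_map[OF contf refl gf])
    fix O' assume "openin (top_of_set W) O'"
    then obtain O'' where "open O''" "O' = O'' \<inter> W" by (auto simp: openin_open)
    then show "openin (top_of_set (?f ` W)) (?f ` O')"
      using opf by (metis Int_lower2 image_mono open_subset)
  qed
  moreover have "inj_on g (?f ` W)"
    unfolding g_def by (rule inj_on_inv_into) simp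
  moreover have "open (?f ` W)" using opf[of UNIV] by simp
  ultimately have "open (g ` ?f ` W)" using invariance_of_domain by blast
  moreover have "g ` ?f ` W = W" using gf by (force simp: image_iff)
  ultimately have "W \<subseteq> interior (cball 0 1)" using W by (metis interior_maximal)
  moreover have "p \<in> W" using p pc c by (auto simp: W_def)
  ultimately show False using p by (auto simp: interior_cball)
qed

text \<open>The neighbourhood of an edge formed by two pages of the book: the left half of the strip
runs through the disk near side \<open>j\<close>, and the right half, reflected, through the disk near side \<open>k\<close>.\<close>

definition glued_strip :: "group_word \<Rightarrow> nat \<Rightarrow> nat \<Rightarrow> complex \<Rightarrow> complex set" where
  "glued_strip w j k \<zeta> =
     (if Re \<zeta> \<le> 0 then cell_point w (side_collar w j \<zeta>) else cell_point w (side_collar w k (- cnj \<zeta>)))"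

lemma reflected_strip: "- cnj \<zeta> \<in> strip \<longleftrightarrow> \<zeta> \<in> strip"
  by (simp add: strip_def)

lemma continuous_map_glued_strip:
  assumes "j < length w" "k < length w" "fst (w ! j) = fst (w ! k)"
  shows "continuous_map (top_of_set strip) (word_complex w) (glued_strip w j k)"
  unfolding glued_strip_def
proof (rule continuous_map_cases_le)
  show "continuous_map (top_of_set strip) euclideanreal Re" "continuous_map (top_of_set strip) euclideanreal (\<lambda>x. 0)"
    by (auto intro: continuous_intros)
  have sub: "subtopology (top_of_set strip) {x \<in> topspace (top_of_set strip). P x} = top_of_set {x \<in> strip. P x}" for P
  proof -
    have "strip \<inter> {x \<in> topspace (top_of_set strip). P x} = {x \<in> strip. P x}" by auto
    then show ?thesis unfolding subtopology_subtopology by simp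
  qed
  have *: "continuous_on {x \<in> strip. 0 \<le> Re x} (\<lambda>\<zeta>. side_collar w k (- cnj \<zeta>))"
    by (rule continuous_on_compose2[OF continuous_on_side_collar[of UNIV]]) (auto intro!: continuous_intros)
  have "continuous_map (top_of_set {x \<in> strip. 0 \<le> Re x}) (top_of_set (cball 0 1)) (\<lambda>\<zeta>. side_collar w k (- cnj \<zeta>))"
    unfolding continuous_map_subtopology_eu
    using * by (intro conjI) (assumption, simp add: Pi_iff norm_side_collar_cases(2)[OF assms(2)])
  from continuous_map_compose[OF this continuous_map_cell_point[of w]]
  show "continuous_map (subtopology (top_of_set strip) {x \<in> topspace (top_of_set strip). 0 \<le> Re x}) (word_complex w)
     (\<lambda>x. cell_point w (side_collar w k (- cnj x)))"
    unfolding sub o_def .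
  have "continuous_map (top_of_set {x \<in> strip. Re x \<le> 0}) (top_of_set (cball 0 1)) (side_collar w j)"
    unfolding continuous_map_subtopology_eu
    by (intro conjI continuous_on_side_collar) (simp add: Pi_iff norm_side_collar_cases(2)[OF assms(1)])
  from continuous_map_compose[OF this continuous_map_cell_point[of w]]
  show "continuous_map (subtopology (top_of_set strip) {x \<in> topspace (top_of_set strip). Re x \<le> 0}) (word_complex w)
     (\<lambda>x. cell_point w (side_collar w j x))"
    unfolding sub o_def .
  fix x assume x: "x \<in> topspace (top_of_set strip)" "Re x = 0"
  then have "- cnj x = x" by (simp add: complex_eq_iff)
  moreover have "(side_collar w j x, side_collar w k x) \<in> gluing w"
    by (rule gluing_collar) (use assms x in auto)
  ultimately show "cell_point w (side_collar w j x) = cell_point w (side_collar w k (- cnj x))"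
    using cell_point_eq_iff gluing_closed by metis
qed

lemma glued_strip_eqD:
  assumes jk: "j < length w" "k < length w" "fst (w ! j) = fst (w ! k)"
    and z: "\<zeta> \<in> strip" "glued_strip w j k \<zeta> = cell_point w y" "norm y < 1"
  shows "Re \<zeta> \<noteq> 0" "Re \<zeta> < 0 \<Longrightarrow> y = side_collar w j \<zeta>" "Re \<zeta> > 0 \<Longrightarrow> y = side_collar w k (- cnj \<zeta>)"
proof -
  have yc: "y \<in> cball 0 1" using z by simp
  show n: "y = side_collar w j \<zeta>" if "Re \<zeta> < 0"
    using z that gluing_interior[of y _ w] cell_point_eq_iff[OF yc, of w] by (auto simp: glued_strip_def)
  show "y = side_collar w k (- cnj \<zeta>)" if "Re \<zeta> > 0"
    using z that gluing_interior[of y _ w] cell_point_eq_iff[OF yc, of w] by (auto simp: glued_strip_def)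
  show "Re \<zeta> \<noteq> 0"
  proof
    assume 0: "Re \<zeta> = 0"
    then have "y = side_collar w j \<zeta>" 
      using z gluing_interior[of y _ w] cell_point_eq_iff[OF yc, of w] by (auto simp: glued_strip_def)
    then show False using z 0 norm_side_collar_cases(1)[OF jk(1), of \<zeta>] by simp
  qed
qed

lemma glued_strip_edge_eqD:
  assumes jk: "j < length w" "k < length w" "fst (w ! j) = fst (w ! k)"
    and z: "\<zeta> \<in> strip" "glued_strip w j k \<zeta> = cell_point w (side_collar w i \<xi>)" "i < length w" "\<xi> \<in> strip" "Re \<xi> = 0"
  shows "\<zeta> = \<xi>"
proof -
  have c: "side_collar w i \<xi> \<in> cball 0 1" and n: "norm (side_collar w i \<xi>) = 1"
    using norm_side_collar_cases(2)[OF z(3)] z(5) by (auto simp: norm_side_collar)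
  show ?thesis
  proof (cases "Re \<zeta> \<le> 0")
    case True
    then have "(side_collar w i \<xi>, side_collar w j \<zeta>) \<in> gluing w"
      using z(2)[symmetric] cell_point_eq_iff[OF c, of w] by (simp add: glued_strip_def)
    then obtain k' where "k' < length w" "side_collar w j \<zeta> = side_collar w k' \<xi>"
      using gluing_side[OF _ z(4,5,3)] by metis
    then show ?thesis using side_collar_inj[of w j \<zeta> k' \<xi>] jk z by (auto simp: strip_def)
  next
    case False
    then have "(side_collar w i \<xi>, side_collar w k (- cnj \<zeta>)) \<in> gluing w"
      using z(2)[symmetric] cell_point_eq_iff[OF c, of w] by (simp add: glued_strip_def)
    then obtain k' where k': "k' < length w" "side_collar w k (- cnj \<zeta>) = side_collar w k' \<xi>"
      using gluing_side[OF _ z(4,5,3)] by metis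
    then have "- cnj \<zeta> = \<xi>" using side_collar_inj[of w k "- cnj \<zeta>" k' \<xi>] jk z by (auto simp: strip_def)
    then have "Re \<zeta> = 0" using z(5) by (auto simp: complex_eq_iff)
    then show ?thesis using False by simp
  qed
qed

lemma inj_on_glued_strip:
  assumes jk: "j < length w" "k < length w" "fst (w ! j) = fst (w ! k)" "j \<noteq> k"
  shows "inj_on (glued_strip w j k) strip"
proof (rule inj_onI)
  fix x y assume xy: "x \<in> strip" "y \<in> strip" "glued_strip w j k x = glued_strip w j k y"
  consider "Re y < 0" | "Re y = 0" | "Re y > 0" by linarith
  then show "x = y"
  proof cases
    case 1
    let ?q = "side_collar w j y"
    have q: "norm ?q < 1" "glued_strip w j k x = cell_point w ?q"
      using 1 xy norm_side_collar_cases(1)[OF jk(1)] by (auto simp: glued_strip_def)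
    note d = glued_strip_eqD[OF jk(1-3) xy(1) q(2,1)]
    show ?thesis
    proof (cases "Re x < 0")
      case True
      then show ?thesis using d(2) side_collar_inj[of w j x j y] xy jk by (auto simp: strip_def)
    next
      case False
      then have "?q = side_collar w k (- cnj x)" using d by simp
      then show ?thesis using side_collar_inj[of w j y k "- cnj x"] xy jk by (auto simp: strip_def)
    qed
  next
    case 2
    then show ?thesis using glued_strip_edge_eqD[OF jk(1-3) xy(1) _ jk(1) xy(2)] xy by (simp add: glued_strip_def)
  next
    case 3
    let ?q = "side_collar w k (- cnj y)"
    have q: "norm ?q < 1" "glued_strip w j k x = cell_point w ?q"
      using 3 xy norm_side_collar_cases(1)[OF jk(2)] by (auto simp: glued_strip_def)
    note d = glued_strip_eqD[OF jk(1-3) xy(1) q(2,1)]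
    show ?thesis
    proof (cases "Re x < 0")
      case True
      then have "side_collar w j x = ?q" using d(2) by simp
      then show ?thesis using side_collar_inj[of w j x k "- cnj y"] xy jk by (auto simp: strip_def)
    next
      case False
      then have "?q = side_collar w k (- cnj x)" using d by simp
      then have "- cnj y = - cnj x" using side_collar_inj[of w k "- cnj y" k "- cnj x"] xy jk by (auto simp: strip_def)
      then show ?thesis by (simp add: complex_eq_iff)
    qed
  qed
qed

text \<open>Nothing is glued for the empty word, and the closed disk has a boundary.\<close>

lemma surface_word_nonempty:
  assumes "surface (word_complex w)" shows "w \<noteq> []"
proof
  assume w: "w = []"
  then have "side_pairs w = {}" by (simp add: side_pairs_def)
  then have "gluing w = Id_on (cball 0 1)" by (simp add: gluing_def)
  then show False using not_surface_free_boundary[of 1 UNIV w] assms by auto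
qed

text \<open>A side whose letter does not recur would consist of boundary points.\<close>

lemma surface_letter_twice:
  assumes X: "surface (word_complex w)" and j: "j < length w"
  shows "\<exists>k<length w. k \<noteq> j \<and> fst (w ! k) = fst (w ! j)"
proof (rule ccontr)
  assume no: "\<not> ?thesis"
  define p where "p = side_collar w j (\<i> / 2)"
  have s: "\<i> / 2 \<in> strip" by (simp add: strip_def)
  have "\<not> surface (word_complex w)"
  proof (rule not_surface_free_boundary)
    show "p \<in> sphere 0 1" by (simp add: p_def norm_side_collar)
    show "p \<in> side_collar w j ` strip" using s by (simp add: p_def)
    show "open (side_collar w j ` strip)"
      by (rule planar_embedding_open_image[OF planar_embedding_side_collar[OF j]])
    fix z z' assume z: "z \<in> side_collar w j ` strip \<inter> cball 0 1" "(z, z') \<in> gluing w"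
    then obtain \<zeta> where \<zeta>: "\<zeta> \<in> strip" "z = side_collar w j \<zeta>" by auto
    then consider "Re \<zeta> < 0" | "Re \<zeta> = 0" using z norm_side_collar_cases[OF j, of \<zeta>] by fastforce
    then show "z' = z"
    proof cases
      case 1
      then show ?thesis using gluing_interior[OF z(2)] \<zeta> norm_side_collar_cases(1)[OF j] by simp
    next
      case 2
      then show ?thesis using gluing_side[OF z(2)[unfolded \<zeta>(2)] \<zeta>(1) 2 j] no \<zeta>(2) by metis
    qed
  qed
  then show False using X by simp
qed

text \<open>Two pages already form an open set of the surface by \<open>surface_open_map\<close>. It contains the midpoint of the
edge, hence also the points of the disk close to the midpoint of a third side; but these lie on neither
page.\<close>

lemma surface_letter_at_most_twice:
  assumes X: "surface (word_complex w)" and jk: "j < length w" "k < length w" "fst (w ! j) = fst (w ! k)" "j \<noteq> k"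
    and i: "i < length w" "fst (w ! i) = fst (w ! j)"
  shows "i = j \<or> i = k"
proof (rule ccontr)
  assume ne: "\<not> ?thesis"
  let ?E = "glued_strip w j k ` strip"
  have s: "\<i> / 2 \<in> strip" by (simp add: strip_def)
  have "openin (word_complex w) ?E"
    by (rule surface_open_map[OF X open_strip continuous_map_glued_strip[OF jk(1-3)] inj_on_glued_strip[OF jk] open_strip]) simp
  then have "openin (top_of_set (cball 0 1)) {z \<in> cball 0 1. cell_point w z \<in> ?E}"
    unfolding openin_word_complex by blast
  then obtain V where V: "open V" "{z \<in> cball 0 1. cell_point w z \<in> ?E} = cball 0 1 \<inter> V"
    by (auto simp: openin_open)
  have p: "side_collar w i (\<i> / 2) \<in> cball 0 1" using norm_side_collar_cases(2)[OF i(1), of "\<i> / 2"] by simp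
  have "(side_collar w i (\<i> / 2), side_collar w j (\<i> / 2)) \<in> gluing w"
    by (rule gluing_collar) (use i jk s in auto)
  then have "cell_point w (side_collar w i (\<i> / 2)) = glued_strip w j k (\<i> / 2)"
    using cell_point_eq_iff[OF p] by (simp add: glued_strip_def)
  then have "side_collar w i (\<i> / 2) \<in> V" using V p s by blast
  then have "\<i> / 2 \<in> side_collar w i -` V" by simp
  moreover have "open (side_collar w i -` V)"
    using continuous_on_side_collar[of UNIV w i] V(1) by (simp add: continuous_on_open_vimage)
  ultimately obtain d where d: "d > 0" "ball (\<i> / 2) d \<subseteq> side_collar w i -` V" by (meson open_contains_ball)
  define \<xi> where "\<xi> = \<i> / 2 - of_real (d / 2)"
  have "\<xi> \<in> ball (\<i> / 2) d" using d(1) by (simp add: \<xi>_def dist_norm)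
  then have \<xi>V: "side_collar w i \<xi> \<in> V" using d(2) by auto
  have \<xi>: "\<xi> \<in> strip" "Re \<xi> < 0" using d(1) by (auto simp: \<xi>_def strip_def)
  have n: "norm (side_collar w i \<xi>) < 1" using \<xi> norm_side_collar_cases(1)[OF i(1)] by simp
  then obtain \<zeta> where \<zeta>: "\<zeta> \<in> strip" "glued_strip w j k \<zeta> = cell_point w (side_collar w i \<xi>)"
    using V(2) \<xi>V by force
  note d = glued_strip_eqD[OF jk(1-3) \<zeta> n]
  consider "Re \<zeta> < 0" | "Re \<zeta> > 0" using d(1) by linarith
  then show False
  proof cases
    case 1
    then show False using d(2) side_collar_inj[of w i \<xi> j \<zeta>] \<xi> \<zeta> i jk ne by (auto simp: strip_def)
  next
    case 2
    then show False using d(3) side_collar_inj[of w i \<xi> k "- cnj \<zeta>"] \<xi> \<zeta> i jk ne by (auto simp: strip_def)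
  qed
qed

section \<open>Orientability and the signs of the letters\<close>

text \<open>A chart is compared with the open disk only, where the projection is injective. The edges and
vertices have empty interior, so this decides the sign of the chart.\<close>

definition chart_degree :: "group_word \<Rightarrow> complex set set \<Rightarrow> (complex set \<Rightarrow> complex) \<Rightarrow> complex \<Rightarrow> bool" where
  "chart_degree w U \<phi> k \<longleftrightarrow>
     (\<forall>y\<in>ball 0 1. cell_point w y \<in> U \<longrightarrow> has_local_degree (\<phi> \<circ> cell_point w) y k)"

definition letter_sign :: "group_word \<Rightarrow> nat \<Rightarrow> complex" where
  "letter_sign w j = (if snd (w ! j) then 1 else -1)"

lemma connected_two_valued:
  assumes S: "connected S"
    and ex: "\<And>x. x \<in> S \<Longrightarrow> Q 1 x \<or> Q (-1) x"
    and un: "\<And>x. x \<in> S \<Longrightarrow> \<not> (Q 1 x \<and> Q (-1) x)"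
    and loc: "\<And>k x. x \<in> S \<Longrightarrow> Q k x \<Longrightarrow> \<exists>d>0. \<forall>y\<in>ball x d \<inter> S. Q k y"
  shows "\<exists>k\<in>{1, -1::complex}. \<forall>x\<in>S. Q k x"
proof (rule ccontr)
  assume no: "\<not> ?thesis"
  define A where "A k = \<Union>{ball x d | x d. x \<in> S \<and> (\<forall>y\<in>ball x d \<inter> S. Q k y)}" for k
  have opA: "open (A k)" for k unfolding A_def by (intro open_Union) auto
  have A1: "Q k x" if "x \<in> A k" "x \<in> S" for x k using that unfolding A_def by blast
  have A2: "x \<in> A k" if x: "x \<in> S" "Q k x" for x k
  proof -
    obtain d where "d > 0" "\<forall>y\<in>ball x d \<inter> S. Q k y" using loc[OF x] by blast
    then show ?thesis unfolding A_def using x(1) centre_in_ball[of x d] by blast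
  qed
  have "A 1 \<inter> S = {} \<or> A (-1) \<inter> S = {}"
    by (rule connectedD[OF S opA opA]) (use A1 A2 un ex in blast)+
  then have "(\<forall>x\<in>S. Q 1 x) \<or> (\<forall>x\<in>S. Q (-1) x)" using ex A2 by blast
  then show False using no by blast
qed

lemma has_local_degree_exp:
  assumes "planar_embedding S (\<lambda>\<zeta>. exp (c * \<zeta> + b))" "c \<noteq> 0" "z \<in> S"
  shows "has_local_degree (\<lambda>\<zeta>. exp (c * \<zeta> + b)) z 1"
  by (rule has_local_degree_derivative[OF assms(1,3), of "c * exp (c * z + b)"])
    (use assms(2) in \<open>auto intro!: derivative_eq_intros\<close>)

lemma has_local_degree_cnj_exp:
  assumes "planar_embedding S (\<lambda>\<zeta>. cnj (exp (c * \<zeta> + b)))" "c \<noteq> 0" "z \<in> S"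
  shows "has_local_degree (\<lambda>\<zeta>. cnj (exp (c * \<zeta> + b))) z (-1)"
proof -
  have "planar_embedding S (\<lambda>\<zeta>. exp (c * \<zeta> + b))"
    using assms(1) unfolding planar_embedding_def inj_on_def by (auto intro!: continuous_intros)
  then have "has_local_degree (cnj \<circ> (\<lambda>\<zeta>. exp (c * \<zeta> + b))) z (- 1)"
    by (intro has_local_degree_cnj has_local_degree_exp assms) (use assms in auto)
  then show ?thesis by (simp add: o_def)
qed

lemma side_collar_forms:
  assumes "j < length w"
  obtains c b where "c \<noteq> 0" "snd (w ! j) \<Longrightarrow> side_collar w j = (\<lambda>\<zeta>. exp (c * \<zeta> + b))"
    "\<not> snd (w ! j) \<Longrightarrow> side_collar w j = (\<lambda>\<zeta>. cnj (exp (c * \<zeta> + b)))"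
    "snd (w ! j) \<Longrightarrow> (\<lambda>\<zeta>. side_collar w j (- cnj \<zeta>)) = (\<lambda>\<zeta>. cnj (exp (- c * \<zeta> + cnj b)))"
    "\<not> snd (w ! j) \<Longrightarrow> (\<lambda>\<zeta>. side_collar w j (- cnj \<zeta>)) = (\<lambda>\<zeta>. exp (- c * \<zeta> + cnj b))"
proof -
  define c where "c = complex_of_real (2 * pi / length w)"
  have c: "c \<noteq> 0" "cnj c = c" using assms by (auto simp: c_def)
  define b where "b = (if snd (w ! j) then c * \<i> * of_nat j else cnj (c * (\<i> + \<i> * of_nat j)))"
  have "side_collar w j \<zeta> = exp (c * ((if snd (w ! j) then \<zeta> else cnj \<zeta> + \<i>) + \<i> * of_nat j))" for \<zeta>
    by (simp only: side_collar_def c_def)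
  then show ?thesis
    by (intro that[of c b]) (use c in \<open>auto simp: fun_eq_iff b_def exp_cnj algebra_simps\<close>)
qed

lemma local_degree_side_collar:
  assumes j: "j < length w" and z: "\<zeta> \<in> strip"
  shows "has_local_degree (side_collar w j) \<zeta> (letter_sign w j)"
proof -
  obtain c b where c: "c \<noteq> 0" "snd (w ! j) \<Longrightarrow> side_collar w j = (\<lambda>\<zeta>. exp (c * \<zeta> + b))"
    "\<not> snd (w ! j) \<Longrightarrow> side_collar w j = (\<lambda>\<zeta>. cnj (exp (c * \<zeta> + b)))"
    by (rule side_collar_forms[OF j]) blast
  note e = planar_embedding_side_collar[OF j]
  show ?thesis
  proof (cases "snd (w ! j)")
    case True
    then show ?thesis using has_local_degree_exp[OF _ c(1) z, of b] e c(2) by (simp add: letter_sign_def)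
  next
    case False
    then show ?thesis using has_local_degree_cnj_exp[OF _ c(1) z, of b] e c(3) by (simp add: letter_sign_def)
  qed
qed

lemma planar_embedding_reflected_collar:
  assumes "j < length w" shows "planar_embedding strip (\<lambda>\<zeta>. side_collar w j (- cnj \<zeta>))"
proof -
  have "planar_embedding strip (\<lambda>\<zeta>. - cnj \<zeta>)"
    unfolding planar_embedding_def by (auto intro!: continuous_intros simp: open_strip inj_on_def)
  moreover have "(\<lambda>\<zeta>. - cnj \<zeta>) ` strip \<subseteq> strip" using reflected_strip by blast
  ultimately have "planar_embedding strip (side_collar w j \<circ> (\<lambda>\<zeta>. - cnj \<zeta>))"
    using planar_embedding_compose planar_embedding_side_collar[OF assms] by blast
  then show ?thesis unfolding o_def .
qed

lemma local_degree_reflected_collar: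
  assumes j: "j < length w" and z: "\<zeta> \<in> strip"
  shows "has_local_degree (\<lambda>\<zeta>. side_collar w j (- cnj \<zeta>)) \<zeta> (- letter_sign w j)"
proof -
  obtain c b where c: "c \<noteq> 0" "snd (w ! j) \<Longrightarrow> (\<lambda>\<zeta>. side_collar w j (- cnj \<zeta>)) = (\<lambda>\<zeta>. cnj (exp (- c * \<zeta> + cnj b)))"
    "\<not> snd (w ! j) \<Longrightarrow> (\<lambda>\<zeta>. side_collar w j (- cnj \<zeta>)) = (\<lambda>\<zeta>. exp (- c * \<zeta> + cnj b))"
    by (rule side_collar_forms[OF j]) blast
  note e = planar_embedding_reflected_collar[OF j]
  have c': "- c \<noteq> 0" using c(1) by simp
  show ?thesis
  proof (cases "snd (w ! j)")
    case True
    then show ?thesis using has_local_degree_cnj_exp[OF _ c' z, of "cnj b"] e c(2) by (simp add: letter_sign_def)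
  next
    case False
    then show ?thesis using has_local_degree_exp[OF _ c' z, of "cnj b"] e c(3) by (simp add: letter_sign_def)
  qed
qed

lemma disk_interior_parametrisation:
  shows "continuous_map (top_of_set (ball 0 1)) (word_complex w) (cell_point w)"
    and "inj_on (cell_point w) (ball 0 1)"
proof -
  have "continuous_map (subtopology (top_of_set (cball 0 1)) (ball 0 1)) (word_complex w) (cell_point w)"
    by (rule continuous_map_from_subtopology[OF continuous_map_cell_point])
  moreover have "cball 0 1 \<inter> ball 0 1 = ball (0::complex) 1" by auto
  ultimately show "continuous_map (top_of_set (ball 0 1)) (word_complex w) (cell_point w)"
    unfolding subtopology_subtopology by simp
  show "inj_on (cell_point w) (ball 0 1)"
  proof (rule inj_onI)
    fix x y :: complex assume xy: "x \<in> ball 0 1" "y \<in> ball 0 1" "cell_point w x = cell_point w y"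
    then have "(x, y) \<in> gluing w" using cell_point_eq_iff[of x w y] by auto
    then show "x = y" using gluing_interior[of x y w] xy by simp
  qed
qed

lemma interior_chart_embedding:
  assumes "planar_chart (word_complex w) (U, \<phi>)"
  shows "planar_embedding {y \<in> ball 0 1. cell_point w y \<in> U} (\<phi> \<circ> cell_point w)"
  by (rule planar_chart_parametrisation[OF assms open_ball disk_interior_parametrisation])

text \<open>The chain rule for the two halves of the strip. The reflection in the right half contributes the
factor \<open>-1\<close>, so the two sides of the edge agree exactly if the signs of the letters are opposite.\<close>

lemma glued_strip_degree:
  assumes c: "planar_chart (word_complex w) (U, \<phi>)" and jk: "j < length w" "k < length w"
    and z: "\<zeta> \<in> strip" "glued_strip w j k \<zeta> \<in> U" "has_local_degree (\<phi> \<circ> glued_strip w j k) \<zeta> d"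
  shows "Re \<zeta> < 0 \<Longrightarrow> has_local_degree (\<phi> \<circ> cell_point w) (side_collar w j \<zeta>) l \<Longrightarrow> d = l * letter_sign w j"
    and "Re \<zeta> > 0 \<Longrightarrow> has_local_degree (\<phi> \<circ> cell_point w) (side_collar w k (- cnj \<zeta>)) l \<Longrightarrow> d = l * - letter_sign w k"
proof -
  note g = interior_chart_embedding[OF c]
  have op: "open {\<zeta> \<in> strip. Re \<zeta> < 0}" "open {\<zeta> \<in> strip. Re \<zeta> > 0}"
    unfolding strip_def mem_Collect_eq by (intro open_Collect_conj open_Collect_less continuous_intros)+
  show "d = l * letter_sign w j" if "Re \<zeta> < 0" and l: "has_local_degree (\<phi> \<circ> cell_point w) (side_collar w j \<zeta>) l"
  proof -
    have "has_local_degree ((\<phi> \<circ> cell_point w) \<circ> side_collar w j) \<zeta> (l * letter_sign w j)"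
      by (rule has_local_degree_compose[OF planar_embedding_side_collar[OF jk(1)] z(1) local_degree_side_collar[OF jk(1) z(1)] g _ l])
        (use that z norm_side_collar_cases(1)[OF jk(1)] in \<open>auto simp: glued_strip_def\<close>)
    then have "has_local_degree (\<phi> \<circ> glued_strip w j k) \<zeta> (l * letter_sign w j)"
      by (subst has_local_degree_cong[OF op(1)]) (use that z(1) in \<open>auto simp: glued_strip_def\<close>)
    then show ?thesis using has_local_degree_unique z(3) by blast
  qed
  show "d = l * - letter_sign w k" if "Re \<zeta> > 0" and l: "has_local_degree (\<phi> \<circ> cell_point w) (side_collar w k (- cnj \<zeta>)) l"
  proof -
    have "has_local_degree ((\<phi> \<circ> cell_point w) \<circ> (\<lambda>\<zeta>. side_collar w k (- cnj \<zeta>))) \<zeta> (l * - letter_sign w k)"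
      by (rule has_local_degree_compose[OF planar_embedding_reflected_collar[OF jk(2)] z(1) local_degree_reflected_collar[OF jk(2) z(1)] g _ l])
        (use that z norm_side_collar_cases(1)[OF jk(2)] in \<open>auto simp: glued_strip_def\<close>)
    then have "has_local_degree (\<phi> \<circ> glued_strip w j k) \<zeta> (l * - letter_sign w k)"
      by (subst has_local_degree_cong[OF op(2)]) (use that z(1) in \<open>auto simp: glued_strip_def\<close>)
    then show ?thesis using has_local_degree_unique z(3) by blast
  qed
qed

lemma planar_chart_inverse:
  assumes c: "planar_chart X (U, \<phi>)"
  shows "continuous_map (top_of_set (\<phi> ` U)) X (inv_into U \<phi>)" "inj_on (inv_into U \<phi>) (\<phi> ` U)"
proof -
  note p = planar_chart_props[OF c]
  have inv: "inv_into U \<phi> (\<phi> x) = x" if "x \<in> U" for x using p(4) that by simp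
  show "continuous_map (top_of_set (\<phi> ` U)) X (inv_into U \<phi>)"
    unfolding continuous_map_def
  proof (intro conjI allI impI)
    show "inv_into U \<phi> \<in> topspace (top_of_set (\<phi> ` U)) \<rightarrow> topspace X"
      using inv p(2) by auto
    fix O' assume O': "openin X O'"
    have "{z \<in> topspace (top_of_set (\<phi> ` U)). inv_into U \<phi> z \<in> O'} = \<phi> ` (U \<inter> O')"
      using inv by auto
    moreover have "open (\<phi> ` (U \<inter> O'))"
      by (rule planar_chart_open_image[OF c]) (use p O' in auto)
    ultimately show "openin (top_of_set (\<phi> ` U)) {z \<in> topspace (top_of_set (\<phi> ` U)). inv_into U \<phi> z \<in> O'}"
      by (metis Int_lower1 image_mono open_subset)
  qed
  show "inj_on (inv_into U \<phi>) (\<phi> ` U)" by (rule inj_on_inv_into) simp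
qed

lemma transition_embedding:
  assumes c: "planar_chart X (U, \<phi>)" and c': "planar_chart X (V, \<psi>)"
  shows "planar_embedding (\<phi> ` (U \<inter> V)) (\<psi> \<circ> inv_into U \<phi>)"
proof -
  note p = planar_chart_props[OF c]
  have "{z \<in> \<phi> ` U. inv_into U \<phi> z \<in> V} = \<phi> ` (U \<inter> V)" using p(4) by auto
  then show ?thesis
    using planar_chart_parametrisation[OF c' p(3) planar_chart_inverse[OF c]] by simp
qed

lemma transition_degree:
  assumes c: "planar_chart (word_complex w) (U, \<phi>)" and c': "planar_chart (word_complex w) (V, \<psi>)"
    and y: "y \<in> ball 0 1" "cell_point w y \<in> U \<inter> V"
    and k: "has_local_degree (\<phi> \<circ> cell_point w) y k"
    and l: "has_local_degree (\<psi> \<circ> inv_into U \<phi>) (\<phi> (cell_point w y)) l"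
  shows "has_local_degree (\<psi> \<circ> cell_point w) y (l * k)"
proof -
  note p = planar_chart_props[OF c]
  let ?S = "{y \<in> ball 0 1. cell_point w y \<in> U}" and ?S' = "{y \<in> ball 0 1. cell_point w y \<in> V}"
  have e: "planar_embedding ?S (\<phi> \<circ> cell_point w)" "planar_embedding ?S' (\<psi> \<circ> cell_point w)"
    by (rule interior_chart_embedding; fact)+
  have "has_local_degree ((\<psi> \<circ> inv_into U \<phi>) \<circ> (\<phi> \<circ> cell_point w)) y (l * k)"
    by (rule has_local_degree_compose[OF e(1) _ k transition_embedding[OF c c']]) (use y l in auto)
  then show ?thesis
    by (subst has_local_degree_cong[of "?S \<inter> ?S'"]) (use e y p(4) in \<open>auto simp: planar_embedding_def\<close>)
qed

lemma open_set_meets_interior: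
  assumes "openin (word_complex w) O'" "O' \<noteq> {}"
  obtains y where "y \<in> ball 0 1" "cell_point w y \<in> O'"
proof -
  obtain V where V: "open V" "{z \<in> cball 0 1. cell_point w z \<in> O'} = cball 0 1 \<inter> V"
    using assms(1) unfolding openin_word_complex openin_open by auto
  obtain x where x: "x \<in> O'" using assms(2) by blast
  then have "x \<in> topspace (word_complex w)" using assms(1) openin_subset by blast
  then obtain z where "z \<in> cball 0 1" "x = cell_point w z" by (rule topspace_word_complex_cases)
  then have z: "z \<in> closure (ball 0 1)" "z \<in> V" using V x by auto
  then obtain y where "y \<in> ball 0 1" "y \<in> V"
    using V(1) by (metis IntE disjoint_iff open_Int_closure_eq_empty)
  moreover from this have "y \<in> {z \<in> cball 0 1. cell_point w z \<in> O'}" unfolding V(2) by auto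
  ultimately show ?thesis using that by blast
qed

text \<open>All charts of an oriented atlas have one common degree on the disk, which is constant because
the disk is connected. A chart around the midpoint of the edge has a constant degree along the glued strip, and
comparing its left and right half by \<open>glued_strip_degree\<close> relates the signs of the two letters.\<close>

lemma orientable_opposite_signs:
  assumes X: "surface (word_complex w)" and ori: "orientable (word_complex w)"
    and jk: "j < length w" "k < length w" "fst (w ! j) = fst (w ! k)" "j \<noteq> k"
  shows "snd (w ! j) \<noteq> snd (w ! k)"
proof
  assume same: "snd (w ! j) = snd (w ! k)"
  let ?X = "word_complex w"
  obtain \<A> where A0: "\<forall>c\<in>\<A>. planar_chart ?X c" and tops: "topspace ?X = (\<Union>(U, \<phi>)\<in>\<A>. U)"
    and or0: "\<forall>(U, \<phi>)\<in>\<A>. \<forall>(V, \<psi>)\<in>\<A>. orientation_preserving_on (\<phi> ` (U \<inter> V)) (\<psi> \<circ> inv_into U \<phi>)"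
    using ori unfolding orientable_def by (elim exE conjE)
  have \<A>: "planar_chart ?X (U, \<phi>)" if "(U, \<phi>) \<in> \<A>" for U \<phi> using A0 that by blast
  have or: "orientation_preserving_on (\<phi> ` (U \<inter> V)) (\<psi> \<circ> inv_into U \<phi>)"
    if "(U, \<phi>) \<in> \<A>" "(V, \<psi>) \<in> \<A>" for U \<phi> V \<psi>
    using bspec[OF bspec[OF or0 that(1), unfolded case_prod_conv] that(2), unfolded case_prod_conv] .
  have cover: "\<exists>U \<phi>. (U, \<phi>) \<in> \<A> \<and> x \<in> U" if "x \<in> topspace ?X" for x
    using that tops by auto
  have indep: "has_local_degree (\<psi> \<circ> cell_point w) y s"
    if "(U, \<phi>) \<in> \<A>" "(V, \<psi>) \<in> \<A>" "y \<in> ball 0 1" "cell_point w y \<in> U" "cell_point w y \<in> V"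
      "has_local_degree (\<phi> \<circ> cell_point w) y s" for U \<phi> V \<psi> y s
  proof -
    have "has_local_degree (\<psi> \<circ> inv_into U \<phi>) (\<phi> (cell_point w y)) 1"
      using or[OF that(1,2)] orientation_preserving_on_iff[OF transition_embedding[OF \<A>[OF that(1)] \<A>[OF that(2)]]] that(4,5)
      by blast
    from transition_degree[OF \<A>[OF that(1)] \<A>[OF that(2)] that(3) _ that(6) this]
    show ?thesis using that by simp
  qed
  define Q where "Q s y \<longleftrightarrow> (\<exists>U \<phi>. (U, \<phi>) \<in> \<A> \<and> cell_point w y \<in> U \<and> has_local_degree (\<phi> \<circ> cell_point w) y s)" for s y
  have "\<exists>s\<in>{1,-1}. \<forall>y\<in>ball 0 1. Q s y"
  proof (rule connected_two_valued[where Q = Q])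
    fix y :: complex assume y: "y \<in> ball 0 1"
    then have "cell_point w y \<in> topspace ?X" by (intro cell_point_in_topspace) auto
    then obtain U \<phi> where U: "(U, \<phi>) \<in> \<A>" "cell_point w y \<in> U" using cover by blast
    then obtain s where "has_local_degree (\<phi> \<circ> cell_point w) y s" "s \<in> {-1,1}"
      using has_local_degree_exists[OF interior_chart_embedding[OF \<A>[OF U(1)]], of y] y by auto
    then show "Q 1 y \<or> Q (-1) y" using U unfolding Q_def by blast
    show "\<not> (Q 1 y \<and> Q (-1) y)"
    proof
      assume "Q 1 y \<and> Q (-1) y"
      then have "(1::complex) = -1"
        using indep y has_local_degree_unique unfolding Q_def by metis
      then show False by simp
    qed
  next
    fix s and y :: complex assume y: "y \<in> ball 0 1" "Q s y"
    then obtain U \<phi> where U: "(U, \<phi>) \<in> \<A>" "cell_point w y \<in> U" "has_local_degree (\<phi> \<circ> cell_point w) y s"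
      unfolding Q_def by blast
    then obtain d where "d > 0" "ball y d \<subseteq> {y \<in> ball 0 1. cell_point w y \<in> U}"
      "\<forall>v\<in>ball y d. has_local_degree (\<phi> \<circ> cell_point w) v s"
      using has_local_degree_locally_constant[OF interior_chart_embedding[OF \<A>[OF U(1)]] _ U(3)] y by auto
    then show "\<exists>d>0. \<forall>y\<in>ball y d \<inter> ball 0 1. Q s y"
      using U(1) unfolding Q_def by blast
  qed simp
  then obtain s where s: "s \<in> {1,-1}" "\<And>y. y \<in> ball 0 1 \<Longrightarrow> Q s y" by blast
  let ?E = "glued_strip w j k" and ?z = "\<i> / 2 :: complex"
  have z: "?z \<in> strip" by (simp add: strip_def)
  note cE = continuous_map_glued_strip[OF jk(1-3)]
  have "?E ?z \<in> topspace ?X" using cE z by (auto simp: continuous_map_def)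
  then obtain U \<phi> where U: "(U, \<phi>) \<in> \<A>" "?E ?z \<in> U" using cover by blast
  note ch = \<A>[OF U(1)]
  let ?S = "{\<zeta> \<in> strip. ?E \<zeta> \<in> U}"
  have emb: "planar_embedding ?S (\<phi> \<circ> ?E)"
    by (rule planar_chart_parametrisation[OF ch open_strip cE inj_on_glued_strip[OF jk]])
  obtain d where d: "has_local_degree (\<phi> \<circ> ?E) ?z d"
    using has_local_degree_exists[OF emb, of ?z] z U(2) by blast
  obtain e where e: "e > 0" "ball ?z e \<subseteq> ?S" "\<forall>v\<in>ball ?z e. has_local_degree (\<phi> \<circ> ?E) v d"
    using has_local_degree_locally_constant[OF emb _ d] z U(2) by auto
  have deg: "has_local_degree (\<phi> \<circ> cell_point w) y s" if "y \<in> ball 0 1" "cell_point w y \<in> U" for y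
    using s(2)[OF that(1)] indep[OF _ U(1) that(1) _ that(2)] unfolding Q_def by blast
  define l where "l = ?z - of_real (e / 2)"
  define r where "r = ?z + of_real (e / 2)"
  have l: "l \<in> ball ?z e" "Re l < 0" and r: "r \<in> ball ?z e" "Re r > 0"
    using e(1) by (auto simp: l_def r_def dist_norm)
  have lS: "l \<in> ?S" and rS: "r \<in> ?S" using l r e(2) by auto
  have "d = s * letter_sign w j"
  proof (rule glued_strip_degree(1)[OF ch jk(1,2) _ _ _ l(2)])
    show "has_local_degree (\<phi> \<circ> cell_point w) (side_collar w j l) s"
      by (rule deg) (use lS l(2) norm_side_collar_cases(1)[OF jk(1)] in \<open>auto simp: glued_strip_def\<close>)
  qed (use lS l e(3) in auto)
  moreover have "d = s * - letter_sign w k"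
  proof (rule glued_strip_degree(2)[OF ch jk(1,2) _ _ _ r(2)])
    show "has_local_degree (\<phi> \<circ> cell_point w) (side_collar w k (- cnj r)) s"
      by (rule deg) (use rS r(2) norm_side_collar_cases(1)[OF jk(2)] in \<open>auto simp: glued_strip_def\<close>)
  qed (use rS r e(3) in auto)
  ultimately show False using s(1) same by (auto simp: letter_sign_def split: if_splits)
qed

lemma planar_chart_restrict:
  assumes c: "planar_chart X (U, \<phi>)" and V: "openin X V" "V \<subseteq> U"
  shows "planar_chart X (V, \<phi>)"
proof -
  note p = planar_chart_props[OF c]
  have h: "homeomorphic_map (subtopology X U) (top_of_set (\<phi> ` U)) \<phi>"
    using c unfolding planar_chart_def by auto
  have "homeomorphic_map (subtopology (subtopology X U) V) (subtopology (top_of_set (\<phi> ` U)) (\<phi> ` V)) \<phi>"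
    by (rule homeomorphic_map_subtopologies_alt[OF h]) (use p(4) V(2) in \<open>auto simp: inj_on_def\<close>)
  moreover have "U \<inter> V = V" "\<phi> ` U \<inter> \<phi> ` V = \<phi> ` V" using V(2) by auto
  ultimately have "homeomorphic_map (subtopology X V) (top_of_set (\<phi> ` V)) \<phi>"
    unfolding subtopology_subtopology by simp
  then show ?thesis using V(1) planar_chart_open_image[OF c V] unfolding planar_chart_def by auto
qed

lemma planar_chart_cnj:
  assumes c: "planar_chart X (U, \<phi>)"
  shows "planar_chart X (U, cnj \<circ> \<phi>)"
proof -
  note p = planar_chart_props[OF c]
  have h: "homeomorphic_map (subtopology X U) (top_of_set (\<phi> ` U)) \<phi>"
    using c unfolding planar_chart_def by auto
  have "homeomorphic_maps (top_of_set (\<phi> ` U)) (top_of_set (cnj ` \<phi> ` U)) cnj cnj"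
    unfolding homeomorphic_maps_def by (auto simp: continuous_map_subtopology_eu intro!: continuous_intros)
  then have "homeomorphic_map (top_of_set (\<phi> ` U)) (top_of_set (cnj ` \<phi> ` U)) cnj"
    using homeomorphic_map_maps by blast
  from homeomorphic_map_compose[OF h this]
  have "homeomorphic_map (subtopology X U) (top_of_set ((cnj \<circ> \<phi>) ` U)) (cnj \<circ> \<phi>)" by (simp add: image_comp)
  moreover have "open ((cnj \<circ> \<phi>) ` U)"
  proof -
    have "planar_embedding (\<phi> ` U) cnj"
      using p(3) unfolding planar_embedding_def by (auto intro!: continuous_intros simp: inj_on_def)
    from planar_embedding_open_image[OF this] show ?thesis by (simp add: image_comp)
  qed
  ultimately show ?thesis using p(1) unfolding planar_chart_def by auto
qed

text \<open>Shrink a chart until its image is a disk. Without the finitely many vertices this image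
stays connected, and at each remaining point the degree relative to the open disk is locally constant: at
points of edges by the comparison along the glued strip, where the opposite signs are used. Hence the degree
is constant, and composing with complex conjugation makes it \<open>1\<close>.\<close>

lemma positive_chart_exists:
  assumes X: "surface (word_complex w)"
    and opp: "\<And>j k. j < length w \<Longrightarrow> k < length w \<Longrightarrow> fst (w ! j) = fst (w ! k) \<Longrightarrow> j \<noteq> k \<Longrightarrow> snd (w ! j) \<noteq> snd (w ! k)"
    and x: "x \<in> topspace (word_complex w)"
  shows "\<exists>U \<phi>. planar_chart (word_complex w) (U, \<phi>) \<and> x \<in> U \<and> chart_degree w U \<phi> 1"
proof -
  let ?X = "word_complex w" and ?F = "zero_cells w"
  have finF: "finite ?F" unfolding zero_cells_def by simp
  obtain U0 \<phi> where U0: "planar_chart ?X (U0, \<phi>)" "x \<in> U0" using X x unfolding surface_def by blast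
  note p0 = planar_chart_props[OF U0(1)]
  obtain R where R: "R > 0" "ball (\<phi> x) R \<subseteq> \<phi> ` U0" using p0(3) U0(2) by (meson imageI open_contains_ball)
  define U where "U = {u \<in> U0. \<phi> u \<in> ball (\<phi> x) R}"
  have c: "planar_chart ?X (U, \<phi>)"
    by (rule planar_chart_restrict[OF U0(1)]) (use planar_chart_inverse_open[OF U0(1) open_ball] in \<open>auto simp: U_def\<close>)
  note p = planar_chart_props[OF c]
  have im: "\<phi> ` U = ball (\<phi> x) R" using R(2) by (auto simp: U_def)
  have xU: "x \<in> U" using U0(2) R(1) by (simp add: U_def)
  let ?P = "ball (\<phi> x) R - \<phi> ` (U \<inter> ?F)"
  have conP: "connected ?P"
    by (rule connected_open_diff_countable) (use finF in \<open>auto intro: countable_finite\<close>)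
  let ?S = "{y \<in> ball 0 1. cell_point w y \<in> U}" and ?f = "\<phi> \<circ> cell_point w"
  have emb: "planar_embedding ?S ?f" by (rule interior_chart_embedding[OF c])
  \<comment> \<open>the degree relative to the open disk near \<open>z\<close>; the definition makes sense at points of edges, too\<close>
  define Q where "Q k z \<longleftrightarrow> (\<exists>\<delta>>0. \<forall>y\<in>?S. ?f y \<in> ball z \<delta> \<longrightarrow> has_local_degree ?f y k)" for k z
  have "\<exists>k\<in>{1,-1}. \<forall>z\<in>?P. Q k z"
  proof (rule connected_two_valued[where Q = Q, OF conP])
    fix z assume z: "z \<in> ?P"
    then have "z \<in> \<phi> ` U" using im by simp
    then obtain v where v': "v \<in> U" "z = \<phi> v" by blast
    then have v: "v \<in> U" "z = \<phi> v" "v \<notin> ?F" using z by auto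
    then obtain y0 where y0: "y0 \<in> cball 0 1" "v = cell_point w y0"
      using p(2) topspace_word_complex_cases by blast
    have "\<exists>k\<in>{1,-1}. Q k z"
    proof (rule disk_cases[OF y0(1) surface_word_nonempty[OF X]])
      assume "norm y0 < 1"
      then have y0S: "y0 \<in> ?S" using v y0 by simp
      obtain k where k: "has_local_degree ?f y0 k" "k \<in> {-1,1}" by (rule has_local_degree_exists[OF emb y0S])
      obtain d where d: "d > 0" "ball y0 d \<subseteq> ?S" "\<forall>y\<in>ball y0 d. has_local_degree ?f y k"
        using has_local_degree_locally_constant[OF emb y0S k(1)] by blast
      have "open (?f ` ball y0 d)"
        by (rule planar_embedding_open_image[OF planar_embedding_subset[OF emb open_ball d(2)]])
      moreover have "z \<in> ?f ` ball y0 d" using v(2) y0(2) d(1) by auto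
      ultimately obtain \<delta> where \<delta>: "\<delta> > 0" "ball z \<delta> \<subseteq> ?f ` ball y0 d" by (meson open_contains_ball)
      have "has_local_degree ?f y k" if y: "y \<in> ?S" "?f y \<in> ball z \<delta>" for y
      proof -
        obtain y' where y': "y' \<in> ball y0 d" "?f y = ?f y'" using \<delta>(2) y(2) by blast
        then have "y = y'" using emb y(1) d(2) unfolding planar_embedding_def by (meson inj_onD subsetD)
        then show ?thesis using d(3) y'(1) by blast
      qed
      then show ?thesis using \<delta>(1) k(2) unfolding Q_def by blast
    next
      fix j \<zeta>0 assume j: "j < length w" "\<zeta>0 \<in> strip" "Re \<zeta>0 = 0" "y0 = side_collar w j \<zeta>0"
      obtain k where k: "k < length w" "k \<noteq> j" "fst (w ! k) = fst (w ! j)"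
        using surface_letter_twice[OF X j(1)] by blast
      have "snd (w ! j) \<noteq> snd (w ! k)" using opp j(1) k by metis
      then obtain a b where ab: "a < length w" "b < length w" "fst (w ! a) = fst (w ! b)" "a \<noteq> b"
        "snd (w ! a)" "\<not> snd (w ! b)" "fst (w ! a) = fst (w ! j)"
        using j(1) k by metis
      let ?E = "glued_strip w a b"
      have Ez: "?E \<zeta>0 = v"
        using gluing_collar[of a w j \<zeta>0] ab j cell_point_eq_iff[of "side_collar w a \<zeta>0" w y0] norm_side_collar_cases(2)[OF ab(1), of \<zeta>0]
        by (simp add: glued_strip_def y0(2))
      let ?T = "{\<zeta> \<in> strip. ?E \<zeta> \<in> U}"
      have embE: "planar_embedding ?T (\<phi> \<circ> ?E)"
        by (rule planar_chart_parametrisation[OF c open_strip continuous_map_glued_strip[OF ab(1-3)] inj_on_glued_strip[OF ab(1-4)]])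
      have z0: "\<zeta>0 \<in> ?T" using j(2) Ez v(1) by simp
      obtain m where m: "has_local_degree (\<phi> \<circ> ?E) \<zeta>0 m" "m \<in> {-1,1}" by (rule has_local_degree_exists[OF embE z0])
      obtain d where d: "d > 0" "ball \<zeta>0 d \<subseteq> ?T" "\<forall>y\<in>ball \<zeta>0 d. has_local_degree (\<phi> \<circ> ?E) y m"
        using has_local_degree_locally_constant[OF embE z0 m(1)] by blast
      have "open ((\<phi> \<circ> ?E) ` ball \<zeta>0 d)"
        by (rule planar_embedding_open_image[OF planar_embedding_subset[OF embE open_ball d(2)]])
      moreover have "z \<in> (\<phi> \<circ> ?E) ` ball \<zeta>0 d" using v(2) Ez d(1) by (auto intro!: image_eqI[of _ _ \<zeta>0])
      ultimately obtain \<delta> where \<delta>: "\<delta> > 0" "ball z \<delta> \<subseteq> (\<phi> \<circ> ?E) ` ball \<zeta>0 d" by (meson open_contains_ball)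
      have "has_local_degree ?f y m" if y: "y \<in> ?S" "?f y \<in> ball z \<delta>" for y
      proof -
        obtain \<zeta> where \<zeta>: "\<zeta> \<in> ball \<zeta>0 d" "?f y = \<phi> (?E \<zeta>)" using \<delta>(2) y(2) by fastforce
        have \<zeta>T: "\<zeta> \<in> ?T" using d(2) \<zeta>(1) by blast
        have E: "?E \<zeta> = cell_point w y" using p(4) \<zeta>T y(1) \<zeta>(2) by (auto simp: inj_on_def)
        obtain l where l: "has_local_degree ?f y l" using has_local_degree_exists[OF emb y(1)] by blast
        have md: "has_local_degree (\<phi> \<circ> ?E) \<zeta> m" using d(3) \<zeta>(1) by blast
        have n: "norm y < 1" using y(1) by simp
        note D = glued_strip_eqD[OF ab(1-3) _ E n]
        have \<zeta>s: "\<zeta> \<in> strip" "?E \<zeta> \<in> U" using \<zeta>T by auto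
        consider "Re \<zeta> < 0" | "Re \<zeta> > 0" using D(1)[OF \<zeta>s(1)] by linarith
        then have "m = l"
        proof cases
          case 1
          have "m = l * letter_sign w a"
            by (rule glued_strip_degree(1)[OF c ab(1,2) \<zeta>s md 1]) (use D(2)[OF \<zeta>s(1) 1] l in simp)
          then show ?thesis using ab(5) by (simp add: letter_sign_def)
        next
          case 2
          have "m = l * - letter_sign w b"
            by (rule glued_strip_degree(2)[OF c ab(1,2) \<zeta>s md 2]) (use D(3)[OF \<zeta>s(1) 2] l in simp)
          then show ?thesis using ab(6) by (simp add: letter_sign_def)
        qed
        then show ?thesis using l by simp
      qed
      then show ?thesis using \<delta>(1) m(2) unfolding Q_def by blast
    next
      assume "cell_point w y0 \<in> ?F"
      then show ?thesis using v(3) y0(2) by simp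
    qed
    then show "Q 1 z \<or> Q (-1) z" by blast
    show "\<not> (Q 1 z \<and> Q (-1) z)"
    proof
      assume "Q 1 z \<and> Q (-1) z"
      then obtain \<delta> \<delta>' where \<delta>: "\<delta> > 0" "\<delta>' > 0"
        "\<And>y. y \<in> ?S \<Longrightarrow> ?f y \<in> ball z \<delta> \<Longrightarrow> has_local_degree ?f y 1"
        "\<And>y. y \<in> ?S \<Longrightarrow> ?f y \<in> ball z \<delta>' \<Longrightarrow> has_local_degree ?f y (-1)"
        unfolding Q_def by blast
      have op: "openin ?X {u \<in> U. \<phi> u \<in> ball z (min \<delta> \<delta>')}" by (rule planar_chart_inverse_open[OF c open_ball])
      have "v \<in> {u \<in> U. \<phi> u \<in> ball z (min \<delta> \<delta>')}" using v \<delta> by simp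
      then have ne: "{u \<in> U. \<phi> u \<in> ball z (min \<delta> \<delta>')} \<noteq> {}" by blast
      obtain y where y: "y \<in> ball 0 1" "cell_point w y \<in> {u \<in> U. \<phi> u \<in> ball z (min \<delta> \<delta>')}"
        by (rule open_set_meets_interior[OF op ne])
      then have "has_local_degree ?f y 1" "has_local_degree ?f y (-1)" using \<delta>(3,4)[of y] by auto
      then have "(1::complex) = -1" by (rule has_local_degree_unique)
      then show False by simp
    qed
  next
    fix k z assume "z \<in> ?P" "Q k z"
    then obtain \<delta> where \<delta>: "\<delta> > 0" "\<forall>y\<in>?S. ?f y \<in> ball z \<delta> \<longrightarrow> has_local_degree ?f y k" unfolding Q_def by blast
    have "Q k z'" if "z' \<in> ball z (\<delta>/2)" for z'
    proof -
      have "ball z' (\<delta>/2) \<subseteq> ball z \<delta>"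
      proof
        fix u assume "u \<in> ball z' (\<delta>/2)"
        then show "u \<in> ball z \<delta>" using that dist_triangle[of z u z'] by (simp add: dist_commute)
      qed
      then show ?thesis unfolding Q_def using \<delta> by (intro exI[of _ "\<delta>/2"]) auto
    qed
    then show "\<exists>d>0. \<forall>y\<in>ball z d \<inter> ?P. Q k y" using \<delta>(1) by (intro exI[of _ "\<delta>/2"]) auto
  qed
  then obtain k where k: "k \<in> {1,-1}" "\<And>z. z \<in> ?P \<Longrightarrow> Q k z" by blast
  have deg: "chart_degree w U \<phi> k"
    unfolding chart_degree_def
  proof (intro ballI impI)
    fix y :: complex assume y: "y \<in> ball 0 1" "cell_point w y \<in> U"
    have "cell_point w y \<notin> ?F"
    proof
      assume "cell_point w y \<in> ?F"
      then obtain j where "j < length w" "cell_point w y = cell_point w (cis (2 * pi * real j / real (length w)))"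
        unfolding zero_cells_def by auto
      moreover have "y \<in> cball 0 1" using y(1) by simp
      ultimately have "(y, cis (2 * pi * real j / real (length w))) \<in> gluing w" using cell_point_eq_iff by blast
      then have "cis (2 * pi * real j / real (length w)) = y" using gluing_interior y(1) by simp
      then have "norm y = 1" by (metis norm_cis)
      then show False using y(1) by simp
    qed
    then have "?f y \<in> ?P" using y(2) im p(4) by (auto simp: inj_on_def)
    then obtain \<delta> where "\<delta> > 0" "\<forall>y'\<in>?S. ?f y' \<in> ball (?f y) \<delta> \<longrightarrow> has_local_degree ?f y' k"
      using k(2) unfolding Q_def by blast
    then show "has_local_degree ?f y k" using y by simp
  qed
  show ?thesis
  proof (cases "k = 1")
    case True
    then show ?thesis using c xU deg by blast
  next
    case False
    then have km: "k = -1" using k(1) by simp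
    have "chart_degree w U (cnj \<circ> \<phi>) 1"
      unfolding chart_degree_def
    proof (intro ballI impI)
      fix y :: complex assume y: "y \<in> ball 0 1" "cell_point w y \<in> U"
      then have "has_local_degree ?f y (-1)" using deg km unfolding chart_degree_def by blast
      then have "has_local_degree (cnj \<circ> ?f) y (- (-1))" by (intro has_local_degree_cnj[OF emb]) (use y in auto)
      then show "has_local_degree ((cnj \<circ> \<phi>) \<circ> cell_point w) y 1" by (simp add: comp_assoc)
    qed
    then show ?thesis using planar_chart_cnj[OF c] xU by blast
  qed
qed

text \<open>All charts of degree \<open>1\<close> are taken. Between two of them the transition has
degree \<open>1\<close> at the points coming from the open disk, and these are dense.\<close>

lemma opposite_signs_orientable:
  assumes X: "surface (word_complex w)"
    and opp: "\<And>j k. j < length w \<Longrightarrow> k < length w \<Longrightarrow> fst (w ! j) = fst (w ! k) \<Longrightarrow> j \<noteq> k \<Longrightarrow> snd (w ! j) \<noteq> snd (w ! k)"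
  shows "orientable (word_complex w)"
proof -
  let ?X = "word_complex w"
  define \<A> where "\<A> = {(U, \<phi>). planar_chart ?X (U, \<phi>) \<and> chart_degree w U \<phi> 1}"
  have "orientation_preserving_on (\<phi> ` (U \<inter> V)) (\<psi> \<circ> inv_into U \<phi>)"
    if c: "planar_chart ?X (U, \<phi>)" "chart_degree w U \<phi> 1" and c': "planar_chart ?X (V, \<psi>)" "chart_degree w V \<psi> 1"
    for U \<phi> V \<psi>
  proof -
    note p = planar_chart_props[OF c(1)]
    let ?t = "\<psi> \<circ> inv_into U \<phi>"
    note emb = transition_embedding[OF c(1) c'(1)]
    have "has_local_degree ?t z 1" if z: "z \<in> \<phi> ` (U \<inter> V)" for z
    proof -
      obtain k where k: "has_local_degree ?t z k" using has_local_degree_exists[OF emb z] by blast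
      obtain d where d: "d > 0" "ball z d \<subseteq> \<phi> ` (U \<inter> V)" "\<forall>y\<in>ball z d. has_local_degree ?t y k"
        using has_local_degree_locally_constant[OF emb z k] by blast
      have op: "openin ?X {u \<in> U. \<phi> u \<in> ball z d}" by (rule planar_chart_inverse_open[OF c(1) open_ball])
      have ne: "{u \<in> U. \<phi> u \<in> ball z d} \<noteq> {}" using z d(1) by auto
      obtain y where "y \<in> ball 0 1" "cell_point w y \<in> {u \<in> U. \<phi> u \<in> ball z d}"
        by (rule open_set_meets_interior[OF op ne])
      then have y: "y \<in> ball 0 1" "cell_point w y \<in> U" "\<phi> (cell_point w y) \<in> ball z d" by blast+
      have "\<phi> (cell_point w y) \<in> \<phi> ` (U \<inter> V)" using y(3) d(2) by blast
      then have yV: "cell_point w y \<in> U \<inter> V" using y(2) p(4) by (auto simp: inj_on_def)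
      have "has_local_degree (\<psi> \<circ> cell_point w) y (k * 1)"
        by (rule transition_degree[OF c(1) c'(1) y(1) yV]) (use c(2) y d(3) in \<open>auto simp: chart_degree_def\<close>)
      moreover have "has_local_degree (\<psi> \<circ> cell_point w) y 1" using c'(2) y(1) yV by (auto simp: chart_degree_def)
      ultimately have "k = 1" using has_local_degree_unique by fastforce
      then show ?thesis using k by simp
    qed
    then show ?thesis using orientation_preserving_on_iff[OF emb] by blast
  qed
  moreover have "topspace ?X = (\<Union>(U, \<phi>)\<in>\<A>. U)"
  proof
    show "topspace ?X \<subseteq> (\<Union>(U, \<phi>)\<in>\<A>. U)"
      using positive_chart_exists[OF X opp] unfolding \<A>_def by fast
    show "(\<Union>(U, \<phi>)\<in>\<A>. U) \<subseteq> topspace ?X"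
      using planar_chart_props(2) unfolding \<A>_def by blast
  qed
  ultimately show ?thesis
    unfolding orientable_def by (intro exI[of _ \<A>]) (auto simp: \<A>_def)
qed

section \<open>Reducing words\<close>

definition inverse_word :: "group_word \<Rightarrow> group_word" where
  "inverse_word w = rev (map (\<lambda>(x, s). (x, \<not> s)) w)"

definition each_letter_twice :: "group_word \<Rightarrow> bool" where
  "each_letter_twice w \<longleftrightarrow> (\<forall>x. count_list (map fst w) x \<in> {0, 2})"

text \<open>The steps by which letters are integrated out. \<open>E\<close> counts the letters, \<open>N\<close> the steps that remove a
letter with two occurrences of the same sign (each contributes the Frobenius-Schur indicator), and \<open>v\<close> the
cancellations (each contributes a factor \<open>dim V\<close>). In terms of surfaces the three steps split off a projective
plane, a sphere and a torus; only the second one removes a vertex, and \<open>v + 1\<close> is the number of vertices.\<close>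

inductive word_reduction :: "group_word \<Rightarrow> nat \<Rightarrow> nat \<Rightarrow> nat \<Rightarrow> bool" where
  empty: "word_reduction [] 0 0 0"
| crosscap: "word_reduction (a @ inverse_word u @ b) E N v \<Longrightarrow> x \<notin> word_letters (a @ u @ b) \<Longrightarrow>
    word_reduction (a @ (x, s) # u @ (x, s) # b) (Suc E) (Suc N) v"
| cancel: "word_reduction (a @ b) E N v \<Longrightarrow> x \<notin> word_letters (a @ b) \<Longrightarrow>
    word_reduction (a @ (x, s) # (x, \<not> s) # b) (Suc E) N (Suc v)"
| handle: "word_reduction (p @ u @ q) E N v \<Longrightarrow> a @ b = p @ (y, \<not> r) # q \<Longrightarrow>
    x \<notin> word_letters (p @ u @ q) \<Longrightarrow> y \<notin> word_letters (p @ u @ q) \<Longrightarrow> x \<noteq> y \<Longrightarrow>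
    word_reduction (a @ (x, s) # (y, r) # u @ (x, \<not> s) # b) (Suc (Suc E)) N v"

lemma word_letters_simps [simp]:
  "word_letters [] = {}" "word_letters (p # w) = insert (fst p) (word_letters w)"
  "word_letters (u @ w) = word_letters u \<union> word_letters w" "word_letters (inverse_word w) = word_letters w"
  by (force simp: word_letters_def inverse_word_def)+

lemma finite_word_letters [simp]: "finite (word_letters w)"
  by (simp add: word_letters_def)

lemma word_letters_memD: "x \<in> word_letters w \<Longrightarrow> \<exists>s. (x, s) \<in> set w"
  by (auto simp: word_letters_def)

lemma handle_letters:
  assumes "a @ b = p @ (y, r) # q"
  shows "word_letters a \<union> word_letters b = insert y (word_letters (p @ q))"
  using arg_cong[OF assms, of word_letters] by simp

lemma handle_distinct:
  assumes "a @ b = p @ (y, \<not> r) # q"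
    and "x \<notin> word_letters (p @ u @ q)" "y \<notin> word_letters (p @ u @ q)" "x \<noteq> y"
  shows "distinct (a @ (x, s) # (y, r) # u @ (x, \<not> s) # b) \<longleftrightarrow> distinct (p @ u @ q)"
proof -
  have "mset (a @ (x, s) # (y, r) # u @ (x, \<not> s) # b) = mset ((x, s) # (x, \<not> s) # (y, r) # u @ (a @ b))"
    by simp
  also have "\<dots> = mset ((x, s) # (x, \<not> s) # (y, r) # (y, \<not> r) # p @ u @ q)"
    unfolding assms(1) by simp
  finally have "distinct (a @ (x, s) # (y, r) # u @ (x, \<not> s) # b)
     \<longleftrightarrow> distinct ((x, s) # (x, \<not> s) # (y, r) # (y, \<not> r) # p @ u @ q)"
    by (rule mset_eq_imp_distinct_iff)
  also have "\<dots> \<longleftrightarrow> distinct (p @ u @ q)"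
    using assms(2-4) by (force simp: word_letters_def)
  finally show ?thesis .
qed

lemma word_reduction_invariants:
  assumes "word_reduction w E N v"
  shows "E = card (word_letters w)" "even (E + N + v)" "v \<le> E" "0 < N \<Longrightarrow> v < E" "N = 0 \<longleftrightarrow> distinct w"
proof -
  have "E = card (word_letters w) \<and> even (E + N + v) \<and> v \<le> E \<and> (0 < N \<longrightarrow> v < E) \<and> (N = 0 \<longleftrightarrow> distinct w)"
    using assms
  proof induction
    case (handle p u q E N v a b y r x s)
    have L: "word_letters (a @ (x, s) # (y, r) # u @ (x, \<not> s) # b) = insert x (insert y (word_letters (p @ u @ q)))"
      using handle_letters[OF handle.hyps(2)] by auto
    have C: "card (word_letters (a @ (x, s) # (y, r) # u @ (x, \<not> s) # b)) = Suc (Suc E)"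
      unfolding L using handle.hyps(3-5) handle.IH by (simp del: word_letters_simps)
    show ?case
      unfolding C handle_distinct[OF handle.hyps(2-5), of s]
      using conjunct2[OF handle.IH] by (simp del: word_letters_simps distinct_append)
  next
    case (crosscap a u b E N v x s)
    have L: "word_letters (a @ (x, s) # u @ (x, s) # b) = insert x (word_letters (a @ inverse_word u @ b))" by auto
    have "card (word_letters (a @ (x, s) # u @ (x, s) # b)) = Suc E"
      unfolding L using crosscap.hyps(2) crosscap.IH by (subst card_insert_disjoint) auto
    then show ?case using crosscap.IH by auto
  next
    case (cancel a b E N v x s)
    have L: "word_letters (a @ (x, s) # (x, \<not> s) # b) = insert x (word_letters (a @ b))" by auto
    have C: "card (word_letters (a @ (x, s) # (x, \<not> s) # b)) = Suc E"
      unfolding L using cancel.hyps(2) cancel.IH by (subst card_insert_disjoint) auto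
    have D: "distinct (a @ (x, s) # (x, \<not> s) # b) \<longleftrightarrow> distinct (a @ b)"
      using cancel.hyps(2) by (force simp: word_letters_def)
    show ?case
      unfolding C D using conjunct2[OF cancel.IH] by (simp del: word_letters_simps distinct_append)
  qed simp
  then show "E = card (word_letters w)" "even (E + N + v)" "v \<le> E" "0 < N \<Longrightarrow> v < E" "N = 0 \<longleftrightarrow> distinct w"
    by blast+
qed

lemma count_letters_zero: "count_list (map fst w) x = 0 \<longleftrightarrow> x \<notin> word_letters w"
  by (simp add: word_letters_def count_list_0_iff)

lemma count_letters_positions:
  "count_list (map fst w) x = card {j. j < length w \<and> fst (w ! j) = x}"
proof -
  have "count_list (map fst w) x = length (filter (\<lambda>p. fst p = x) w)" by (induction w) auto
  then show ?thesis by (simp only: length_filter_conv_card)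
qed

text \<open>A letter with two occurrences of the same sign is removed first. Otherwise take a letter whose two
occurrences are as close together as possible: nothing between them can occur there twice. Either nothing is
between them and the pair cancels, or the first letter in between has its other occurrence outside and forms
a handle with the chosen one.\<close>

lemma word_reduction_exists:
  assumes "each_letter_twice w" shows "\<exists>E N v. word_reduction w E N v"
  using assms
proof (induction "length w" arbitrary: w rule: less_induct)
  case less
  have cnt: "count_list (map fst w) x \<in> {0, 2}" for x using less.prems by (simp add: each_letter_twice_def)
  show ?case
  proof (cases "distinct w")
    case False
    then obtain a u b l where "w = a @ [l] @ u @ [l] @ b" using not_distinct_decomp by blast
    then obtain x s where w: "w = a @ (x, s) # u @ (x, s) # b" by (cases l) auto
    have x: "x \<notin> word_letters (a @ u @ b)"
      using cnt[of x] count_letters_zero[of a x] count_letters_zero[of u x] count_letters_zero[of b x] by (auto simp: w)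
    have "each_letter_twice (a @ inverse_word u @ b)"
      unfolding each_letter_twice_def
    proof
      fix y
      have "map fst (inverse_word u) = rev (map fst u)"
        by (simp add: inverse_word_def rev_map split_def o_def)
      then show "count_list (map fst (a @ inverse_word u @ b)) y \<in> {0, 2}"
        using cnt[of y] by (auto simp: w split: if_splits)
    qed
    moreover have "length (a @ inverse_word u @ b) < length w" by (simp add: w inverse_word_def)
    ultimately obtain E N v where "word_reduction (a @ inverse_word u @ b) E N v" using less.hyps by blast
    then show ?thesis using word_reduction.crosscap[OF _ x] unfolding w by blast
  next
    case dist: True
    show ?thesis
    proof (cases "w = []")
      case True
      then show ?thesis using word_reduction.empty by blast
    next
      case False
      \<comment> \<open>the lengths of the subwords enclosed by two occurrences of one letter\<close>
      define P where "P n \<longleftrightarrow> (\<exists>a x s u t b. w = a @ (x, s) # u @ (x, t) # b \<and> length u = n)" for n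
      have "\<exists>n. P n"
      proof -
        have "\<not> distinct (map fst w)"
        proof
          assume d: "distinct (map fst w)"
          obtain l w' where w: "w = l # w'" using False by (cases w) auto
          then have "count_list (map fst w') (fst l) = 1" using cnt[of "fst l"] by auto
          then have "fst l \<in> word_letters w'" using count_letters_zero[of w' "fst l"] by auto
          then show False using d w by (auto simp: word_letters_def)
        qed
        then obtain xs ys zs y where "map fst w = xs @ [y] @ ys @ [y] @ zs" using not_distinct_decomp by blast
        then show ?thesis
          by (auto simp: map_eq_append_conv map_eq_Cons_conv append_eq_map_conv Cons_eq_map_conv P_def)
            blast
      qed
      then obtain n where n: "P n" "\<And>m. P m \<Longrightarrow> n \<le> m" using exists_least_iff[of P] by (metis not_less)
      then obtain a x s u t b where w0: "w = a @ (x, s) # u @ (x, t) # b" "length u = n" unfolding P_def by blast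
      have t: "t = (\<not> s)" using dist unfolding w0(1) by auto
      note w = w0(1)[unfolded t]
      have x: "x \<notin> word_letters (a @ u @ b)"
        using cnt[of x] count_letters_zero[of a x] count_letters_zero[of u x] count_letters_zero[of b x] by (auto simp: w)
      show ?thesis
      proof (cases u)
        case Nil
        have "each_letter_twice (a @ b)"
          unfolding each_letter_twice_def
        proof
          fix y show "count_list (map fst (a @ b)) y \<in> {0, 2}"
            using cnt[of y] by (auto simp: w Nil split: if_splits)
        qed
        moreover have "length (a @ b) < length w" by (simp add: w)
        ultimately obtain E N v where "word_reduction (a @ b) E N v" using less.hyps by blast
        then show ?thesis using word_reduction.cancel[of a b] x unfolding w Nil by force
      next
        case (Cons l u')
        then obtain y r where u: "u = (y, r) # u'" by (cases l) auto
        have xy: "x \<noteq> y" using x by (auto simp: u)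
        have y': "y \<notin> word_letters u'"
        proof
          assume "y \<in> word_letters u'"
          then obtain r' where "(y, r') \<in> set u'" by (auto simp: word_letters_def)
          then obtain c d where cd: "u' = c @ (y, r') # d" by (meson split_list)
          have "w = (a @ [(x, s)]) @ (y, r) # c @ (y, r') # (d @ (x, t) # b)" using w0(1) by (simp add: u cd)
          then have "P (length c)" unfolding P_def by blast
          then have "n \<le> length c" by (rule n(2))
          then show False using w0(2) by (simp add: u cd)
        qed
        have cy: "count_list (map fst (a @ b)) y = 1"
          using cnt[of y] y' xy count_letters_zero[of u' y] by (auto simp: w u)
        then have "y \<in> word_letters (a @ b)" using count_letters_zero[of "a @ b" y] by auto
        then obtain r' where "(y, r') \<in> set (a @ b)" using word_letters_memD by blast
        then obtain p q where pq: "a @ b = p @ (y, r') # q" by (meson split_list)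
        have "(y, r) \<in> set u" "set u \<inter> set (a @ b) = {}" using dist by (auto simp: w u)
        then have r': "r' = (\<not> r)" using \<open>(y, r') \<in> set (a @ b)\<close> by auto
        note pq' = pq[unfolded r']
        have ab: "count_list (map fst (a @ b)) z = count_list (map fst p) z + count_list (map fst q) z + (if z = y then 1 else 0)" for z
          unfolding pq by simp
        have "each_letter_twice (p @ u' @ q)"
          unfolding each_letter_twice_def
        proof
          fix z show "count_list (map fst (p @ u' @ q)) z \<in> {0, 2}"
            using cnt[of z] ab[of z] cy xy y' count_letters_zero[of u' y] by (auto simp: w u split: if_splits)
        qed
        moreover have "length (p @ u' @ q) < length w"
          using arg_cong[OF pq, of length] by (simp add: w u)
        ultimately obtain E N v where R: "word_reduction (p @ u' @ q) E N v" using less.hyps by blast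
        have "y \<notin> word_letters (p @ u' @ q)" 
          using cy ab[of y] y' count_letters_zero[of p y] count_letters_zero[of q y] by simp
        moreover have "x \<notin> word_letters (p @ u' @ q)"
          using x arg_cong[OF pq, of word_letters] by (auto simp: u)
        ultimately show ?thesis
          using word_reduction.handle[OF R pq' _ _ xy, of s] unfolding w u by auto
      qed
    qed
  qed
qed

section \<open>Integrals of matrices\<close>

text \<open>Boundedness makes all integrals exist and is stable under matrix multiplication.\<close>

definition bounded_matrix_function :: "'x measure \<Rightarrow> ('x \<Rightarrow> complex^'m^'m) \<Rightarrow> bool" where
  "bounded_matrix_function N F \<longleftrightarrow> (\<forall>i j. (\<lambda>x. F x $ i $ j) \<in> borel_measurable N) \<and>
     (\<exists>B. \<forall>x\<in>space N. \<forall>i j. norm (F x $ i $ j) \<le> B)"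

lemma bounded_matrix_function_const: "bounded_matrix_function N (\<lambda>x. A)"
proof -
  have "norm (A $ i $ j) \<le> (\<Sum>i\<in>UNIV. \<Sum>j\<in>UNIV. norm (A $ i $ j))" for i j
    by (rule order_trans[OF member_le_sum[of j UNIV "\<lambda>j. norm (A $ i $ j)"]
          member_le_sum[of i UNIV "\<lambda>i. \<Sum>j\<in>UNIV. norm (A $ i $ j)"]]) (auto intro: sum_nonneg)
  then show ?thesis unfolding bounded_matrix_function_def by auto
qed

lemma bounded_matrix_function_mult:
  fixes F G :: "'x \<Rightarrow> complex^'m^'m"
  assumes "bounded_matrix_function N F" "bounded_matrix_function N G"
  shows "bounded_matrix_function N (\<lambda>x. F x ** G x)"
proof -
  obtain B C where B: "\<And>x i j. x \<in> space N \<Longrightarrow> norm (F x $ i $ j) \<le> B"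
    and C: "\<And>x i j. x \<in> space N \<Longrightarrow> norm (G x $ i $ j) \<le> C"
    using assms unfolding bounded_matrix_function_def by blast
  have [measurable]: "(\<lambda>x. F x $ i $ j) \<in> borel_measurable N" "(\<lambda>x. G x $ i $ j) \<in> borel_measurable N" for i j
    using assms unfolding bounded_matrix_function_def by auto
  have "norm ((F x ** G x) $ i $ j) \<le> CARD('m) * (B * C)" if "x \<in> space N" for x i j
  proof -
    have "norm ((F x ** G x) $ i $ j) \<le> (\<Sum>k\<in>(UNIV::'m set). norm (F x $ i $ k * G x $ k $ j))"
      unfolding matrix_matrix_mult_def by (simp add: norm_sum)
    also have "\<dots> \<le> (\<Sum>k\<in>(UNIV::'m set). B * C)"
      unfolding norm_mult
      by (intro sum_mono mult_mono B C that order_trans[OF norm_ge_zero B[OF that]]) auto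
    finally show ?thesis by simp
  qed
  moreover have "(\<lambda>x. (F x ** G x) $ i $ j) \<in> borel_measurable N" for i j
    unfolding matrix_matrix_mult_def by simp
  ultimately show ?thesis unfolding bounded_matrix_function_def by blast
qed

lemma bounded_matrix_function_trace:
  fixes F :: "'x \<Rightarrow> complex^'m^'m"
  assumes "bounded_matrix_function N F"
  shows "bounded_matrix_function N (\<lambda>x. mat (trace (F x)) :: complex^'m^'m)"
proof -
  obtain B where B: "\<And>x i j. x \<in> space N \<Longrightarrow> norm (F x $ i $ j) \<le> B"
    using assms unfolding bounded_matrix_function_def by blast
  have [measurable]: "(\<lambda>x. F x $ i $ j) \<in> borel_measurable N" for i j
    using assms unfolding bounded_matrix_function_def by auto
  have n: "norm (trace (F x)) \<le> CARD('m) * B" if "x \<in> space N" for x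
  proof -
    have "norm (trace (F x)) \<le> (\<Sum>k\<in>(UNIV::'m set). norm (F x $ k $ k))"
      unfolding trace_def by (rule norm_sum)
    also have "\<dots> \<le> (\<Sum>k\<in>(UNIV::'m set). B)" by (intro sum_mono B that)
    finally show ?thesis by simp
  qed
  then have "norm ((mat (trace (F x)) :: complex^'m^'m) $ i $ j) \<le> CARD('m) * B" if "x \<in> space N" for x i j
    using that order_trans[OF norm_ge_zero n[OF that]] by (simp add: mat_def)
  moreover have "(\<lambda>x. (mat (trace (F x)) :: complex^'m^'m) $ i $ j) \<in> borel_measurable N" for i j
    unfolding mat_def trace_def by (cases "i = j") simp_all
  ultimately show ?thesis unfolding bounded_matrix_function_def by blast
qed

lemma (in finite_measure) integrable_bounded_matrix_entry:
  assumes "bounded_matrix_function M F" shows "integrable M (\<lambda>x. F x $ i $ j)"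
proof -
  obtain B where "\<And>x i j. x \<in> space M \<Longrightarrow> norm (F x $ i $ j) \<le> B"
    using assms unfolding bounded_matrix_function_def by blast
  then show ?thesis
    using assms unfolding bounded_matrix_function_def
    by (intro integrable_const_bound[of _ B]) auto
qed

lemma matrix_integral_cong:
  "(\<And>x. x \<in> space N \<Longrightarrow> F x = G x) \<Longrightarrow> matrix_integral N F = matrix_integral N G"
  unfolding matrix_integral_def by (auto simp: vec_eq_iff intro!: Bochner_Integration.integral_cong)

lemma mat_mult_nth: "(mat k ** A) $ i $ j = k * (A $ i $ j :: complex)"
  by (simp add: matrix_matrix_mult_def mat_def if_distrib[of "\<lambda>x. x * _"] cong: if_cong)

lemma mult_mat_nth: "(A ** mat k) $ i $ j = k * (A $ i $ j :: complex)"
  by (simp add: matrix_matrix_mult_def mat_def if_distrib[of "\<lambda>x. _ * x"] mult.commute cong: if_cong)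

lemma mat_mult_commute: "A ** mat k = mat k ** (A :: complex^'m^'m)"
  by (simp add: vec_eq_iff mat_mult_nth mult_mat_nth)

lemma mat_mult_left_commute: "A ** (mat k ** B) = mat k ** ((A :: complex^'m^'m) ** (B :: complex^'m^'m))"
  by (simp only: matrix_mul_assoc mat_mult_commute[of A k])

lemma mat_mult_mat: "mat a ** mat b = (mat (a * b) :: complex^'m^'m)"
  by (simp add: vec_eq_iff mat_mult_nth) (simp add: mat_def)

lemma (in finite_measure) matrix_integral_sandwich:
  fixes F :: "'a \<Rightarrow> complex^'m^'m"
  assumes F: "bounded_matrix_function M F"
  shows "matrix_integral M (\<lambda>x. A ** F x ** B) = A ** matrix_integral M F ** B"
proof -
  note int = integrable_bounded_matrix_entry[OF F]
  have "(LINT x|M. (A ** F x ** B) $ i $ j) = (A ** matrix_integral M F ** B) $ i $ j" for i j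
    unfolding matrix_matrix_mult_def matrix_integral_def
    by (simp add: int Bochner_Integration.integral_sum)
  then show ?thesis by (simp add: matrix_integral_def vec_eq_iff)
qed

lemma (in finite_measure) matrix_integral_scale:
  fixes F :: "'a \<Rightarrow> complex^'m^'m"
  assumes F: "bounded_matrix_function M F"
  shows "matrix_integral M (\<lambda>x. mat k ** F x) = mat k ** matrix_integral M F"
  using matrix_integral_sandwich[OF F, of "mat k" "mat 1"] by simp

section \<open>Random matrices with prescribed second moments\<close>

text \<open>The second moment identities that drive the reduction steps, detached from groups. The matrix
\<open>X False g\<close> plays the role of the inverse of \<open>X True g\<close>. For \<open>\<epsilon> = 0\<close> the squares average to zero and \<open>star\<close> carries no information, hence the
condition in \<open>star_X\<close>.\<close>

locale matrix_system = prob_space M for M :: "'g measure" +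
  fixes X :: "bool \<Rightarrow> 'g \<Rightarrow> complex^'m^'m"
    and c \<epsilon> :: complex
    and star :: "complex^'m^'m \<Rightarrow> complex^'m^'m"
  assumes bounded: "bounded_matrix_function M (X s)"
    and pair_moment: "(LINT g|M. X s g $ i $ j * X (\<not> s) g $ k $ l) = (if i = l \<and> j = k then c else 0)"
    and square_moment: "matrix_integral M (\<lambda>g. X s g ** A ** X s g) = mat (\<epsilon> * c) ** star A"
    and star_mult: "star (A ** B) = star B ** star A"
    and star_one: "star (mat 1) = mat 1"
    and star_X: "\<epsilon> \<noteq> 0 \<Longrightarrow> g \<in> space M \<Longrightarrow> star (X s g) = X (\<not> s) g"
begin

definition word_matrix :: "group_word \<Rightarrow> (nat \<Rightarrow> 'g) \<Rightarrow> complex^'m^'m" where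
  "word_matrix w t = foldr (\<lambda>(x, s) A. X s (t x) ** A) w (mat 1)"

abbreviation samples :: "nat set \<Rightarrow> (nat \<Rightarrow> 'g) measure" where
  "samples I \<equiv> Pi\<^sub>M I (\<lambda>_. M)"

lemma word_matrix_simps [simp]:
  "word_matrix [] t = mat 1" "word_matrix ((x, s) # w) t = X s (t x) ** word_matrix w t"
  by (simp_all add: word_matrix_def)

lemma word_matrix_append: "word_matrix (u @ v) t = word_matrix u t ** word_matrix v t"
  by (induction u) (auto simp: matrix_mul_assoc[symmetric])

lemma word_matrix_update: "x \<notin> word_letters w \<Longrightarrow> word_matrix w (t(x := g)) = word_matrix w t"
  by (induction w) auto

lemma star_word_matrix:
  assumes "\<epsilon> \<noteq> 0" "\<And>x. x \<in> word_letters u \<Longrightarrow> t x \<in> space M"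
  shows "star (word_matrix u t) = word_matrix (inverse_word u) t"
  using assms(2)
proof (induction u)
  case (Cons l u)
  have "inverse_word (l # u) = inverse_word u @ [(fst l, \<not> snd l)]"
    by (simp add: inverse_word_def split_def)
  then show ?case
    using Cons by (cases l) (simp add: star_mult star_X[OF assms(1)] word_matrix_append)
qed (simp add: star_one inverse_word_def)

lemma integrable_pair: "integrable M (\<lambda>g. X s g $ i $ j * X (\<not> s) g $ k $ l)"
proof -
  obtain B where B: "\<And>s x i j. x \<in> space M \<Longrightarrow> norm (X s x $ i $ j) \<le> B s"
    using bounded unfolding bounded_matrix_function_def by metis
  have "(\<lambda>g. X s g $ i $ j * X (\<not> s) g $ k $ l) \<in> borel_measurable M"
    using bounded unfolding bounded_matrix_function_def by (intro borel_measurable_times) auto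
  moreover have "norm (X s g $ i $ j * X (\<not> s) g $ k $ l) \<le> B s * B (\<not> s)" if "g \<in> space M" for g
    unfolding norm_mult using B[OF that] order_trans[OF norm_ge_zero B[OF that]] by (intro mult_mono) auto
  ultimately show ?thesis by (intro integrable_const_bound[of _ "B s * B (\<not> s)"]) auto
qed

lemma sandwich_moment: "matrix_integral M (\<lambda>g. X s g ** C ** X (\<not> s) g) = mat (c * trace C)"
proof -
  have "(LINT g|M. (X s g ** C ** X (\<not> s) g) $ k $ l) = (mat (c * trace C) :: complex^'m^'m) $ k $ l" for k l
  proof -
    have "(X s g ** C ** X (\<not> s) g) $ k $ l = (\<Sum>b\<in>UNIV. \<Sum>a\<in>UNIV. C $ a $ b * (X s g $ k $ a * X (\<not> s) g $ b $ l))" for g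
      by (simp add: matrix_matrix_mult_def sum_distrib_right sum_distrib_left mult_ac)
    then have "(LINT g|M. (X s g ** C ** X (\<not> s) g) $ k $ l)
        = (\<Sum>b\<in>UNIV. \<Sum>a\<in>UNIV. C $ a $ b * (LINT g|M. X s g $ k $ a * X (\<not> s) g $ b $ l))"
      by (simp add: integrable_pair Bochner_Integration.integral_sum)
    also have "\<dots> = (\<Sum>b\<in>UNIV. \<Sum>a\<in>UNIV. if a = b then (if k = l then C $ a $ b * c else 0) else 0)"
      unfolding pair_moment by (intro sum.cong) auto
    also have "\<dots> = (mat (c * trace C) :: complex^'m^'m) $ k $ l"
      by (simp add: mat_def trace_def sum_distrib_left mult.commute)
    finally show ?thesis .
  qed
  then show ?thesis by (simp add: matrix_integral_def vec_eq_iff)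
qed

lemma trace_moment: "matrix_integral M (\<lambda>g. mat (trace (X s g ** U)) ** X (\<not> s) g) = mat c ** U"
proof -
  have "(LINT g|M. (mat (trace (X s g ** U)) ** X (\<not> s) g) $ k $ l) = (mat c ** U) $ k $ l" for k l
  proof -
    have "(mat (trace (X s g ** U)) ** X (\<not> s) g) $ k $ l = (\<Sum>i\<in>UNIV. \<Sum>j\<in>UNIV. U $ j $ i * (X s g $ i $ j * X (\<not> s) g $ k $ l))" for g
      unfolding mat_mult_nth by (simp add: trace_def matrix_matrix_mult_def sum_distrib_left sum_distrib_right mult_ac)
    then have "(LINT g|M. (mat (trace (X s g ** U)) ** X (\<not> s) g) $ k $ l)
        = (\<Sum>i\<in>UNIV. \<Sum>j\<in>UNIV. U $ j $ i * (LINT g|M. X s g $ i $ j * X (\<not> s) g $ k $ l))"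
      by (simp add: integrable_pair Bochner_Integration.integral_sum)
    also have "\<dots> = (\<Sum>i\<in>UNIV. \<Sum>j\<in>UNIV. if i = l then (if j = k then U $ j $ i * c else 0) else 0)"
      unfolding pair_moment by (intro sum.cong) auto
    also have "\<dots> = (\<Sum>j\<in>UNIV. \<Sum>i\<in>UNIV. if i = l then (if j = k then U $ j $ i * c else 0) else 0)"
      by (rule sum.swap)
    also have "\<dots> = (mat c ** U) $ k $ l"
      by (simp only: sum.delta finite UNIV_I if_True mat_mult_nth mult.commute)
    finally show ?thesis .
  qed
  then show ?thesis by (simp add: matrix_integral_def vec_eq_iff)
qed

lemma bounded_word_matrix:
  "word_letters w \<subseteq> I \<Longrightarrow> bounded_matrix_function (samples I) (word_matrix w)"
proof (induction w)
  case Nil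
  then show ?case by (simp add: word_matrix_def bounded_matrix_function_const)
next
  case (Cons l w)
  obtain x s where l: "l = (x, s)" by fastforce
  have x: "x \<in> I" using Cons l by simp
  have "bounded_matrix_function (samples I) (\<lambda>t. X s (t x))"
    unfolding bounded_matrix_function_def
  proof (intro conjI allI)
    fix i j
    have "(\<lambda>t. t x) \<in> measurable (samples I) M" using x by (rule measurable_component_singleton)
    moreover have "(\<lambda>g. X s g $ i $ j) \<in> borel_measurable M"
      using bounded unfolding bounded_matrix_function_def by blast
    ultimately show "(\<lambda>t. X s (t x) $ i $ j) \<in> borel_measurable (samples I)"
      by (rule measurable_compose)
  next
    obtain B where "\<And>g i j. g \<in> space M \<Longrightarrow> norm (X s g $ i $ j) \<le> B"
      using bounded[of s] unfolding bounded_matrix_function_def by blast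
    then show "\<exists>B. \<forall>t\<in>space (samples I). \<forall>i j. norm (X s (t x) $ i $ j) \<le> B"
      using x by (intro exI[of _ B]) (auto simp: space_PiM PiE_iff)
  qed
  from bounded_matrix_function_mult[OF this Cons.IH] show ?case
    using Cons.prems by (simp add: l)
qed

lemma matrix_integral_insert:
  fixes F :: "(nat \<Rightarrow> 'g) \<Rightarrow> complex^'m^'m"
  assumes "finite I" "x \<notin> I" "bounded_matrix_function (samples (insert x I)) F"
  shows "matrix_integral (samples (insert x I)) F =
     matrix_integral (samples I) (\<lambda>t. matrix_integral M (\<lambda>g. F (t(x := g))))"
proof -
  interpret P: prob_space "samples (insert x I)" by (rule prob_space_PiM) (rule prob_space_axioms)
  interpret product_prob_space "\<lambda>_. M" "insert x I" by unfold_locales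
  show ?thesis
    unfolding matrix_integral_def vec_eq_iff
    by (simp add: product_integral_insert[OF assms(1,2)] P.integrable_bounded_matrix_entry[OF assms(3)])
qed

text \<open>By Fubini the letters of one reduction step are integrated first; the second moments turn the
integrand into that of the reduced word.\<close>

theorem matrix_integral_word_matrix:
  assumes "word_reduction w E N v" "finite I" "word_letters w \<subseteq> I"
  shows "matrix_integral (samples I) (word_matrix w) = mat (\<epsilon> ^ N * c ^ E * of_nat CARD('m) ^ v)"
  using assms
proof (induction arbitrary: I)
  case empty
  interpret P: prob_space "samples I" by (rule prob_space_PiM) (rule prob_space_axioms)
  show ?case by (simp add: matrix_integral_def vec_eq_iff mat_def P.prob_space)
next
  case (crosscap a u b E N v x s)
  define J where "J = I - {x}"
  have J: "finite J" "x \<notin> J" "I = insert x J" using crosscap.prems by (auto simp: J_def)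
  have sub: "word_letters (a @ inverse_word u @ b) \<subseteq> J" using crosscap.prems crosscap.hyps(2) by (auto simp: J_def)
  interpret P: prob_space "samples J" by (rule prob_space_PiM) (rule prob_space_axioms)
  have inner: "matrix_integral M (\<lambda>g. word_matrix (a @ (x, s) # u @ (x, s) # b) (t(x := g)))
      = mat (\<epsilon> * c) ** word_matrix (a @ inverse_word u @ b) t" if t: "t \<in> space (samples J)" for t
  proof -
    have "word_matrix (a @ (x, s) # u @ (x, s) # b) (t(x := g))
       = word_matrix a t ** (X s g ** word_matrix u t ** X s g) ** word_matrix b t" for g
      using crosscap.hyps(2) by (simp add: word_matrix_append word_matrix_update matrix_mul_assoc)
    then have "matrix_integral M (\<lambda>g. word_matrix (a @ (x, s) # u @ (x, s) # b) (t(x := g)))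
      = word_matrix a t ** matrix_integral M (\<lambda>g. X s g ** word_matrix u t ** X s g) ** word_matrix b t"
      by (simp add: matrix_integral_sandwich bounded bounded_matrix_function_mult bounded_matrix_function_const)
    also have "\<dots> = mat (\<epsilon> * c) ** (word_matrix a t ** star (word_matrix u t) ** word_matrix b t)"
      unfolding square_moment by (simp only: mat_mult_left_commute matrix_mul_assoc[symmetric])
    also have "\<dots> = mat (\<epsilon> * c) ** word_matrix (a @ inverse_word u @ b) t"
    proof (cases "\<epsilon> = 0")
      case True
      then show ?thesis by (simp add: vec_eq_iff mat_mult_nth)
    next
      case False
      have "t y \<in> space M" if "y \<in> word_letters u" for y
        using t that sub by (auto simp: space_PiM PiE_iff)
      then show ?thesis by (simp add: star_word_matrix[OF False] word_matrix_append matrix_mul_assoc)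
    qed
    finally show ?thesis .
  qed
  have "matrix_integral (samples I) (word_matrix (a @ (x, s) # u @ (x, s) # b))
    = matrix_integral (samples J) (\<lambda>t. mat (\<epsilon> * c) ** word_matrix (a @ inverse_word u @ b) t)"
    unfolding J(3) by (subst matrix_integral_insert[OF J(1,2)])
      (use crosscap.prems J(3) in \<open>auto intro!: matrix_integral_cong inner bounded_word_matrix simp del: word_matrix_simps\<close>)
  also have "\<dots> = mat (\<epsilon> * c) ** mat (\<epsilon> ^ N * c ^ E * of_nat CARD('m) ^ v)"
    using crosscap.IH[OF J(1) sub] by (simp add: P.matrix_integral_scale[OF bounded_word_matrix[OF sub]])
  finally show ?case by (simp add: mat_mult_mat mult_ac)
next
  case (cancel a b E N v x s)
  define J where "J = I - {x}"
  have J: "finite J" "x \<notin> J" "I = insert x J" using cancel.prems by (auto simp: J_def)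
  have sub: "word_letters (a @ b) \<subseteq> J" using cancel.prems cancel.hyps(2) by (auto simp: J_def)
  interpret P: prob_space "samples J" by (rule prob_space_PiM) (rule prob_space_axioms)
  have inner: "matrix_integral M (\<lambda>g. word_matrix (a @ (x, s) # (x, \<not> s) # b) (t(x := g)))
      = mat (c * of_nat CARD('m)) ** word_matrix (a @ b) t" for t
  proof -
    have "word_matrix (a @ (x, s) # (x, \<not> s) # b) (t(x := g))
       = word_matrix a t ** (X s g ** mat 1 ** X (\<not> s) g) ** word_matrix b t" for g
      using cancel.hyps(2) by (simp add: word_matrix_append word_matrix_update matrix_mul_assoc)
    then have "matrix_integral M (\<lambda>g. word_matrix (a @ (x, s) # (x, \<not> s) # b) (t(x := g)))
      = word_matrix a t ** matrix_integral M (\<lambda>g. X s g ** mat 1 ** X (\<not> s) g) ** word_matrix b t"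
      by (simp only: matrix_integral_sandwich bounded bounded_matrix_function_mult bounded_matrix_function_const)
    also have "\<dots> = mat (c * trace (mat 1 :: complex^'m^'m)) ** (word_matrix a t ** word_matrix b t)"
      unfolding sandwich_moment by (simp only: mat_mult_left_commute matrix_mul_assoc[symmetric])
    finally show ?thesis by (simp add: word_matrix_append trace_I)
  qed
  have "matrix_integral (samples I) (word_matrix (a @ (x, s) # (x, \<not> s) # b))
    = matrix_integral (samples J) (\<lambda>t. mat (c * of_nat CARD('m)) ** word_matrix (a @ b) t)"
    unfolding J(3) by (subst matrix_integral_insert[OF J(1,2)])
      (use cancel.prems J(3) in \<open>auto intro!: matrix_integral_cong inner bounded_word_matrix simp del: word_matrix_simps\<close>)
  also have "\<dots> = mat (c * of_nat CARD('m)) ** mat (\<epsilon> ^ N * c ^ E * of_nat CARD('m) ^ v)"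
    using cancel.IH[OF J(1) sub] by (simp add: P.matrix_integral_scale[OF bounded_word_matrix[OF sub]])
  finally show ?case by (simp add: mat_mult_mat mult_ac)
next
  case (handle p u q E N v a b y r x s)
  define J where "J = I - {x, y}"
  have ab: "word_letters a \<union> word_letters b = insert y (word_letters (p @ q))"
    using handle_letters[OF handle.hyps(2)] .
  have sets: "x \<in> I" "y \<in> I" "word_letters (p @ u @ q) \<subseteq> I" using handle.prems ab by auto
  have J: "finite J" "y \<notin> J" "x \<notin> insert y J" "I = insert x (insert y J)" 
    using handle.prems handle.hyps(5) sets by (auto simp: J_def)
  have sub: "word_letters (p @ u @ q) \<subseteq> J" using sets handle.hyps(3,4) by (auto simp: J_def)
  have subab: "word_letters (a @ b) \<subseteq> insert y J" "word_letters u \<subseteq> insert y J" using ab sub by auto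
  have xab: "x \<notin> word_letters a" "x \<notin> word_letters b" "x \<notin> word_letters u"
    using ab handle.hyps(3,5) by auto
  interpret P: prob_space "samples J" by (rule prob_space_PiM) (rule prob_space_axioms)
  interpret P': prob_space "samples (insert y J)" by (rule prob_space_PiM) (rule prob_space_axioms)
  \<comment> \<open>integrating over \<open>x\<close> leaves a trace in which \<open>y\<close> occurs, times the rest, where its inverse occurs\<close>
  define H where "H t = mat (trace (word_matrix ((y, r) # u) t)) ** word_matrix (a @ b) t" for t
  have bH: "bounded_matrix_function (samples (insert y J)) H"
    unfolding H_def
    by (intro bounded_matrix_function_mult bounded_matrix_function_trace bounded_word_matrix) (use subab in auto)
  have inner: "matrix_integral M (\<lambda>g. word_matrix (a @ (x, s) # (y, r) # u @ (x, \<not> s) # b) (t(x := g)))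
      = mat c ** H t" for t
  proof -
    have "word_matrix (a @ (x, s) # (y, r) # u @ (x, \<not> s) # b) (t(x := g))
       = word_matrix a t ** (X s g ** word_matrix ((y, r) # u) t ** X (\<not> s) g) ** word_matrix b t" for g
      using handle.hyps(5) xab by (simp add: word_matrix_append word_matrix_update matrix_mul_assoc)
    then have "matrix_integral M (\<lambda>g. word_matrix (a @ (x, s) # (y, r) # u @ (x, \<not> s) # b) (t(x := g)))
      = word_matrix a t ** matrix_integral M (\<lambda>g. X s g ** word_matrix ((y, r) # u) t ** X (\<not> s) g) ** word_matrix b t"
      by (simp only: matrix_integral_sandwich bounded bounded_matrix_function_mult bounded_matrix_function_const)
    also have "\<dots> = mat (c * trace (word_matrix ((y, r) # u) t)) ** (word_matrix a t ** word_matrix b t)"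
      unfolding sandwich_moment by (simp only: mat_mult_left_commute matrix_mul_assoc[symmetric])
    finally show ?thesis by (simp add: word_matrix_append H_def mat_mult_mat[symmetric] matrix_mul_assoc)
  qed
  have inner': "matrix_integral M (\<lambda>g. H (t(y := g))) = mat c ** word_matrix (p @ u @ q) t" for t
  proof -
    have "H (t(y := g)) = word_matrix p t ** (mat (trace (X r g ** word_matrix u t)) ** X (\<not> r) g) ** word_matrix q t" for g
    proof -
      have "word_matrix (a @ b) (t(y := g)) = word_matrix p t ** (X (\<not> r) g ** word_matrix q t)"
        unfolding handle.hyps(2) using handle.hyps(4) by (simp add: word_matrix_append word_matrix_update)
      then show ?thesis
        using handle.hyps(4) by (simp add: H_def word_matrix_update mat_mult_left_commute matrix_mul_assoc[symmetric])
    qed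
    then have "matrix_integral M (\<lambda>g. H (t(y := g)))
      = word_matrix p t ** matrix_integral M (\<lambda>g. mat (trace (X r g ** word_matrix u t)) ** X (\<not> r) g) ** word_matrix q t"
      by (simp only: matrix_integral_sandwich bounded bounded_matrix_function_mult bounded_matrix_function_trace bounded_matrix_function_const)
    also have "\<dots> = mat c ** (word_matrix p t ** (word_matrix u t ** word_matrix q t))"
      unfolding trace_moment by (simp only: mat_mult_left_commute matrix_mul_assoc[symmetric])
    finally show ?thesis by (simp add: word_matrix_append)
  qed
  have "matrix_integral (samples I) (word_matrix (a @ (x, s) # (y, r) # u @ (x, \<not> s) # b))
    = matrix_integral (samples (insert y J)) (\<lambda>t. mat c ** H t)"
    unfolding J(4) by (subst matrix_integral_insert)
      (use handle.prems J in \<open>auto intro!: matrix_integral_cong inner bounded_word_matrix simp del: word_matrix_simps\<close>)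
  also have "\<dots> = mat c ** matrix_integral (samples (insert y J)) H"
    by (rule P'.matrix_integral_scale[OF bH])
  also have "matrix_integral (samples (insert y J)) H = matrix_integral (samples J) (\<lambda>t. mat c ** word_matrix (p @ u @ q) t)"
    unfolding matrix_integral_insert[OF J(1,2) bH] inner' ..
  also have "\<dots> = mat c ** mat (\<epsilon> ^ N * c ^ E * of_nat CARD('m) ^ v)"
    using handle.IH[OF J(1) sub] by (simp add: P.matrix_integral_scale[OF bounded_word_matrix[OF sub]])
  finally show ?case by (simp add: mat_mult_mat mult_ac)
qed

end

section \<open>Counting vertices with random signs\<close>

definition sign_of :: "(bool \<times> bool \<Rightarrow> bool) \<Rightarrow> bool \<times> bool \<Rightarrow> complex" where
  "sign_of \<sigma> p = (if \<sigma> p then 1 else - 1)"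

definition sign_matrix :: "bool \<Rightarrow> (bool \<times> bool \<Rightarrow> bool) \<Rightarrow> complex^bool^bool" where
  "sign_matrix s \<sigma> = (\<chi> i j. sign_of \<sigma> (if s then (i, j) else (j, i)))"

abbreviation sign_measure :: "(bool \<times> bool \<Rightarrow> bool) measure" where
  "sign_measure \<equiv> measure_pmf (pmf_of_set UNIV)"

lemma sign_measure_integral:
  "(LINT \<sigma>|sign_measure. f \<sigma>) = (\<Sum>\<sigma>\<in>UNIV. f \<sigma>) / of_nat CARD(bool \<times> bool \<Rightarrow> bool)" for f :: "_ \<Rightarrow> complex"
  by (subst integral_measure_pmf[of UNIV])
    (auto simp: pmf_of_set sum_divide_distrib scaleR_conv_of_real intro!: sum.cong)

text \<open>For two different positions, flipping the sign at one of them is a bijection that negates the product.\<close>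

lemma sign_correlation:
  "(LINT \<sigma>|sign_measure. sign_of \<sigma> p * sign_of \<sigma> q) = (if p = q then 1 else 0)"
proof (cases "p = q")
  case True
  have "(\<lambda>\<sigma>. sign_of \<sigma> q * sign_of \<sigma> q) = (\<lambda>_. 1)" by (auto simp: sign_of_def)
  then show ?thesis using True measure_pmf.prob_space by simp
next
  case False
  let ?f = "\<lambda>\<sigma>. sign_of \<sigma> p * sign_of \<sigma> q"
  have "(\<Sum>\<sigma>\<in>UNIV. ?f \<sigma>) = (\<Sum>\<sigma>\<in>UNIV. - ?f \<sigma>)"
    by (rule sum.reindex_bij_witness[of _ "\<lambda>\<sigma>. \<sigma>(p := \<not> \<sigma> p)" "\<lambda>\<sigma>. \<sigma>(p := \<not> \<sigma> p)"])
      (use False in \<open>auto simp: sign_of_def\<close>)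
  then have "(\<Sum>\<sigma>\<in>UNIV. ?f \<sigma>) = 0" by (simp add: sum_negf)
  then show ?thesis using False by (simp add: sign_measure_integral)
qed

lemma bounded_sign_matrix: "bounded_matrix_function sign_measure (sign_matrix s)"
  unfolding bounded_matrix_function_def sign_matrix_def sign_of_def
  by (intro conjI allI exI[of _ 1]) auto

text \<open>Two entries are correlated only if they carry the same sign variable, so the moment identities hold with \<open>c = \<epsilon> = 1\<close>.
In dimension \<open>2\<close> the evaluation \<open>2 ^ v\<close> determines \<open>v\<close>, which a one-dimensional system would not.\<close>

interpretation signs: matrix_system sign_measure sign_matrix 1 1 transpose
proof (unfold_locales)
  fix s show "bounded_matrix_function sign_measure (sign_matrix s)" by (rule bounded_sign_matrix)
  fix i j k l
  show "(LINT g|sign_measure. sign_matrix s g $ i $ j * sign_matrix (\<not> s) g $ k $ l) = (if i = l \<and> j = k then 1 else 0)"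
    unfolding sign_matrix_def by (cases s) (auto simp: sign_correlation)
next
  fix s and A :: "complex^bool^bool"
  have "(LINT g|sign_measure. (sign_matrix s g ** A ** sign_matrix s g) $ k $ l) = A $ l $ k" for k l
  proof -
    have "(sign_matrix s g ** A ** sign_matrix s g) $ k $ l
       = (\<Sum>b\<in>UNIV. \<Sum>a\<in>UNIV. A $ a $ b * (sign_matrix s g $ k $ a * sign_matrix s g $ b $ l))" for g
      by (simp add: matrix_matrix_mult_def sum_distrib_right sum_distrib_left mult_ac)
    then have "(LINT g|sign_measure. (sign_matrix s g ** A ** sign_matrix s g) $ k $ l)
       = (\<Sum>b\<in>UNIV. \<Sum>a\<in>UNIV. A $ a $ b * (LINT g|sign_measure. sign_matrix s g $ k $ a * sign_matrix s g $ b $ l))"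
      by (simp add: integrable_measure_pmf_finite Bochner_Integration.integral_sum)
    also have "\<dots> = (\<Sum>b\<in>UNIV. \<Sum>a\<in>UNIV. if b = k then (if a = l then A $ a $ b else 0) else 0)"
      unfolding sign_matrix_def by (intro sum.cong) (cases s; auto simp: sign_correlation)+
    also have "\<dots> = A $ l $ k" by (subst sum.swap) simp
    finally show ?thesis .
  qed
  then show "matrix_integral sign_measure (\<lambda>g. sign_matrix s g ** A ** sign_matrix s g) = mat (1 * 1) ** transpose A"
    by (simp add: matrix_integral_def vec_eq_iff transpose_def)
next
  fix s g show "transpose (sign_matrix s g) = sign_matrix (\<not> s) g"
    by (simp add: transpose_def sign_matrix_def vec_eq_iff)
qed (auto simp: matrix_transpose_mul transpose_mat)

fun matrix_product :: "(nat \<Rightarrow> complex^'m^'m) \<Rightarrow> nat \<Rightarrow> complex^'m^'m" where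
  "matrix_product A 0 = mat 1"
| "matrix_product A (Suc n) = matrix_product A n ** A n"

text \<open>Expansion of a matrix product over the paths of intermediate indices that start at \<open>p\<close>.\<close>

lemma matrix_product_entry:
  fixes A :: "nat \<Rightarrow> complex^'m^'m"
  shows "matrix_product A (Suc n) $ p $ q =
    (\<Sum>f\<in>{..<Suc n} \<rightarrow>\<^sub>E UNIV. if f 0 = p then (\<Prod>j<n. A j $ f j $ f (Suc j)) * A n $ f n $ q else 0)"
proof (induction n arbitrary: q)
  case 0
  have "(\<Sum>f\<in>{..<Suc 0} \<rightarrow>\<^sub>E UNIV. if f 0 = p then A 0 $ f 0 $ q else 0)
      = (\<Sum>r\<in>UNIV. if r = p then A 0 $ r $ q else 0)"
    by (rule sum.reindex_bij_witness[of _ "\<lambda>r. \<lambda>x\<in>{..<Suc 0}. r" "\<lambda>f. f 0"])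
      (auto simp: PiE_def extensional_def fun_eq_iff)
  then show ?case by (simp cong: if_cong)
next
  case (Suc n)
  let ?P = "{..<Suc n} \<rightarrow>\<^sub>E (UNIV :: 'm set)"
  let ?F = "\<lambda>f. (\<Prod>j<Suc n. A j $ f j $ f (Suc j)) * A (Suc n) $ f (Suc n) $ q"
  have "matrix_product A (Suc (Suc n)) $ p $ q = (\<Sum>r\<in>UNIV. matrix_product A (Suc n) $ p $ r * A (Suc n) $ r $ q)"
    by (simp add: matrix_matrix_mult_def)
  also have "\<dots> = (\<Sum>(r, f)\<in>UNIV \<times> ?P. if f 0 = p then ((\<Prod>j<n. A j $ f j $ f (Suc j)) * A n $ f n $ r) * A (Suc n) $ r $ q else 0)"
    unfolding Suc.IH by (simp add: sum.cartesian_product[symmetric] sum_distrib_right if_distrib[of "\<lambda>x. x * _"] cong: if_cong)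
  also have "\<dots> = (\<Sum>f\<in>{..<Suc (Suc n)} \<rightarrow>\<^sub>E UNIV. if f 0 = p then ?F f else 0)"
  proof (rule sum.reindex_bij_witness[of _ "\<lambda>f. (f (Suc n), restrict f {..<Suc n})" "\<lambda>(r, f). f(Suc n := r)"], goal_cases)
    case (1 a)
    then show ?case by (auto simp: PiE_def extensional_def fun_eq_iff restrict_def less_Suc_eq)
  next
    case (2 a)
    then show ?case by (auto simp: PiE_def extensional_def)
  next
    case (3 b)
    then show ?case by (auto simp: PiE_def extensional_def fun_eq_iff restrict_def less_Suc_eq)
  next
    case (4 b)
    then show ?case by auto
  next
    case (5 a)
    obtain r f where a: "a = (r, f)" by fastforce
    have "(\<Prod>j<n. A j $ (f(Suc n := r)) j $ (f(Suc n := r)) (Suc j)) = (\<Prod>j<n. A j $ f j $ f (Suc j))"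
      by (rule prod.cong) auto
    then show ?case by (simp add: a)
  qed
  finally show ?case .
qed

lemma trace_matrix_product:
  fixes A :: "nat \<Rightarrow> complex^'m^'m"
  assumes "0 < n"
  shows "trace (matrix_product A n) = (\<Sum>f\<in>{..<n} \<rightarrow>\<^sub>E UNIV. \<Prod>j<n. A j $ f j $ f (Suc j mod n))"
proof -
  obtain k where n: "n = Suc k" using assms by (cases n) auto
  have "trace (matrix_product A n) = (\<Sum>f\<in>{..<n} \<rightarrow>\<^sub>E UNIV. \<Sum>p\<in>UNIV. if f 0 = p then (\<Prod>j<k. A j $ f j $ f (Suc j)) * A k $ f k $ p else 0)"
    unfolding trace_def n matrix_product_entry by (rule sum.swap)
  also have "\<dots> = (\<Sum>f\<in>{..<n} \<rightarrow>\<^sub>E UNIV. \<Prod>j<n. A j $ f j $ f (Suc j mod n))"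
  proof (rule sum.cong)
    fix f :: "nat \<Rightarrow> 'm"
    have "(\<Prod>j<k. A j $ f j $ f (Suc j)) = (\<Prod>j<k. A j $ f j $ f (Suc j mod n))"
      by (rule prod.cong) (auto simp: n)
    then show "(\<Sum>p\<in>UNIV. if f 0 = p then (\<Prod>j<k. A j $ f j $ f (Suc j)) * A k $ f k $ p else 0) = (\<Prod>j<n. A j $ f j $ f (Suc j mod n))"
      by (simp add: n)
  qed simp
  finally show ?thesis .
qed

lemma (in matrix_system) word_matrix_as_product:
  "word_matrix w t = matrix_product (\<lambda>j. X (snd (w ! j)) (t (fst (w ! j)))) (length w)"
proof (induction w rule: rev_induct)
  case (snoc l w)
  have "matrix_product (\<lambda>j. X (snd ((w @ [l]) ! j)) (t (fst ((w @ [l]) ! j)))) n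
      = matrix_product (\<lambda>j. X (snd (w ! j)) (t (fst (w ! j)))) n" if "n \<le> length w" for n
    using that by (induction n) (auto simp: nth_append)
  then show ?case using snoc by (cases l) (simp add: word_matrix_append)
qed simp

text \<open>The labels at the two ends of side \<open>j\<close>, listed along the direction of its letter. With the transpose for
negative letters, the matrix entry belonging to this side is always indexed by this pair.\<close>

definition side_ends :: "group_word \<Rightarrow> (nat \<Rightarrow> 'v) \<Rightarrow> nat \<Rightarrow> 'v \<times> 'v" where
  "side_ends w f j = (if snd (w ! j) then (f j, f (Suc j mod length w)) else (f (Suc j mod length w), f j))"

definition vertex_labelings :: "group_word \<Rightarrow> (nat \<Rightarrow> bool) set" where
  "vertex_labelings w = {f \<in> {..<length w} \<rightarrow>\<^sub>E UNIV.
     \<forall>j<length w. \<forall>k<length w. fst (w ! j) = fst (w ! k) \<longrightarrow> side_ends w f j = side_ends w f k}"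

lemma each_letter_twice_positions:
  assumes "each_letter_twice w"
  obtains "{j. j < length w \<and> fst (w ! j) = x} = {}"
  | j k where "{j. j < length w \<and> fst (w ! j) = x} = {j, k}" "j \<noteq> k"
proof -
  have "count_list (map fst w) x \<in> {0, 2}" using assms unfolding each_letter_twice_def by blast
  then have "card {j. j < length w \<and> fst (w ! j) = x} \<in> {0, 2}"
    unfolding count_letters_positions .
  then have "card {j. j < length w \<and> fst (w ! j) = x} = 0 \<or> card {j. j < length w \<and> fst (w ! j) = x} = 2"
    by simp
  then show ?thesis
  proof
    assume "card {j. j < length w \<and> fst (w ! j) = x} = 0"
    then show ?thesis using that(1) by simp
  next
    assume "card {j. j < length w \<and> fst (w ! j) = x} = 2"
    then show ?thesis using that(2) unfolding card_2_iff by blast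
  qed
qed

lemma constant_on_pair: "g j = g k \<longleftrightarrow> (\<forall>a\<in>{j, k}. \<forall>b\<in>{j, k}. g a = g b)"
  by auto

lemma prod_indicator:
  "finite I \<Longrightarrow> (\<Prod>x\<in>I. if P x then 1 else 0) = (if \<forall>x\<in>I. P x then 1 else (0::complex))"
  by (induction I rule: finite_induct) auto

text \<open>The trace is a sum over labelings of the corners of the polygon, and by independence the expectation of each
summand is a product over the letters. The factor of a letter is the correlation of two signs,
which is \<open>1\<close> if its two sides carry the same labels at their ends and \<open>0\<close> otherwise.\<close>

lemma expected_sign_trace:
  assumes tw: "each_letter_twice w" and ne: "w \<noteq> []"
  shows "trace (matrix_integral (signs.samples (word_letters w)) (signs.word_matrix w)) = of_nat (card (vertex_labelings w))"
proof -
  let ?l = "length w" and ?I = "word_letters w"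
  let ?occ = "\<lambda>x. {j. j < ?l \<and> fst (w ! j) = x}"
  let ?L = "{..<?l} \<rightarrow>\<^sub>E (UNIV :: bool set)"
  interpret PS: product_prob_space "\<lambda>_. sign_measure" ?I
    by (intro product_prob_spaceI measure_pmf.prob_space_axioms)
  have "prob_space (signs.samples ?I)" by (rule prob_space_PiM) (rule measure_pmf.prob_space_axioms)
  then have fm: "finite_measure (signs.samples ?I)" by (rule prob_space.axioms(1))
  note entry = finite_measure.integrable_bounded_matrix_entry[OF fm signs.bounded_word_matrix[OF subset_refl]]
  define h where "h f x \<sigma> = (\<Prod>j\<in>?occ x. sign_of \<sigma> (side_ends w f j))" for f x \<sigma>
  have int_h: "(LINT \<sigma>|sign_measure. h f x \<sigma>)
      = (if \<forall>j\<in>?occ x. \<forall>k\<in>?occ x. side_ends w f j = side_ends w f k then 1 else 0)" for f x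
  proof (rule each_letter_twice_positions[OF tw, of x])
    assume e: "?occ x = {}"
    show ?thesis unfolding h_def e by simp
  next
    fix j k assume e: "?occ x = {j, k}" "j \<noteq> k"
    have "(\<Prod>i\<in>{j, k}. sign_of \<sigma> (side_ends w f i)) = sign_of \<sigma> (side_ends w f j) * sign_of \<sigma> (side_ends w f k)" for \<sigma>
      using e(2) by simp
    moreover have "side_ends w f j = side_ends w f k \<longleftrightarrow> (\<forall>a\<in>{j, k}. \<forall>b\<in>{j, k}. side_ends w f a = side_ends w f b)"
      by (rule constant_on_pair)
    ultimately show ?thesis unfolding h_def e(1) by (simp only: sign_correlation)
  qed
  have integrable_h: "integrable sign_measure (h f x)" for f x
    by (rule integrable_measure_pmf_finite) simp
  have tr: "trace (signs.word_matrix w t) = (\<Sum>f\<in>?L. \<Prod>x\<in>?I. h f x (t x))" for t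
  proof -
    have "trace (signs.word_matrix w t) = (\<Sum>f\<in>?L. \<Prod>j<?l. sign_of (t (fst (w ! j))) (side_ends w f j))"
      unfolding signs.word_matrix_as_product
      by (subst trace_matrix_product) (use ne in \<open>auto simp: sign_matrix_def side_ends_def intro!: sum.cong prod.cong\<close>)
    also have "\<dots> = (\<Sum>f\<in>?L. \<Prod>x\<in>?I. h f x (t x))"
    proof (rule sum.cong)
      fix f :: "nat \<Rightarrow> bool"
      have "(\<lambda>j. fst (w ! j)) ` {..<?l} \<subseteq> ?I" by (auto simp: word_letters_def)
      from prod.group[OF _ _ this, of "\<lambda>j. sign_of (t (fst (w ! j))) (side_ends w f j)"]
      have "(\<Prod>j<?l. sign_of (t (fst (w ! j))) (side_ends w f j))
        = (\<Prod>x\<in>?I. \<Prod>j\<in>{j \<in> {..<?l}. fst (w ! j) = x}. sign_of (t (fst (w ! j))) (side_ends w f j))" by simp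
      also have "\<dots> = (\<Prod>x\<in>?I. h f x (t x))"
        unfolding h_def by (intro prod.cong) auto
      finally show "(\<Prod>j<?l. sign_of (t (fst (w ! j))) (side_ends w f j)) = (\<Prod>x\<in>?I. h f x (t x))" .
    qed simp
    finally show ?thesis .
  qed
  have fin: "finite ?L" by (simp add: finite_PiE)
  have "trace (matrix_integral (signs.samples ?I) (signs.word_matrix w))
     = (LINT t|signs.samples ?I. trace (signs.word_matrix w t))"
    unfolding trace_def matrix_integral_def
    by (simp add: Bochner_Integration.integral_sum entry)
  also have "\<dots> = (\<Sum>f\<in>?L. LINT t|signs.samples ?I. (\<Prod>x\<in>?I. h f x (t x)))"
    unfolding tr by (rule Bochner_Integration.integral_sum) (intro PS.product_integrable_prod integrable_h, simp)
  also have "\<dots> = (\<Sum>f\<in>?L. \<Prod>x\<in>?I. LINT \<sigma>|sign_measure. h f x \<sigma>)"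
    by (intro sum.cong PS.product_integral_prod integrable_h) simp_all
  also have "\<dots> = (\<Sum>f\<in>?L. if f \<in> vertex_labelings w then 1 else 0)"
  proof (rule sum.cong)
    fix f assume f: "f \<in> ?L"
    have "f \<in> vertex_labelings w \<longleftrightarrow> (\<forall>x\<in>?I. \<forall>j\<in>?occ x. \<forall>k\<in>?occ x. side_ends w f j = side_ends w f k)"
    proof -
      have I: "fst (w ! j) \<in> ?I" if "j < ?l" for j using that by (auto simp: word_letters_def)
      have v: "f \<in> vertex_labelings w \<longleftrightarrow>
          (\<forall>j<?l. \<forall>k<?l. fst (w ! j) = fst (w ! k) \<longrightarrow> side_ends w f j = side_ends w f k)"
        using f unfolding vertex_labelings_def by blast
      show ?thesis
        unfolding v
      proof (intro iffI ballI allI impI)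
        fix x j k
        assume H: "\<forall>j<?l. \<forall>k<?l. fst (w ! j) = fst (w ! k) \<longrightarrow> side_ends w f j = side_ends w f k"
          and "j \<in> ?occ x" "k \<in> ?occ x"
        then have "j < ?l" "k < ?l" "fst (w ! j) = fst (w ! k)" by auto
        then show "side_ends w f j = side_ends w f k" using H by blast
      next
        fix j k
        assume H: "\<forall>x\<in>?I. \<forall>j\<in>?occ x. \<forall>k\<in>?occ x. side_ends w f j = side_ends w f k"
          and jk: "j < ?l" "k < ?l" "fst (w ! j) = fst (w ! k)"
        have "j \<in> ?occ (fst (w ! j))" "k \<in> ?occ (fst (w ! j))" using jk by auto
        then show "side_ends w f j = side_ends w f k" using H I[OF jk(1)] by blast
      qed
    qed
    then show "(\<Prod>x\<in>?I. LINT \<sigma>|sign_measure. h f x \<sigma>) = (if f \<in> vertex_labelings w then 1 else 0)"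
      unfolding int_h prod_indicator[OF finite_word_letters] by (simp only:)
  qed simp
  also have "\<dots> = of_nat (card (vertex_labelings w))"
  proof -
    have "?L \<inter> vertex_labelings w = vertex_labelings w" unfolding vertex_labelings_def by auto
    then show ?thesis using fin by (simp add: sum.If_cases Collect_mem_eq)
  qed
  finally show ?thesis .
qed

definition vertex_point :: "group_word \<Rightarrow> nat \<Rightarrow> complex" where
  "vertex_point w j = cis (2 * pi * real j / real (length w))"

lemma vertex_point_mod: "0 < length w \<Longrightarrow> vertex_point w (i mod length w) = vertex_point w i"
proof -
  assume l: "0 < length w"
  have "real i = real (i mod length w) + real (length w) * real (i div length w)"
    by (metis mod_mult_div_eq of_nat_add of_nat_mult)
  then have "2 * pi * real i / real (length w) = 2 * pi * real (i mod length w) / real (length w) + 2 * pi * real (i div length w)"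
    using l by (simp add: field_simps)
  then show ?thesis unfolding vertex_point_def using cis_mult[symmetric] by (simp add: cis_multiple_2pi)
qed

lemma vertex_point_inj:
  assumes "j < length w" "cis (2 * pi * x / real (length w)) = vertex_point w j" "0 \<le> x" "x \<le> real (length w)"
  shows "x = real j \<or> (j = 0 \<and> x = real (length w))"
proof -
  let ?l = "real (length w)"
  have l: "?l > 0" using assms(1) by linarith
  have "exp (\<i> * of_real (2 * pi * x / ?l)) = exp (\<i> * of_real (2 * pi * j / ?l))"
    using assms(2) unfolding vertex_point_def cis_conv_exp .
  then obtain n :: int where "\<i> * of_real (2 * pi * x / ?l) = \<i> * of_real (2 * pi * j / ?l) + of_int (2 * n) * pi * \<i>"
    unfolding exp_eq by (auto simp: mult.assoc)
  then have "2 * pi * x / ?l = 2 * pi * j / ?l + 2 * n * pi"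
    by (auto simp: complex_eq_iff)
  then have "2 * pi * x = 2 * pi * (j + n * ?l)" using l by (simp add: field_simps)
  then have e: "x = j + n * ?l" by simp
  have jl: "real j < ?l" using assms(1) by simp
  consider "n \<le> -1" | "n = 0" | "n = 1" | "n \<ge> 2" by linarith
  then show ?thesis
  proof cases
    case 1
    then have "n * ?l \<le> - ?l" using mult_right_mono[of "real_of_int n" "-1" ?l] l by simp
    then show ?thesis using e jl assms(3) by linarith
  next
    case 3
    then show ?thesis using e assms(4) by simp
  next
    case 4
    then have "2 * ?l \<le> n * ?l" using mult_right_mono[of 2 "real_of_int n" ?l] l by simp
    then show ?thesis using e assms(4) l by linarith
  qed (use e in simp)
qed

text \<open>An identification of a vertex with another point matches two ends of sides with the same letter, and
at these ends a labeling takes the same value.\<close>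

lemma side_pairs_vertex:
  assumes "(vertex_point w i, y) \<in> side_pairs w" "i < length w" "f \<in> vertex_labelings w"
  shows "\<exists>i'<length w. y = vertex_point w i' \<and> f i' = f i"
proof -
  let ?l = "length w"
  have l: "0 < ?l" using assms(2) by linarith
  obtain j k u where jk: "j < ?l" "k < ?l" "fst (w ! j) = fst (w ! k)" "0 \<le> u" "u \<le> 1"
    "vertex_point w i = side_point w j u" "y = side_point w k u"
    using assms(1) unfolding side_pairs_def by blast
  define v where "v = (if snd (w ! j) then u else 1 - u)"
  have "real j + 1 \<le> ?l" using jk(1) by linarith
  then have "real j + v = real i \<or> (i = 0 \<and> real j + v = real ?l)"
    using jk by (intro vertex_point_inj assms(2)) (auto simp: side_point_def v_def)
  moreover have "0 \<le> v" "v \<le> 1" using jk by (auto simp: v_def)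
  ultimately have v: "v = 0 \<and> i = j \<or> v = 1 \<and> i = Suc j mod ?l"
  proof (elim disjE conjE)
    assume e: "real j + v = real i"
    then have "i = j \<or> i = Suc j" using \<open>0 \<le> v\<close> \<open>v \<le> 1\<close> by linarith
    then show ?thesis using e assms(2) by auto
  next
    assume e: "i = 0" "real j + v = real ?l"
    then have "v = 1" "Suc j = ?l" using \<open>real j + 1 \<le> ?l\<close> \<open>v \<le> 1\<close> by linarith+
    then show ?thesis using e by simp
  qed
  have se: "side_ends w f j = side_ends w f k" using assms(3) jk unfolding vertex_labelings_def by blast
  \<comment> \<open>the corner of side \<open>k\<close> at the label parameter \<open>u\<close>, which runs backwards for a negative letter\<close>
  define i' where "i' = (if (u = 0) = snd (w ! k) then k else Suc k mod ?l)"
  have u: "u = 0 \<or> u = 1" using v by (auto simp: v_def split: if_splits)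
  have "i' < ?l" using jk(2) l by (simp add: i'_def)
  moreover have "y = vertex_point w i'"
    using u l unfolding jk(7) side_point_def i'_def
    by (auto simp: vertex_point_mod) (auto simp: vertex_point_def add.commute)
  moreover have "f i' = f i"
    using u v se by (auto simp: i'_def v_def side_ends_def split: if_splits)
  ultimately show ?thesis by blast
qed

lemma vertex_labelings_constant:
  assumes "f \<in> vertex_labelings w" "i < length w" "i' < length w" "(vertex_point w i, vertex_point w i') \<in> gluing w"
  shows "f i' = f i"
proof -
  have inj: "a = b" if "a < length w" "b < length w" "vertex_point w a = vertex_point w b" for a b
    using vertex_point_inj[of b w "real a"] that by (auto simp: vertex_point_def)
  have "\<exists>b<length w. y = vertex_point w b \<and> f b = f i" if "(vertex_point w i, y) \<in> (side_pairs w)\<^sup>+" for y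
    using that
  proof (induction rule: trancl_induct)
    case (base y)
    then show ?case using side_pairs_vertex assms(1,2) by blast
  next
    case (step y z)
    then show ?case using side_pairs_vertex assms(1) by metis
  qed
  then show ?thesis using assms(2-4) inj unfolding gluing_def by blast
qed

lemma side_ends_glued:
  assumes "j < length w" "k < length w" "fst (w ! j) = fst (w ! k)"
  shows "(fst (side_ends w (vertex_point w) j), fst (side_ends w (vertex_point w) k)) \<in> gluing w"
    and "(snd (side_ends w (vertex_point w) j), snd (side_ends w (vertex_point w) k)) \<in> gluing w"
proof -
  have l: "0 < length w" using assms(1) by linarith
  have "fst (side_ends w (vertex_point w) i) = side_point w i 0" "snd (side_ends w (vertex_point w) i) = side_point w i 1" for i
    by (simp_all add: side_ends_def vertex_point_mod[OF l]) (simp_all add: side_point_def vertex_point_def add.commute)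
  moreover have "(side_point w j u, side_point w k u) \<in> gluing w" if "0 \<le> u" "u \<le> 1" for u
  proof -
    have "(side_point w j u, side_point w k u) \<in> side_pairs w"
      unfolding side_pairs_def using assms that by blast
    then show ?thesis unfolding gluing_def by blast
  qed
  ultimately show "(fst (side_ends w (vertex_point w) j), fst (side_ends w (vertex_point w) k)) \<in> gluing w"
    "(snd (side_ends w (vertex_point w) j), snd (side_ends w (vertex_point w) k)) \<in> gluing w"
    by simp_all
qed

text \<open>The labelings are the functions on the corners that are constant on the classes of the gluing,
that is, the functions on the set of 0-cells.\<close>

lemma card_vertex_labelings: "card (vertex_labelings w) = 2 ^ card (zero_cells w)"
proof -
  let ?l = "length w" and ?Z = "zero_cells w"
  let ?p = "\<lambda>i. cell_point w (vertex_point w i)"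
  have Z: "?Z = ?p ` {..<?l}" unfolding zero_cells_def vertex_point_def by simp
  have cb: "vertex_point w i \<in> cball 0 1" for i by (simp add: vertex_point_def)
  have "bij_betw (\<lambda>g. \<lambda>i\<in>{..<?l}. g (?p i)) (?Z \<rightarrow>\<^sub>E (UNIV :: bool set)) (vertex_labelings w)"
  proof (rule bij_betwI[where g = "\<lambda>f. \<lambda>z\<in>?Z. f (inv_into {..<?l} ?p z)"])
    show "(\<lambda>g. \<lambda>i\<in>{..<?l}. g (?p i)) \<in> (?Z \<rightarrow>\<^sub>E UNIV) \<rightarrow> vertex_labelings w"
    proof
      fix g :: "complex set \<Rightarrow> bool"
      show "(\<lambda>i\<in>{..<?l}. g (?p i)) \<in> vertex_labelings w"
        unfolding vertex_labelings_def
      proof (intro CollectI conjI allI impI)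
        fix j k assume jk: "j < ?l" "k < ?l" "fst (w ! j) = fst (w ! k)"
        then have l: "0 < ?l" by linarith
        have "side_ends w (\<lambda>i\<in>{..<?l}. g (?p i)) i
            = map_prod (\<lambda>z. g (cell_point w z)) (\<lambda>z. g (cell_point w z)) (side_ends w (vertex_point w) i)" if "i < ?l" for i
          using that l by (simp add: side_ends_def)
        moreover have "cell_point w (fst (side_ends w (vertex_point w) j)) = cell_point w (fst (side_ends w (vertex_point w) k))"
          "cell_point w (snd (side_ends w (vertex_point w) j)) = cell_point w (snd (side_ends w (vertex_point w) k))"
          using side_ends_glued[OF jk] cell_point_eq_iff gluing_closed by metis+
        ultimately show "side_ends w (\<lambda>i\<in>{..<?l}. g (?p i)) j = side_ends w (\<lambda>i\<in>{..<?l}. g (?p i)) k"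
          using jk by (simp add: map_prod_def split_def)
      qed simp
    qed
    show "(\<lambda>f. \<lambda>z\<in>?Z. f (inv_into {..<?l} ?p z)) \<in> vertex_labelings w \<rightarrow> (?Z \<rightarrow>\<^sub>E UNIV)" by auto
    fix g :: "complex set \<Rightarrow> bool" assume g: "g \<in> ?Z \<rightarrow>\<^sub>E UNIV"
    have i: "inv_into {..<?l} ?p z \<in> {..<?l} \<and> ?p (inv_into {..<?l} ?p z) = z" if "z \<in> ?Z" for z
      using that unfolding Z by (meson f_inv_into_f inv_into_into)
    show "(\<lambda>z\<in>?Z. (\<lambda>i\<in>{..<?l}. g (?p i)) (inv_into {..<?l} ?p z)) = g"
      using g i by (auto simp: fun_eq_iff PiE_def extensional_def restrict_def)
  next
    fix f assume f: "f \<in> vertex_labelings w"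
    have "f (inv_into {..<?l} ?p (?p i)) = f i" if i: "i < ?l" for i
    proof -
      let ?i' = "inv_into {..<?l} ?p (?p i)"
      have m: "?p i \<in> ?p ` {..<?l}" using i by blast
      have "?i' < ?l" using inv_into_into[OF m] by simp
      moreover have "(vertex_point w i, vertex_point w ?i') \<in> gluing w"
        using f_inv_into_f[OF m, symmetric] unfolding cell_point_eq_iff[OF cb] .
      ultimately show ?thesis using vertex_labelings_constant[OF f i] by blast
    qed
    moreover have "f \<in> {..<?l} \<rightarrow>\<^sub>E UNIV" using f unfolding vertex_labelings_def by blast
    moreover have "?p i \<in> ?Z" if "i < ?l" for i using that unfolding Z by blast
    ultimately show "(\<lambda>i\<in>{..<?l}. (\<lambda>z\<in>?Z. f (inv_into {..<?l} ?p z)) (?p i)) = f"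
      by (auto simp: fun_eq_iff PiE_def extensional_def restrict_def)
  qed
  then have "card (vertex_labelings w) = card (?Z \<rightarrow>\<^sub>E (UNIV :: bool set))" by (simp add: bij_betw_same_card)
  then show ?thesis unfolding zero_cells_def by (simp add: card_PiE)
qed

text \<open>The expected trace for random signs is \<open>2 ^ Suc v\<close> by reduction of the word, and \<open>2\<close> to the number of
0-cells by counting labelings.\<close>

theorem card_zero_cells:
  assumes "word_reduction w E N v" "each_letter_twice w" "w \<noteq> []"
  shows "card (zero_cells w) = Suc v"
proof -
  have "matrix_integral (signs.samples (word_letters w)) (signs.word_matrix w) = mat (2 ^ v)"
    using signs.matrix_integral_word_matrix[OF assms(1), of "word_letters w"] by simp
  then have "(of_nat (2 ^ card (zero_cells w)) :: complex) = trace (mat (2 ^ v) :: complex^bool^bool)"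
    using expected_sign_trace[OF assms(2,3)] by (simp only: card_vertex_labelings)
  also have "\<dots> = of_nat (2 ^ Suc v)" by (simp add: trace_def mat_def UNIV_bool)
  finally have "(2::nat) ^ card (zero_cells w) = 2 ^ Suc v" unfolding of_nat_eq_iff .
  then show ?thesis by (metis one_less_numeral_iff power_inject_exp semiring_norm(76))
qed

section \<open>Schur's lemma and the moments of an irreducible representation\<close>

text \<open>If \<open>det (A - z)\<close> had no root, this polynomial in \<open>z\<close> would be a constant \<open>c\<close>, and \<open>det (s A - 1)\<close> would
equal \<open>s ^ m * c\<close> for \<open>s \<noteq> 0\<close>. It would tend to \<open>0\<close> as \<open>s \<longrightarrow> 0\<close>, whereas its value at \<open>s = 0\<close> is
\<open>det (- 1) \<noteq> 0\<close>.\<close>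

lemma exists_eigenvalue:
  fixes A :: "complex^'m^'m"
  shows "\<exists>r. \<not> invertible (A - mat r)"
proof (rule ccontr)
  assume "\<not> ?thesis"
  then have nz: "det (A - mat r) \<noteq> 0" for r using invertible_det_nz by blast
  define p where "p = det (\<chi> i j. [:A $ i $ j:] - (if i = j then [:0, 1:] else 0) :: complex poly ^ 'm ^ 'm)"
  have "poly p z = det (A - mat z)" for z
    unfolding p_def det_def
    by (simp add: poly_sum poly_prod of_int_poly mat_def if_distrib[of "\<lambda>q. poly q _"] cong: if_cong)
  then have "constant (poly p)" using Fundamental_Theorem_Algebra.fundamental_theorem_of_algebra[of p] nz by metis
  then obtain c where c: "det (A - mat z) = c" for z
    using \<open>\<And>z. poly p z = det (A - mat z)\<close> unfolding constant_def by metis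
  define D where "D s = det (\<chi> i j. s * A $ i $ j - (mat 1 :: complex^'m^'m) $ i $ j)" for s
  have D: "D s = s ^ CARD('m) * c" if "s \<noteq> 0" for s
  proof -
    have "(\<chi> i j. s * A $ i $ j - (mat 1 :: complex^'m^'m) $ i $ j) = (\<chi> i. s *s ((A - mat (1 / s)) $ i))"
      using that by (simp add: vec_eq_iff mat_def right_diff_distrib)
    then have "D s = s ^ CARD('m) * det (\<chi> i. (A - mat (1 / s)) $ i)"
      unfolding D_def by (simp only: det_rows_mul) simp
    then show ?thesis unfolding vec_lambda_eta c .
  qed
  have "continuous_on UNIV D" unfolding D_def det_def by (auto intro!: continuous_intros)
  then have "D \<midarrow>0\<rightarrow> D 0" using continuous_on_def by blast
  moreover have "D \<midarrow>0\<rightarrow> 0"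
  proof (rule Lim_transform_within[where d = 1])
    show "(\<lambda>s. s ^ CARD('m) * c) \<midarrow>0\<rightarrow> 0" by (auto intro!: tendsto_eq_intros)
  qed (auto simp: D)
  ultimately have "D 0 = 0" by (rule LIM_unique)
  moreover have "D 0 = det (0 - mat 1 :: complex^'m^'m)"
    unfolding D_def by (rule arg_cong[of _ _ det]) (simp add: vec_eq_iff)
  moreover have "invertible (0 - mat 1 :: complex^'m^'m)"
  proof -
    have "0 - mat 1 = (mat (-1) :: complex^'m^'m)" by (simp add: vec_eq_iff mat_def)
    moreover have "mat (-1) ** mat (-1) = (mat 1 :: complex^'m^'m)" by (simp add: mat_mult_mat)
    ultimately show ?thesis unfolding invertible_def by metis
  qed
  ultimately show False using invertible_det_nz by metis
qed

text \<open>Turns statements about averages of \<open>A g ** C ** B g\<close> for all \<open>C\<close> into statements about products of entries.\<close>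

lemma matrix_unit_sandwich:
  fixes A B :: "complex^'m^'m"
  shows "(A ** (\<chi> a b. if a = j \<and> b = k then 1 else 0) ** B) $ i $ l = A $ i $ j * B $ k $ l"
proof -
  have "(A ** (\<chi> a b. if a = j \<and> b = k then 1 else 0)) $ i $ b = (if b = k then A $ i $ j else 0)" for b
  proof -
    have "A $ i $ a * (if a = j \<and> b = k then 1 else 0) = (if a = j then (if b = k then A $ i $ j else 0) else 0)" for a
      by auto
    then show ?thesis by (simp add: matrix_matrix_mult_def)
  qed
  then have "(A ** (\<chi> a b. if a = j \<and> b = k then 1 else 0) ** B) $ i $ l = (\<Sum>b\<in>UNIV. if b = k then A $ i $ j * B $ b $ l else 0)"
    by (subst matrix_matrix_mult_def) (simp add: if_distrib[of "\<lambda>x. x * _"] cong: if_cong)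
  then show ?thesis by simp
qed

lemma matrix_diff_distribs:
  fixes A B C :: "complex^'m^'m"
  shows "A ** (B - C) = A ** B - A ** C" "(B - C) ** A = B ** A - C ** A"
  by (simp_all add: matrix_matrix_mult_def vec_eq_iff sum_subtractf algebra_simps)

lemma invertible_mult_left_eq: "invertible C \<Longrightarrow> C ** A = C ** B \<Longrightarrow> A = (B :: complex^'m^'m)"
  unfolding invertible_def by (metis matrix_mul_assoc matrix_mul_lid)

locale irreducible_haar = compact_group G T for G (structure) and T +
  fixes \<mu> :: "'a measure" and \<rho> :: "'a \<Rightarrow> complex^'m^'m"
  assumes haar: "normalized_haar_measure G T \<mu>"
    and irreducible: "irreducible_representation G T \<rho>"
begin

sublocale haar: prob_space \<mu>
  using haar unfolding normalized_haar_measure_def by blast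

lemma space_haar: "space \<mu> = carrier G"
  using haar topspace_eq unfolding normalized_haar_measure_def by simp

lemma sets_haar: "sets \<mu> = sigma_sets (carrier G) {U. openin T U}"
  using haar topspace_eq unfolding normalized_haar_measure_def by simp

lemma rep_mult: "g \<in> carrier G \<Longrightarrow> h \<in> carrier G \<Longrightarrow> \<rho> (g \<otimes> h) = \<rho> g ** \<rho> h"
  using irreducible unfolding irreducible_representation_def representation_def hom_def general_linear_def by auto

lemma rep_invertible: "g \<in> carrier G \<Longrightarrow> invertible (\<rho> g)"
  using irreducible unfolding irreducible_representation_def representation_def hom_def general_linear_def by auto

lemma rep_one: "\<rho> \<one> = mat 1"
proof -
  have "\<rho> \<one> ** \<rho> \<one> = \<rho> \<one> ** mat 1" using rep_mult[of \<one> \<one>] by simp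
  then show ?thesis using invertible_mult_left_eq rep_invertible by blast
qed

lemma rep_inv: "g \<in> carrier G \<Longrightarrow> \<rho> g ** \<rho> (inv g) = mat 1" "g \<in> carrier G \<Longrightarrow> \<rho> (inv g) ** \<rho> g = mat 1"
  using rep_mult[of g "inv g"] rep_mult[of "inv g" g] rep_one by auto

lemma rep_continuous: "continuous_map T euclidean \<rho>"
  using irreducible unfolding irreducible_representation_def representation_def by auto

lemma invariant_subspace:
  "vec.subspace W \<Longrightarrow> (\<And>g x. g \<in> carrier G \<Longrightarrow> x \<in> W \<Longrightarrow> \<rho> g *v x \<in> W) \<Longrightarrow> W = {0} \<or> W = UNIV"
  using irreducible unfolding irreducible_representation_def by blast

lemma bounded_continuous_matrix:
  fixes F :: "'a \<Rightarrow> complex^'m^'m"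
  assumes F: "continuous_map T euclidean F"
  shows "bounded_matrix_function \<mu> F"
  unfolding bounded_matrix_function_def
proof (intro conjI allI)
  fix i j
  have c: "continuous_map T euclidean (\<lambda>g. F g $ i $ j)"
  proof -
    have "continuous_map euclidean euclidean (\<lambda>A::complex^'m^'m. A $ i $ j)"
      by (auto intro!: continuous_intros)
    from continuous_map_compose[OF F this] show ?thesis by (simp add: o_def)
  qed
  show "(\<lambda>g. F g $ i $ j) \<in> borel_measurable \<mu>"
  proof (rule borel_measurableI)
    fix S :: "complex set" assume "open S"
    then have "openin T {g \<in> topspace T. F g $ i $ j \<in> S}"
      using c unfolding continuous_map_def by (simp add: open_openin[symmetric])
    moreover have "(\<lambda>g. F g $ i $ j) -` S \<inter> space \<mu> = {g \<in> topspace T. F g $ i $ j \<in> S}"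
      by (auto simp: space_haar topspace_eq)
    ultimately show "(\<lambda>g. F g $ i $ j) -` S \<inter> space \<mu> \<in> sets \<mu>"
      unfolding sets_haar by (auto intro: sigma_sets.Basic)
  qed
next
  have "compactin euclidean (F ` topspace T)"
    using image_compactin[OF _ F] compact_topology unfolding compact_space_def by blast
  then have "bounded (F ` topspace T)" by (simp add: compact_imp_bounded)
  then obtain B where B: "\<And>g. g \<in> topspace T \<Longrightarrow> norm (F g) \<le> B" unfolding bounded_iff by blast
  have "norm (F g $ i $ j) \<le> B" if "g \<in> space \<mu>" for g i j
  proof -
    have "norm (F g $ i $ j) \<le> norm (F g $ i)" by (rule Finite_Cartesian_Product.norm_nth_le)
    also have "\<dots> \<le> norm (F g)" by (rule Finite_Cartesian_Product.norm_nth_le)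
    also have "\<dots> \<le> B" using B that by (simp add: space_haar topspace_eq)
    finally show ?thesis .
  qed
  then show "\<exists>B. \<forall>x\<in>space \<mu>. \<forall>i j. norm (F x $ i $ j) \<le> B" by blast
qed

lemma bounded_rep: "bounded_matrix_function \<mu> \<rho>"
  by (rule bounded_continuous_matrix[OF rep_continuous])

lemma bounded_rep_inv: "bounded_matrix_function \<mu> (\<lambda>g. \<rho> (inv g))"
  using bounded_continuous_matrix[OF continuous_map_compose[OF continuous_inv rep_continuous]] by (simp add: o_def)

lemma bounded_transpose:
  fixes F :: "'a \<Rightarrow> complex^'m^'m"
  assumes "bounded_matrix_function \<mu> F"
  shows "bounded_matrix_function \<mu> (\<lambda>g. transpose (F g))"
proof -
  obtain B where B: "\<forall>x\<in>space \<mu>. \<forall>i j. norm (F x $ i $ j) \<le> B"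
    using assms unfolding bounded_matrix_function_def by blast
  then have "\<exists>B. \<forall>x\<in>space \<mu>. \<forall>i j. norm (transpose (F x) $ i $ j) \<le> B"
    by (intro exI[of _ B]) (simp add: transpose_def)
  then show ?thesis using assms unfolding bounded_matrix_function_def by (simp add: transpose_def)
qed

lemma translation_measurable:
  assumes h: "h \<in> carrier G" shows "(\<lambda>g. h \<otimes> g) \<in> measurable \<mu> \<mu>"
proof -
  have "continuous_map T (prod_topology T T) (\<lambda>g. (h, g))"
    using h topspace_eq by (simp add: continuous_map_pairwise o_def)
  from continuous_map_compose[OF this continuous_mult]
  have c: "continuous_map T T (\<lambda>g. h \<otimes> g)" by (simp add: o_def)
  show ?thesis
  proof (rule measurable_sigma_sets[OF sets_haar])
    show "{U. openin T U} \<subseteq> Pow (carrier G)" using openin_subset topspace_eq by blast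
    show "(\<lambda>g. h \<otimes> g) \<in> space \<mu> \<rightarrow> carrier G" using h by (simp add: space_haar)
    fix U assume "U \<in> {U. openin T U}"
    then have "openin T {g \<in> topspace T. h \<otimes> g \<in> U}" using c unfolding continuous_map_def by blast
    moreover have "(\<lambda>g. h \<otimes> g) -` U \<inter> space \<mu> = {g \<in> topspace T. h \<otimes> g \<in> U}" by (auto simp: space_haar topspace_eq)
    ultimately show "(\<lambda>g. h \<otimes> g) -` U \<inter> space \<mu> \<in> sets \<mu>" unfolding sets_haar by (auto intro: sigma_sets.Basic)
  qed
qed

lemma distr_translation:
  assumes h: "h \<in> carrier G" shows "distr \<mu> \<mu> (\<lambda>g. h \<otimes> g) = \<mu>"
proof (rule measure_eqI)
  fix A assume "A \<in> sets (distr \<mu> \<mu> (\<lambda>g. h \<otimes> g))"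
  then have A: "A \<in> sets \<mu>" by simp
  then have sub: "A \<subseteq> carrier G" using sets.sets_into_space space_haar by blast
  have "(\<lambda>g. h \<otimes> g) -` A \<inter> space \<mu> = (\<lambda>x. inv h \<otimes> x) ` A"
  proof (intro subset_antisym subsetI)
    fix g assume "g \<in> (\<lambda>g. h \<otimes> g) -` A \<inter> space \<mu>"
    then have "h \<otimes> g \<in> A" "g \<in> carrier G" by (auto simp: space_haar)
    moreover from this have "g = inv h \<otimes> (h \<otimes> g)" using h by (simp add: m_assoc[symmetric])
    ultimately show "g \<in> (\<lambda>x. inv h \<otimes> x) ` A" by blast
  next
    fix g assume "g \<in> (\<lambda>x. inv h \<otimes> x) ` A"
    then obtain x where x: "x \<in> A" "g = inv h \<otimes> x" by blast
    then have "x \<in> carrier G" using sub by blast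
    then show "g \<in> (\<lambda>g. h \<otimes> g) -` A \<inter> space \<mu>"
      using x h by (simp add: space_haar m_assoc[symmetric])
  qed
  then show "emeasure (distr \<mu> \<mu> (\<lambda>g. h \<otimes> g)) A = emeasure \<mu> A"
    using haar h A unfolding normalized_haar_measure_def
    by (subst emeasure_distr[OF translation_measurable[OF h] A]) simp
qed simp

lemma matrix_integral_translate:
  assumes "h \<in> carrier G" "bounded_matrix_function \<mu> F"
  shows "matrix_integral \<mu> (\<lambda>g. F (h \<otimes> g)) = matrix_integral \<mu> F"
proof -
  have "(LINT g|\<mu>. F (h \<otimes> g) $ i $ j) = (LINT g|\<mu>. F g $ i $ j)" for i j
    using integral_distr[OF translation_measurable[OF assms(1)], of "\<lambda>g. F g $ i $ j"] assms(2)
    unfolding bounded_matrix_function_def distr_translation[OF assms(1)] by simp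
  then show ?thesis unfolding matrix_integral_def by simp
qed

lemma subspace_kernel: "vec.subspace {x. B *v x = (0 :: complex^'m)}"
  by (auto simp: vec.subspace_def matrix_vector_right_distrib vector_scalar_commute)

lemma subspace_range: "vec.subspace (range (\<lambda>x. (B :: complex^'m^'m) *v x))"
  unfolding vec.subspace_def
proof (intro conjI allI ballI)
  show "0 \<in> range ((*v) B)" by (rule range_eqI[of _ _ 0]) simp
next
  fix x y assume "x \<in> range ((*v) B)" "y \<in> range ((*v) B)"
  then show "x + y \<in> range ((*v) B)" by (auto simp: matrix_vector_right_distrib[symmetric])
next
  fix c x assume "x \<in> range ((*v) B)"
  then show "c *s x \<in> range ((*v) B)" by (auto simp: vector_scalar_commute[symmetric])
qed

text \<open>The eigenspace of \<open>B\<close> for any eigenvalue is invariant under the representation.\<close>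

lemma schur_scalar:
  assumes comm: "\<And>g. g \<in> carrier G \<Longrightarrow> \<rho> g ** B = B ** \<rho> g"
  shows "\<exists>r. B = mat r"
proof -
  obtain r where r: "\<not> invertible (B - mat r)" using exists_eigenvalue by blast
  let ?C = "B - mat r"
  let ?W = "{x. ?C *v x = 0}"
  have comm': "\<rho> g ** ?C = ?C ** \<rho> g" if "g \<in> carrier G" for g
    using comm[OF that] by (simp add: matrix_diff_distribs mat_mult_commute)
  have "?W = {0} \<or> ?W = UNIV"
  proof (rule invariant_subspace[OF subspace_kernel])
    fix g x assume "g \<in> carrier G" "x \<in> ?W"
    then have "(?C ** \<rho> g) *v x = 0" by (simp add: comm'[symmetric] matrix_vector_mul_assoc[symmetric])
    then show "\<rho> g *v x \<in> ?W" by (simp add: matrix_vector_mul_assoc)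
  qed
  moreover have "?W \<noteq> {0}"
    using r unfolding invertible_left_inverse matrix_left_invertible_ker by auto
  ultimately have "?C *v x = 0" for x by blast
  then have "?C = 0" by (simp add: matrix_eq)
  then show ?thesis by auto
qed

text \<open>The average commutes with the representation by left invariance, so it is a scalar matrix, and
conjugation does not change the trace.\<close>

lemma average_conjugation: "matrix_integral \<mu> (\<lambda>g. \<rho> g ** A ** \<rho> (inv g)) = mat (trace A / of_nat CARD('m))"
proof -
  let ?F = "\<lambda>g. \<rho> g ** A ** \<rho> (inv g)"
  let ?P = "matrix_integral \<mu> ?F"
  have bF: "bounded_matrix_function \<mu> ?F"
    by (intro bounded_matrix_function_mult bounded_rep bounded_rep_inv bounded_matrix_function_const)
  have "\<rho> h ** ?P = ?P ** \<rho> h" if h: "h \<in> carrier G" for h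
  proof -
    have "\<rho> h ** ?P ** \<rho> (inv h) = matrix_integral \<mu> (\<lambda>g. \<rho> h ** ?F g ** \<rho> (inv h))"
      by (rule haar.matrix_integral_sandwich[OF bF, symmetric])
    also have "\<dots> = matrix_integral \<mu> (\<lambda>g. ?F (h \<otimes> g))"
      by (rule matrix_integral_cong) (use h in \<open>simp add: space_haar rep_mult inv_mult_group matrix_mul_assoc\<close>)
    also have "\<dots> = ?P" by (rule matrix_integral_translate[OF h bF])
    finally have "\<rho> h ** ?P ** (\<rho> (inv h) ** \<rho> h) = ?P ** \<rho> h" by (simp add: matrix_mul_assoc)
    then show ?thesis using rep_inv[OF h] by simp
  qed
  then obtain r where r: "?P = mat r" using schur_scalar by blast
  have "trace ?P = (LINT g|\<mu>. trace (?F g))"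
    unfolding trace_def matrix_integral_def
    by (simp add: Bochner_Integration.integral_sum haar.integrable_bounded_matrix_entry[OF bF])
  also have "\<dots> = (LINT g|\<mu>. trace A)"
  proof (rule Bochner_Integration.integral_cong[OF refl])
    fix g assume "g \<in> space \<mu>"
    then have "\<rho> (inv g) ** (\<rho> g ** A) = A" using rep_inv(2)[of g] by (simp add: space_haar matrix_mul_assoc)
    then show "trace (?F g) = trace A" using trace_mul_sym[of "\<rho> g ** A" "\<rho> (inv g)"] by simp
  qed
  also have "\<dots> = trace A" by (simp add: haar.prob_space)
  finally have "of_nat CARD('m) * r = trace A" unfolding r by (simp add: trace_def mat_def)
  then have "r = trace A / of_nat CARD('m)" by (auto simp: field_simps)
  then show ?thesis using r by simp
qed

definition rep_letter :: "bool \<Rightarrow> 'a \<Rightarrow> complex^'m^'m" where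
  "rep_letter s g = \<rho> (if s then g else inv g)"

lemma bounded_rep_letter: "bounded_matrix_function \<mu> (rep_letter s)"
  using bounded_rep bounded_rep_inv by (cases s) (simp_all add: rep_letter_def[abs_def])

lemma rep_pair_moment:
  "(LINT g|\<mu>. rep_letter s g $ i $ j * rep_letter (\<not> s) g $ k $ l) = (if i = l \<and> j = k then 1 / of_nat CARD('m) else 0)"
proof -
  have main: "(LINT g|\<mu>. \<rho> g $ i $ j * \<rho> (inv g) $ k $ l) = (if i = l \<and> j = k then 1 / of_nat CARD('m) else 0)" for i j k l
  proof -
    let ?E = "(\<chi> a b. if a = j \<and> b = k then 1 else 0) :: complex^'m^'m"
    have "trace ?E = (if j = k then 1 else 0)"
    proof -
      have "(if a = j \<and> a = k then 1 else 0) = (if a = j then (if j = k then 1 else 0) else (0::complex))" for a by auto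
      then show ?thesis by (simp add: trace_def)
    qed
    moreover have "(LINT g|\<mu>. \<rho> g $ i $ j * \<rho> (inv g) $ k $ l) = matrix_integral \<mu> (\<lambda>g. \<rho> g ** ?E ** \<rho> (inv g)) $ i $ l"
      unfolding matrix_integral_def by (simp add: matrix_unit_sandwich)
    ultimately show ?thesis unfolding average_conjugation by (simp add: mat_def)
  qed
  show ?thesis
    using main[of i j k l] main[of k l i j] by (cases s) (auto simp: rep_letter_def mult.commute)
qed

lemma entry_product_integrable:
  fixes F H :: "'a \<Rightarrow> complex^'m^'m"
  assumes "bounded_matrix_function \<mu> F" "bounded_matrix_function \<mu> H"
  shows "integrable \<mu> (\<lambda>g. F g $ i $ j * H g $ k $ l)"
proof -
  have "bounded_matrix_function \<mu> (\<lambda>g. F g ** (\<chi> a b. if a = j \<and> b = k then 1 else 0) ** H g)"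
    by (intro bounded_matrix_function_mult assms bounded_matrix_function_const)
  from haar.integrable_bounded_matrix_entry[OF this, of i l] show ?thesis by (simp add: matrix_unit_sandwich)
qed

lemma square_moment_entry:
  fixes F :: "'a \<Rightarrow> complex^'m^'m"
  assumes F: "bounded_matrix_function \<mu> F"
  shows "matrix_integral \<mu> (\<lambda>g. F g ** A ** F g) $ i $ l =
    (\<Sum>k\<in>UNIV. \<Sum>j\<in>UNIV. A $ j $ k * (LINT g|\<mu>. F g $ i $ j * F g $ k $ l))"
proof -
  have "(F g ** A ** F g) $ i $ l = (\<Sum>k\<in>UNIV. \<Sum>j\<in>UNIV. A $ j $ k * (F g $ i $ j * F g $ k $ l))" for g
    by (simp add: matrix_matrix_mult_def sum_distrib_right sum_distrib_left mult_ac)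
  then show ?thesis
    unfolding matrix_integral_def by (simp add: Bochner_Integration.integral_sum entry_product_integrable[OF F F])
qed

text \<open>Equivalently, \<open>J\<close> intertwines the dual representation with \<open>\<rho>\<close>. By left
invariance of the measure, every average of \<open>\<rho> g ** A ** transpose (\<rho> g)\<close> is an invariant tensor.\<close>

definition invariant_tensor :: "complex^'m^'m \<Rightarrow> bool" where
  "invariant_tensor J \<longleftrightarrow> (\<forall>g\<in>carrier G. \<rho> g ** J ** transpose (\<rho> g) = J)"

lemma transpose_rep_inv:
  assumes "g \<in> carrier G"
  shows "transpose (\<rho> g) ** transpose (\<rho> (inv g)) = mat 1" "transpose (\<rho> (inv g)) ** transpose (\<rho> g) = mat 1"
  using rep_inv[OF assms] by (simp_all add: matrix_transpose_mul[symmetric] transpose_mat)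

lemma invariant_tensor_swap:
  assumes "invariant_tensor J" "g \<in> carrier G"
  shows "J ** transpose (\<rho> g) = \<rho> (inv g) ** J"
proof -
  have "\<rho> (inv g) ** (\<rho> g ** J ** transpose (\<rho> g)) = \<rho> (inv g) ** J"
    using assms unfolding invariant_tensor_def by simp
  then show ?thesis using rep_inv(2)[OF assms(2)] by (simp add: matrix_mul_assoc)
qed

lemma invariant_tensor_invertible:
  assumes J: "invariant_tensor J" "J \<noteq> 0" shows "invertible J"
proof -
  let ?W = "range (\<lambda>x. J *v x)"
  have "?W = {0} \<or> ?W = UNIV"
  proof (rule invariant_subspace[OF subspace_range])
    fix g x assume g: "g \<in> carrier G" and "x \<in> ?W"
    then obtain y where "x = J *v y" by blast
    then have "\<rho> g *v x = (J ** transpose (\<rho> (inv g))) *v y"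
      using invariant_tensor_swap[OF J(1), of "inv g"] g by (simp add: matrix_vector_mul_assoc)
    then show "\<rho> g *v x \<in> ?W" by (simp add: matrix_vector_mul_assoc[symmetric])
  qed
  moreover have "?W \<noteq> {0}"
  proof
    assume "?W = {0}"
    then have "J *v x = 0" for x by blast
    then have "J = 0" by (simp add: matrix_eq)
    then show False using J(2) by simp
  qed
  ultimately have "surj ((*v) J)" by simp
  then show ?thesis
    by (simp add: invertible_right_inverse matrix_right_invertible_surjective)
qed

text \<open>An invariant bilinear form is nondegenerate, as its kernel is an invariant subspace. Its inverse is
an invariant tensor.\<close>

lemma dual_invariant_tensor:
  assumes K: "\<And>g. g \<in> carrier G \<Longrightarrow> transpose (\<rho> (inv g)) ** K ** \<rho> (inv g) = K" and "K \<noteq> 0"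
  shows "\<exists>J. invariant_tensor J \<and> J \<noteq> 0"
proof -
  let ?W = "{x. K *v x = 0}"
  have swap: "K ** \<rho> g = transpose (\<rho> (inv g)) ** K" if g: "g \<in> carrier G" for g
  proof -
    have "transpose (\<rho> (inv g)) ** K ** \<rho> (inv g) ** \<rho> g = K ** \<rho> g" using K[OF g] by simp
    then show ?thesis using rep_inv(2)[OF g] by (simp add: matrix_mul_assoc[symmetric])
  qed
  have "?W = {0} \<or> ?W = UNIV"
  proof (rule invariant_subspace[OF subspace_kernel])
    fix g x assume g: "g \<in> carrier G" and x: "x \<in> ?W"
    have "(K ** \<rho> g) *v x = 0" unfolding swap[OF g] using x by (simp add: matrix_vector_mul_assoc[symmetric])
    then show "\<rho> g *v x \<in> ?W" by (simp add: matrix_vector_mul_assoc)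
  qed
  moreover have "?W \<noteq> UNIV"
  proof
    assume "?W = UNIV"
    then have "K *v x = 0" for x by blast
    then have "K = 0" by (simp add: matrix_eq)
    then show False using assms(2) by simp
  qed
  ultimately have "invertible K" unfolding invertible_left_inverse matrix_left_invertible_ker by blast
  then obtain J where J: "K ** J = mat 1" "J ** K = mat 1" unfolding invertible_def by blast
  have "\<rho> g ** J ** transpose (\<rho> g) = J" if g: "g \<in> carrier G" for g
  proof -
    have "\<rho> g ** J = J ** (K ** \<rho> g) ** J" using J by (simp add: matrix_mul_assoc)
    also have "\<dots> = J ** transpose (\<rho> (inv g)) ** (K ** J)" unfolding swap[OF g] by (simp add: matrix_mul_assoc)
    also have "\<dots> = J ** transpose (\<rho> (inv g))" using J by simp
    finally show ?thesis using transpose_rep_inv(2)[OF g] by (simp add: matrix_mul_assoc[symmetric])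
  qed
  moreover have "J \<noteq> 0"
  proof
    assume "J = 0"
    then have "(mat 1 :: complex^'m^'m) $ undefined $ undefined = 0" using J(1) by simp
    then show False by (simp add: mat_def)
  qed
  ultimately show ?thesis unfolding invariant_tensor_def by blast
qed

lemma indicator_as_trace:
  "frobenius_schur G \<mu> (character \<rho>) = trace (matrix_integral \<mu> (\<lambda>g. rep_letter True g ** mat 1 ** rep_letter True g))"
proof -
  let ?F = "\<lambda>g. rep_letter True g ** mat 1 ** rep_letter True g"
  have bF: "bounded_matrix_function \<mu> ?F"
    by (intro bounded_matrix_function_mult bounded_rep_letter bounded_matrix_function_const)
  have "trace (matrix_integral \<mu> ?F) = (LINT g|\<mu>. trace (?F g))"
    unfolding trace_def matrix_integral_def
    by (simp only: vec_lambda_beta Bochner_Integration.integral_sum haar.integrable_bounded_matrix_entry[OF bF])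
  also have "\<dots> = (LINT g|\<mu>. character \<rho> (g [^] (2::nat)))"
    by (rule Bochner_Integration.integral_cong[OF refl])
      (simp add: space_haar character_def rep_letter_def numeral_2_eq_2 rep_mult)
  finally show ?thesis unfolding frobenius_schur_def ..
qed

text \<open>Suitable averages of products of two entries are entries of invariant tensors or of
invariant bilinear forms, so all of them vanish if no nonzero invariant tensor exists.\<close>

lemma complex_type_moments:
  assumes none: "\<And>J. invariant_tensor J \<Longrightarrow> J = 0"
  shows "matrix_integral \<mu> (\<lambda>g. rep_letter s g ** A ** rep_letter s g) = 0"
proof -
  have "(LINT g|\<mu>. rep_letter s g $ i $ j * rep_letter s g $ k $ l) = 0" for i j k l
  proof (cases s)
    case True
    let ?E = "(\<chi> a b. if a = j \<and> b = l then 1 else 0) :: complex^'m^'m"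
    let ?F = "\<lambda>g. \<rho> g ** ?E ** transpose (\<rho> g)"
    have bF: "bounded_matrix_function \<mu> ?F"
      by (intro bounded_matrix_function_mult bounded_rep bounded_transpose bounded_matrix_function_const)
    have "invariant_tensor (matrix_integral \<mu> ?F)"
      unfolding invariant_tensor_def
    proof
      fix h assume h: "h \<in> carrier G"
      have "\<rho> h ** matrix_integral \<mu> ?F ** transpose (\<rho> h) = matrix_integral \<mu> (\<lambda>g. \<rho> h ** ?F g ** transpose (\<rho> h))"
        by (rule haar.matrix_integral_sandwich[OF bF, symmetric])
      also have "\<dots> = matrix_integral \<mu> (\<lambda>g. ?F (h \<otimes> g))"
        by (rule matrix_integral_cong) (use h in \<open>simp add: space_haar rep_mult matrix_transpose_mul matrix_mul_assoc\<close>)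
      finally show "\<rho> h ** matrix_integral \<mu> ?F ** transpose (\<rho> h) = matrix_integral \<mu> ?F"
        using matrix_integral_translate[OF h bF] by simp
    qed
    then have "matrix_integral \<mu> ?F = 0" by (rule none)
    then have "matrix_integral \<mu> ?F $ i $ k = 0" by simp
    then show ?thesis using True unfolding matrix_integral_def
      by (simp add: matrix_unit_sandwich rep_letter_def transpose_def)
  next
    case False
    let ?E = "(\<chi> a b. if a = i \<and> b = k then 1 else 0) :: complex^'m^'m"
    let ?F = "\<lambda>g. transpose (\<rho> (inv g)) ** ?E ** \<rho> (inv g)"
    have bF: "bounded_matrix_function \<mu> ?F"
      by (intro bounded_matrix_function_mult bounded_rep_inv bounded_transpose bounded_matrix_function_const)
    have "transpose (\<rho> (inv h)) ** matrix_integral \<mu> ?F ** \<rho> (inv h) = matrix_integral \<mu> ?F" if h: "h \<in> carrier G" for h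
    proof -
      have "transpose (\<rho> (inv h)) ** matrix_integral \<mu> ?F ** \<rho> (inv h)
          = matrix_integral \<mu> (\<lambda>g. transpose (\<rho> (inv h)) ** ?F g ** \<rho> (inv h))"
        by (rule haar.matrix_integral_sandwich[OF bF, symmetric])
      also have "\<dots> = matrix_integral \<mu> (\<lambda>g. ?F (h \<otimes> g))"
        by (rule matrix_integral_cong)
          (use h in \<open>simp add: space_haar rep_mult inv_mult_group matrix_transpose_mul matrix_mul_assoc\<close>)
      finally show ?thesis using matrix_integral_translate[OF h bF] by simp
    qed
    then have "matrix_integral \<mu> ?F = 0" using dual_invariant_tensor none by blast
    then have "matrix_integral \<mu> ?F $ j $ l = 0" by simp
    then show ?thesis using False unfolding matrix_integral_def
      by (simp add: matrix_unit_sandwich rep_letter_def transpose_def)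
  qed
  then show ?thesis by (simp add: vec_eq_iff square_moment_entry[OF bounded_rep_letter])
qed

text \<open>If there is a nonzero invariant tensor \<open>J\<close>, with inverse \<open>K\<close>, then \<open>transpose J ** K\<close> commutes with
the representation. Hence \<open>transpose J\<close> is \<open>e\<close> times \<open>J\<close>, and transposing twice gives \<open>e = \<plusminus>1\<close>. The
anti-automorphism \<open>A \<mapsto> J ** transpose A ** K\<close> maps \<open>\<rho> g\<close> to \<open>\<rho> (inv g)\<close>, which reduces the second moments of
\<open>\<rho>\<close> with itself to those of \<open>\<rho>\<close> with its inverse; taking the trace identifies \<open>e\<close> with the
Frobenius-Schur indicator.\<close>

theorem matrix_system_exists:
  obtains star where "matrix_system \<mu> rep_letter (1 / of_nat CARD('m)) (frobenius_schur G \<mu> (character \<rho>)) star"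
    and "frobenius_schur G \<mu> (character \<rho>) \<in> {0, 1, -1}"
proof (cases "\<exists>J. invariant_tensor J \<and> J \<noteq> 0")
  case False
  then have z: "matrix_integral \<mu> (\<lambda>g. rep_letter s g ** A ** rep_letter s g) = 0" for s A
    using complex_type_moments by blast
  have v: "frobenius_schur G \<mu> (character \<rho>) = 0" unfolding indicator_as_trace z by (simp add: trace_def)
  have "matrix_system \<mu> rep_letter (1 / of_nat CARD('m)) 0 transpose"
    by unfold_locales
      (simp_all only: bounded_rep_letter rep_pair_moment z matrix_transpose_mul transpose_mat, simp_all add: vec_eq_iff mat_mult_nth)
  then show ?thesis using that v by simp
next
  case True
  then obtain J where J: "invariant_tensor J" "J \<noteq> 0" by blast
  obtain K where K: "J ** K = mat 1" "K ** J = mat 1"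
    using invariant_tensor_invertible[OF J] unfolding invertible_def by blast
  have swap: "K ** \<rho> g = transpose (\<rho> (inv g)) ** K" if g: "g \<in> carrier G" for g
  proof -
    have "J ** transpose (\<rho> (inv g)) = \<rho> g ** J" using invariant_tensor_swap[OF J(1), of "inv g"] g by simp
    then have "K ** (J ** transpose (\<rho> (inv g))) ** K = K ** (\<rho> g ** J) ** K" by simp
    then have "(K ** J) ** transpose (\<rho> (inv g)) ** K = K ** \<rho> g ** (J ** K)" by (simp add: matrix_mul_assoc)
    then show ?thesis using K by simp
  qed
  have Jt: "invariant_tensor (transpose J)"
    unfolding invariant_tensor_def
  proof
    fix g assume "g \<in> carrier G"
    then have "transpose (\<rho> g ** J ** transpose (\<rho> g)) = transpose J" using J(1) unfolding invariant_tensor_def by simp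
    then show "\<rho> g ** transpose J ** transpose (\<rho> g) = transpose J" by (simp add: matrix_transpose_mul matrix_mul_assoc)
  qed
  have "\<rho> g ** (transpose J ** K) = (transpose J ** K) ** \<rho> g" if g: "g \<in> carrier G" for g
  proof -
    have "\<rho> g ** transpose J = transpose J ** transpose (\<rho> (inv g))"
      using invariant_tensor_swap[OF Jt, of "inv g"] g by simp
    then have "\<rho> g ** (transpose J ** K) = transpose J ** (transpose (\<rho> (inv g)) ** K)" by (simp add: matrix_mul_assoc)
    then show ?thesis unfolding swap[OF g, symmetric] by (simp add: matrix_mul_assoc)
  qed
  then obtain e where e: "transpose J ** K = mat e" using schur_scalar by blast
  have tJ: "transpose J = mat e ** J"
  proof -
    have "transpose J ** (K ** J) = mat e ** J" using e by (simp add: matrix_mul_assoc)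
    then show ?thesis using K by simp
  qed
  have tJn: "J $ b $ a = e * J $ a $ b" for a b
    using arg_cong[OF tJ, of "\<lambda>M. M $ a $ b"] by (simp add: transpose_def mat_mult_nth)
  have e2: "e * e = 1"
  proof -
    obtain a b where ab: "J $ a $ b \<noteq> 0" using J(2) by (auto simp: vec_eq_iff)
    have "J $ a $ b = e * (e * J $ a $ b)" using tJn[of a b] tJn[of b a] by simp
    then show ?thesis using ab by (metis (no_types, lifting) mult.assoc mult_cancel_right1 mult.commute)
  qed
  define star where "star A = J ** transpose A ** K" for A
  have star_letter: "star (rep_letter s g) = rep_letter (\<not> s) g" if g: "g \<in> carrier G" for s g
  proof -
    have "star (\<rho> h) = \<rho> (inv h)" if h: "h \<in> carrier G" for h
    proof -
      have "star (\<rho> h) = \<rho> (inv h) ** (J ** K)"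
        unfolding star_def invariant_tensor_swap[OF J(1) h] by (simp add: matrix_mul_assoc)
      then show ?thesis using K by simp
    qed
    then show ?thesis using g by (simp add: rep_letter_def)
  qed
  let ?d = "of_nat CARD('m) :: complex"
  have corr: "(LINT g|\<mu>. rep_letter s g $ i $ j * rep_letter s g $ k $ l) = J $ k $ i * K $ j $ l / ?d" for s i j k l
  proof -
    have "(LINT g|\<mu>. rep_letter s g $ i $ j * rep_letter s g $ k $ l)
       = (LINT g|\<mu>. (\<Sum>b\<in>UNIV. \<Sum>a\<in>UNIV. J $ k $ a * K $ b $ l * (rep_letter s g $ i $ j * rep_letter (\<not> s) g $ b $ a)))"
    proof (rule Bochner_Integration.integral_cong[OF refl])
      fix g assume "g \<in> space \<mu>"
      then have "rep_letter s g = star (rep_letter (\<not> s) g)" using star_letter[of g "\<not> s"] by (simp add: space_haar)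
      then have "rep_letter s g $ k $ l = (\<Sum>b\<in>UNIV. \<Sum>a\<in>UNIV. J $ k $ a * rep_letter (\<not> s) g $ b $ a * K $ b $ l)"
        by (simp add: star_def matrix_matrix_mult_def transpose_def sum_distrib_right)
      then show "rep_letter s g $ i $ j * rep_letter s g $ k $ l
         = (\<Sum>b\<in>UNIV. \<Sum>a\<in>UNIV. J $ k $ a * K $ b $ l * (rep_letter s g $ i $ j * rep_letter (\<not> s) g $ b $ a))"
        by (simp add: sum_distrib_left mult_ac)
    qed
    also have "\<dots> = (\<Sum>b\<in>UNIV. \<Sum>a\<in>UNIV. J $ k $ a * K $ b $ l * (LINT g|\<mu>. rep_letter s g $ i $ j * rep_letter (\<not> s) g $ b $ a))"
      by (simp add: Bochner_Integration.integral_sum entry_product_integrable[OF bounded_rep_letter bounded_rep_letter])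
    also have "\<dots> = (\<Sum>b\<in>UNIV. \<Sum>a\<in>UNIV. if a = i then (if b = j then J $ k $ a * K $ b $ l / ?d else 0) else 0)"
      unfolding rep_pair_moment by (intro sum.cong) auto
    also have "\<dots> = J $ k $ i * K $ j $ l / ?d" by (simp only: sum.delta finite UNIV_I if_True)
    finally show ?thesis .
  qed
  have square: "matrix_integral \<mu> (\<lambda>g. rep_letter s g ** A ** rep_letter s g) = mat (e * (1 / ?d)) ** star A" for s A
  proof -
    have "matrix_integral \<mu> (\<lambda>g. rep_letter s g ** A ** rep_letter s g) $ i $ l = (mat (e * (1 / ?d)) ** star A) $ i $ l" for i l
    proof -
      have "matrix_integral \<mu> (\<lambda>g. rep_letter s g ** A ** rep_letter s g) $ i $ l
        = (\<Sum>k\<in>UNIV. \<Sum>j\<in>UNIV. A $ j $ k * ((e * J $ i $ k) * K $ j $ l / ?d))"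
        unfolding square_moment_entry[OF bounded_rep_letter] corr tJn[of _ i] ..
      also have "\<dots> = e * (1 / ?d) * (\<Sum>k\<in>UNIV. \<Sum>j\<in>UNIV. J $ i $ k * A $ j $ k * K $ j $ l)"
        by (simp add: sum_distrib_left mult_ac)
      also have "(\<Sum>k\<in>UNIV. \<Sum>j\<in>UNIV. J $ i $ k * A $ j $ k * K $ j $ l) = star A $ i $ l"
        unfolding star_def by (subst sum.swap) (simp add: matrix_matrix_mult_def transpose_def sum_distrib_right)
      finally show ?thesis by (simp add: mat_mult_nth)
    qed
    then show ?thesis by (simp add: vec_eq_iff)
  qed
  have star1: "star (mat 1) = mat 1" using K by (simp add: star_def transpose_mat)
  have v: "frobenius_schur G \<mu> (character \<rho>) = e"
    unfolding indicator_as_trace square star1 by (simp add: mat_mult_mat trace_def) (simp add: mat_def)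
  have star_mult: "star (A ** B) = star B ** star A" for A B
  proof -
    have "star B ** star A = J ** transpose B ** (K ** J) ** transpose A ** K" by (simp add: star_def matrix_mul_assoc)
    then show ?thesis using K by (simp add: star_def matrix_transpose_mul matrix_mul_assoc)
  qed
  have "matrix_system \<mu> rep_letter (1 / ?d) e star"
    by unfold_locales
      (simp_all only: bounded_rep_letter rep_pair_moment square star1 star_mult, simp_all add: star_letter space_haar)
  moreover have "e = 1 \<or> e = -1" using e2 by (metis square_eq_1_iff)
  ultimately show ?thesis using that v by auto
qed

end

section \<open>The integral of a surface word\<close>

lemma surface_each_letter_twice:
  assumes X: "surface (word_complex w)"
  shows "each_letter_twice w"
  unfolding each_letter_twice_def
proof
  fix x
  let ?occ = "{j. j < length w \<and> fst (w ! j) = x}"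
  show "count_list (map fst w) x \<in> {0, 2}"
  proof (cases "?occ = {}")
    case True
    show ?thesis unfolding count_letters_positions True by simp
  next
    case False
    then obtain j where j: "j < length w" "fst (w ! j) = x" by blast
    obtain k where k: "k < length w" "k \<noteq> j" "fst (w ! k) = fst (w ! j)"
      using surface_letter_twice[OF X j(1)] by blast
    have "?occ = {j, k}"
    proof
      show "?occ \<subseteq> {j, k}"
      proof
        fix i assume "i \<in> ?occ"
        then have i: "i < length w" "fst (w ! i) = fst (w ! j)" unfolding mem_Collect_eq j(2) by blast+
        have "i = j \<or> i = k"
          by (rule surface_letter_at_most_twice[OF X j(1) k(1) k(3)[symmetric] k(2)[symmetric] i])
        then show "i \<in> {j, k}" by blast
      qed
      have "fst (w ! k) = x" using k(3) j(2) by (rule trans)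
      then show "{j, k} \<subseteq> ?occ" using j k(1) by blast
    qed
    then show ?thesis unfolding count_letters_positions using k(2) by simp
  qed
qed

text \<open>When each letter occurs twice, having no repeated entry means having opposite signs at the two
occurrences of every letter.\<close>

lemma orientable_iff_distinct:
  assumes X: "surface (word_complex w)"
  shows "orientable (word_complex w) \<longleftrightarrow> distinct w"
proof
  assume or: "orientable (word_complex w)"
  show "distinct w"
    unfolding distinct_conv_nth
  proof (intro allI impI notI)
    fix j k assume "j < length w" "k < length w" "j \<noteq> k" "w ! j = w ! k"
    then show False using orientable_opposite_signs[OF X or, of j k] by simp
  qed
next
  assume d: "distinct w"
  show "orientable (word_complex w)"
  proof (rule opposite_signs_orientable[OF X])
    fix j k assume jk: "j < length w" "k < length w" "fst (w ! j) = fst (w ! k)" "j \<noteq> k"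
    have "w ! j \<noteq> w ! k" using nth_eq_iff_index_eq[OF d jk(1,2)] jk(4) by simp
    then show "snd (w ! j) \<noteq> snd (w ! k)" using jk(3) by (simp add: prod_eq_iff)
  qed
qed

context irreducible_haar
begin

lemma rep_word_eval:
  assumes "\<And>x. x \<in> word_letters w \<Longrightarrow> t x \<in> carrier G"
  shows "word_eval G w t \<in> carrier G \<and>
    \<rho> (word_eval G w t) = foldr (\<lambda>(x, s) A. rep_letter s (t x) ** A) w (mat 1)"
  using assms
proof (induction w)
  case Nil
  then show ?case by (simp add: word_eval_def rep_one)
next
  case (Cons l w)
  obtain x s where l: "l = (x, s)" by fastforce
  have tx: "(if s then t x else inv (t x)) \<in> carrier G" using Cons.prems[of x] by (simp add: l)
  have IH: "word_eval G w t \<in> carrier G"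
    "\<rho> (word_eval G w t) = foldr (\<lambda>(x, s) A. rep_letter s (t x) ** A) w (mat 1)"
    using Cons by auto
  have "word_eval G (l # w) t = (if s then t x else inv (t x)) \<otimes> word_eval G w t"
    by (simp add: word_eval_def l)
  then show ?case using tx IH by (simp add: rep_mult rep_letter_def l)
qed

theorem integral_word_reduction:
  assumes "word_reduction w E N v" "word_letters w \<subseteq> {..<n}"
  shows "matrix_integral (Pi\<^sub>M {..<n} (\<lambda>_. \<mu>)) (\<lambda>t. \<rho> (word_eval G w t)) =
    mat (frobenius_schur G \<mu> (character \<rho>) ^ N * (1 / of_nat CARD('m)) ^ E * of_nat CARD('m) ^ v)"
proof -
  obtain star where "matrix_system \<mu> rep_letter (1 / of_nat CARD('m)) (frobenius_schur G \<mu> (character \<rho>)) star"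
    using matrix_system_exists by blast
  then interpret S: matrix_system \<mu> rep_letter "1 / of_nat CARD('m)" "frobenius_schur G \<mu> (character \<rho>)" star .
  have "matrix_integral (Pi\<^sub>M {..<n} (\<lambda>_. \<mu>)) (\<lambda>t. \<rho> (word_eval G w t)) =
    matrix_integral (Pi\<^sub>M {..<n} (\<lambda>_. \<mu>)) (S.word_matrix w)"
  proof (rule matrix_integral_cong)
    fix t assume t: "t \<in> space (Pi\<^sub>M {..<n} (\<lambda>_. \<mu>))"
    have "t x \<in> carrier G" if "x \<in> word_letters w" for x
      using t that assms(2) by (auto simp: space_PiM PiE_iff space_haar)
    then show "\<rho> (word_eval G w t) = S.word_matrix w t" using rep_word_eval[of w t] by (simp add: S.word_matrix_def)
  qed
  then show ?thesis using S.matrix_integral_word_matrix[OF assms(1) _ assms(2)] by simp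
qed

end

theorem theorem4p1:
  fixes G :: "('a, 'b) monoid_scheme"
    and T :: "'a topology"
    and \<mu> :: "'a measure"
    and \<rho> :: "'a \<Rightarrow> complex^'m^'m"
    and n :: nat
    and w :: group_word
  assumes "compact_group G T"
    and "normalized_haar_measure G T \<mu>"
    and "irreducible_representation G T \<rho>"
    and "word_letters w \<subseteq> {..<n}"
    and "surface (word_complex w)"
  shows "(orientable (word_complex w) \<longrightarrow>
            matrix_integral (Pi\<^sub>M {..<n} (\<lambda>_. \<mu>)) (\<lambda>t. \<rho> (word_eval G w t)) =
              mat (of_nat CARD('m) powi (euler_characteristic w - 2))) \<and>
         (\<not> orientable (word_complex w) \<longrightarrow>
            matrix_integral (Pi\<^sub>M {..<n} (\<lambda>_. \<mu>)) (\<lambda>t. \<rho> (word_eval G w t)) =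
              mat (frobenius_schur G \<mu> (character \<rho>) powi (2 - euler_characteristic w) *
                   of_nat CARD('m) powi (euler_characteristic w - 2)))"
proof -
  interpret irreducible_haar G T \<mu> \<rho>
    using assms(1-3) by (simp add: irreducible_haar_def irreducible_haar_axioms_def)
  have twice: "each_letter_twice w" by (rule surface_each_letter_twice[OF assms(5)])
  then obtain E N v where red: "word_reduction w E N v" using word_reduction_exists by blast
  note inv = word_reduction_invariants[OF red]
  \<comment> \<open>\<open>v + 1\<close> vertices, \<open>E\<close> edges and one face\<close>
  have \<kappa>: "euler_characteristic w = int v - int E + 2"
    unfolding euler_characteristic_def
    using card_zero_cells[OF red twice surface_word_nonempty[OF assms(5)]] inv(1) by simp
  let ?d = "of_nat CARD('m) :: complex" and ?\<nu> = "frobenius_schur G \<mu> (character \<rho>)"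
  have dim: "(1 / ?d) ^ E * ?d ^ v = ?d powi (euler_characteristic w - 2)"
    unfolding \<kappa> by (simp add: power_int_diff power_divide)
  note integral = integral_word_reduction[OF red assms(4)]
  have or: "orientable (word_complex w) \<longleftrightarrow> N = 0"
    using orientable_iff_distinct[OF assms(5)] inv(5) by simp
  \<comment> \<open>both exponents are positive and of the same parity, which suffices as \<open>?\<nu>\<close> is \<open>0\<close> or \<open>\<plusminus>1\<close>\<close>
  have sign: "?\<nu> ^ N = ?\<nu> powi (2 - euler_characteristic w)" if "N \<noteq> 0"
  proof -
    have "v < E" using inv(4) that by simp
    then have "2 - euler_characteristic w = int (E - v)" unfolding \<kappa> by (simp add: of_nat_diff)
    then have "?\<nu> powi (2 - euler_characteristic w) = ?\<nu> ^ (E - v)" by (simp only: power_int_of_nat)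
    moreover have "?\<nu> ^ N = ?\<nu> ^ (E - v)"
    proof -
      have parity: "even (E - v) \<longleftrightarrow> even N" using inv(2) \<open>v < E\<close> by auto
      have "?\<nu> \<in> {0, 1, -1}" using matrix_system_exists by blast
      then consider "?\<nu> = 0" | "?\<nu> = 1" | "?\<nu> = -1" unfolding insert_iff empty_iff by blast
      then show ?thesis
      proof cases
        case 1
        then show ?thesis using that \<open>v < E\<close> by (simp only: power_0_left) simp
      next
        case 3
        then show ?thesis by (simp only: minus_one_power_iff parity)
      qed (simp only: power_one)
    qed
    ultimately show ?thesis by simp
  qed
  show ?thesis
    unfolding integral mult.assoc dim or
  proof (intro conjI impI)
    assume "N = 0"
    then show "mat (?\<nu> ^ N * ?d powi (euler_characteristic w - 2)) = (mat (?d powi (euler_characteristic w - 2)) :: complex^'m^'m)"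
      by simp
  next
    assume "N \<noteq> 0"
    show "mat (?\<nu> ^ N * ?d powi (euler_characteristic w - 2)) =
        (mat (?\<nu> powi (2 - euler_characteristic w) * ?d powi (euler_characteristic w - 2)) :: complex^'m^'m)"
      unfolding sign[OF \<open>N \<noteq> 0\<close>] ..
  qed
qed

end
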